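(* Up to isomorphism, there is exactly one $3$-dicritical oriented graph with $20$ arcs, and every other $3$-dicritical oriented graph has more than $20$ arcs.
   Context: All digraphs are finite. An oriented graph is a digraph without loops, without parallel arcs and without directed $2$-cycles. A $k$-coloring of a digraph $D$ is a mapping from the vertices of $D$ to $\{1,\dots,k\}$ such that each color class induces an acyclic digraph (no directed cycle). The dichromatic number $\chi_d(D)$ is the minimum integer $k$ such that $D$ admits a $k$-coloring. A digraph $D$ is $k$-dicritical if $\chi_d(D)\ge k$ but $\chi_d(D')<k$ for every proper subdigraph $D'$ of $D$. *)

theory Defs
  imports "Graph_Theory.Graph_Theory"
begin

text \<open>The library's locale \<^locale>\<open>digraph\<close> is finite, loopless and without parallel arcs.\<close>

locale oriented_graph = digraph +
  assumes no_2cycles: "(u, v) \<in> arcs_ends G \<Longrightarrow> (v, u) \<notin> arcs_ends G"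

definition acyclic_digraph :: "('a, 'b) pre_digraph \<Rightarrow> bool" where
  "acyclic_digraph G \<longleftrightarrow> \<not> (\<exists>p. pre_digraph.cycle G p)"

definition dicoloring :: "('a, 'b) pre_digraph \<Rightarrow> nat \<Rightarrow> ('a \<Rightarrow> nat) \<Rightarrow> bool" where
  "dicoloring G k c \<longleftrightarrow>
     (\<forall>v\<in>verts G. c v \<in> {1..k}) \<and>
     (\<forall>i\<in>{1..k}. acyclic_digraph (G \<restriction> {v \<in> verts G. c v = i}))"

text \<open>
  A loop is a directed cycle, so a digraph with a loop has no coloring and its dichromatic
  number is then an unspecified natural number. Every finite loopless digraph has a coloring.
\<close>

definition dichromatic_number :: "('a, 'b) pre_digraph \<Rightarrow> nat" where
  "dichromatic_number G = (LEAST k. \<exists>c. dicoloring G k c)"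

definition dicritical :: "nat \<Rightarrow> ('a, 'b) pre_digraph \<Rightarrow> bool" where
  "dicritical k G \<longleftrightarrow>
     fin_digraph G \<and> k \<le> dichromatic_number G \<and>
     (\<forall>H. subgraph H G \<and> H \<noteq> G \<longrightarrow> dichromatic_number H < k)"

end

theory Submission
  imports Defs
begin

text \<open>
  Only two consequences of criticality are used: a 3-dicritical digraph \<open>G\<close> has no
  bipartition of its vertices into two acyclic sets, but every \<open>G - v\<close> has one. If
  \<open>V(G) - v\<close> is split into acyclic sets \<open>S\<close> and \<open>T\<close>, then
  \<open>v\<close> has an in-neighbor and an out-neighbor in \<open>S\<close> and in
  \<open>T\<close>, since otherwise \<open>v\<close> could join one of them as a source or a sink.
  So all in- and out-degrees are at least 2, and with at most 20 arcs there are at most 10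
  vertices.

  Counting arcs gives a vertex of in-degree exactly 2 (\<open>ex_in_degree_two\<close>). Over all
  such vertices \<open>v\<close> and all splittings of \<open>V(G) - v\<close>, let
  \<open>S\<close> have the least possible size \<open>p\<close>. List \<open>S\<close> and
  \<open>T\<close> in topological order and number the vertices so that \<open>v\<close> is
  \<open>0\<close>, then \<open>S\<close>, then \<open>T\<close>. This labelling
  (\<open>labelling\<close>) breaks most of the symmetry, since all arcs going backward within
  \<open>S\<close> or \<open>T\<close> are known to be absent, and it leaves twelve pairs
  \<open>(n, p)\<close> with \<open>2 \<le> p\<close>, \<open>2 p < n \<le> 10\<close>.

  A set of vertices is acyclic iff some ordering of it has no backward arc. Hence for every
  bipartition of the vertices and every ordering of its two parts, one of finitely many arcs is
  present; the minimality of \<open>p\<close> gives similar disjunctions for the splittings of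
  \<open>V(G) - u\<close> with a part of size less than \<open>p\<close>, where \<open>u\<close>
  has in-degree 2. For each \<open>(n, p)\<close> at most about five hundred of these
  disjunctions, the degree conditions and the bound on the number of arcs are propositional
  constraints on the possible arcs, and they are refuted by propositional search. The exception is
  \<open>(7, 2)\<close>, where they force 20 particular arcs to be present, and the bound excludes
  any further arc (\<open>arcs_unique\<close>).

  That the resulting digraph \<open>G0\<close> on 7 vertices is 3-dicritical is checked directly:
  ten of its directed triangles do not admit a 2-coloring without monochromatic triangle, and for
  each arc two orderings are given whose only backward arc is that one.
\<close>

section \<open>Acyclic vertex sets and backward arcs\<close>

definition acyclic_on :: "('v \<Rightarrow> 'v \<Rightarrow> bool) \<Rightarrow> 'v set \<Rightarrow> bool" where
  "acyclic_on r S \<longleftrightarrow> acyclic {(x, y). x \<in> S \<and> y \<in> S \<and> r x y}"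

primrec has_back :: "('v \<Rightarrow> 'v \<Rightarrow> bool) \<Rightarrow> 'v list \<Rightarrow> bool" where
  "has_back r [] \<longleftrightarrow> False"
| "has_back r (x # xs) \<longleftrightarrow> list_ex (\<lambda>y. r y x) xs \<or> has_back r xs"

lemma acyclic_on_subset: "acyclic_on r S \<Longrightarrow> T \<subseteq> S \<Longrightarrow> acyclic_on r T"
  unfolding acyclic_on_def by (erule acyclic_subset) auto

lemma acyclic_on_mono: "acyclic_on r S \<Longrightarrow> (\<And>x y. x \<in> S \<Longrightarrow> y \<in> S \<Longrightarrow> r' x y \<Longrightarrow> r x y) \<Longrightarrow> acyclic_on r' S"
  unfolding acyclic_on_def by (erule acyclic_subset) auto

lemma acyclic_on_converse: "acyclic_on (\<lambda>x y. r y x) S \<longleftrightarrow> acyclic_on r S"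
proof -
  have "{(x, y). x \<in> S \<and> y \<in> S \<and> r y x} = {(x, y). x \<in> S \<and> y \<in> S \<and> r x y}\<inverse>" by auto
  then show ?thesis by (simp add: acyclic_on_def)
qed

lemma acyclic_on_insert_source:
  assumes "acyclic_on r S" "\<And>y. y \<in> insert x S \<Longrightarrow> \<not> r y x"
  shows "acyclic_on r (insert x S)"
proof -
  let ?R = "\<lambda>S. {(x, y). x \<in> S \<and> y \<in> S \<and> r x y}"
  \<comment> \<open>Walks never enter \<open>x\<close>, so a closed walk stays in \<open>S\<close>.\<close>
  have *: "a \<noteq> x \<longrightarrow> (a, b) \<in> (?R S)\<^sup>+" and **: "b \<noteq> x" if "(a, b) \<in> (?R (insert x S))\<^sup>+" for a b
    using that
  proof (induction rule: trancl_induct)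
    case (base b)
    { case 1 then show ?case using base assms(2) by auto }
    { case 2 then show ?case using base assms(2) by auto }
  next
    case (step b c)
    { case 1
      have "b \<noteq> x" "c \<noteq> x" using step assms(2) by auto
      then have "(b, c) \<in> ?R S" using step(2) by auto
      then show ?case using step(3) by (auto intro: trancl_into_trancl) }
    { case 2 then show ?case using step assms(2) by auto }
  qed
  show ?thesis
    using * ** assms(1) unfolding acyclic_on_def acyclic_def by blast
qed

lemma acyclic_on_insert_sink:
  assumes "acyclic_on r S" "\<And>y. y \<in> insert x S \<Longrightarrow> \<not> r x y"
  shows "acyclic_on r (insert x S)"
  using acyclic_on_insert_source[of "\<lambda>x y. r y x" S x] assms by (simp add: acyclic_on_converse[of r])

text \<open>
  The first vertex of an ordering without backward arcs is a source.
\<close>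

lemma acyclic_on_if_not_has_back:
  "(\<And>x. \<not> r x x) \<Longrightarrow> \<not> has_back r xs \<Longrightarrow> acyclic_on r (set xs)"
proof (induction xs)
  case Nil
  then show ?case by (simp add: acyclic_on_def acyclic_def)
next
  case (Cons x xs)
  then show ?case by (auto simp: list_ex_iff intro!: acyclic_on_insert_source)
qed

lemma acyclic_on_ordering:
  assumes "finite S" "acyclic_on r S"
  obtains xs where "distinct xs" "set xs = S" "\<not> has_back r xs"
  using assms
proof (induction S arbitrary: thesis rule: finite_psubset_induct)
  case (psubset S)
  show ?case
  proof (cases "S = {}")
    case True
    then show ?thesis using psubset.prems(1)[of "[]"] by simp
  next
    case False
    let ?R = "{(x, y). x \<in> S \<and> y \<in> S \<and> r x y}"
    have "finite ?R" by (rule finite_subset[of _ "S \<times> S"]) (use psubset in auto)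
    then have wf: "wf ?R" using psubset.prems(2) by (simp add: acyclic_on_def finite_acyclic_wf)
    obtain x0 where "x0 \<in> S" using False by blast
    then obtain x where "x \<in> S" "\<forall>y. (y, x) \<in> ?R \<longrightarrow> y \<notin> S"
      using wf[unfolded wf_eq_minimal, THEN spec, THEN spec, of x0 S] by blast
    then have x: "x \<in> S" "\<And>y. y \<in> S \<Longrightarrow> \<not> r y x" by blast+
    have "acyclic_on r (S - {x})" using psubset.prems(2) by (rule acyclic_on_subset) auto
    then obtain xs where "distinct xs" "set xs = S - {x}" "\<not> has_back r xs"
      using psubset.IH[of "S - {x}"] x(1) by blast
    then show ?thesis
      using psubset.prems(1)[of "x # xs"] x by (auto simp: list_ex_iff)
  qed
qed

lemma has_back_map: "has_back r (map f xs) \<longleftrightarrow> has_back (\<lambda>i j. r (f i) (f j)) xs"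
  by (induction xs) (auto simp: list_ex_iff)

section \<open>Finite conjunctions of clauses\<close>

text \<open>
  The recursive predicates below say that a property holds for all sublists of a given length, for
  all lists with one entry left out, or for all tails of a list. Unfolding their equations on
  explicit lists yields the conjunctions that the propositional search works on, with nothing left
  to compute.
\<close>

fun choices :: "('v list \<Rightarrow> bool) \<Rightarrow> nat \<Rightarrow> 'v list \<Rightarrow> 'v list \<Rightarrow> bool" where
  "choices P 0 ys xs \<longleftrightarrow> P ys"
| "choices P (Suc k) ys [] \<longleftrightarrow> True"
| "choices P (Suc k) ys (x # xs) \<longleftrightarrow> choices P k (x # ys) xs \<and> choices P (Suc k) ys xs"

primrec omissions :: "('v list \<Rightarrow> bool) \<Rightarrow> 'v list \<Rightarrow> 'v list \<Rightarrow> bool" where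
  "omissions P ys [] \<longleftrightarrow> True"
| "omissions P ys (x # xs) \<longleftrightarrow> P (ys @ xs) \<and> omissions P (ys @ [x]) xs"

primrec all_tails :: "('v \<Rightarrow> 'v list \<Rightarrow> bool) \<Rightarrow> 'v list \<Rightarrow> bool" where
  "all_tails P [] \<longleftrightarrow> True"
| "all_tails P (x # xs) \<longleftrightarrow> P x xs \<and> all_tails P xs"

lemma all_tails_uptI:
  "(\<And>i. a \<le> i \<Longrightarrow> i < b \<Longrightarrow> P i [Suc i..<b]) \<Longrightarrow> all_tails P [a..<b]"
  by (induction "b - a" arbitrary: a) (auto simp: upt_conv_Cons)

lemma choicesI:
  "(\<And>zs. distinct zs \<Longrightarrow> set zs \<subseteq> set ys \<union> set xs \<Longrightarrow> length zs = length ys + k \<Longrightarrow> P zs)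
    \<Longrightarrow> distinct (ys @ xs) \<Longrightarrow> choices P k ys xs"
proof (induction P k ys xs rule: choices.induct)
  case (3 P k ys x xs)
  show ?case unfolding choices.simps
  proof
    show "choices P k (x # ys) xs"
      by (rule "3.IH"(1), rule "3.prems"(1)) (use "3.prems"(2) in auto)
    show "choices P (Suc k) ys xs"
      by (rule "3.IH"(2), rule "3.prems"(1)) (use "3.prems"(2) in auto)
  qed
qed auto

lemma omissionsI:
  "(\<And>zs x. insert x (set zs) = set ys \<union> set xs \<Longrightarrow> x \<notin> set zs \<Longrightarrow> P zs)
    \<Longrightarrow> distinct (ys @ xs) \<Longrightarrow> omissions P ys xs"
proof (induction xs arbitrary: ys)
  case (Cons x xs)
  have "P (ys @ xs)" by (rule Cons.prems(1)[of x]) (use Cons.prems in auto)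
  moreover have "omissions P (ys @ [x]) xs"
    by (rule Cons.IH) (use Cons.prems in auto)
  ultimately show ?case by simp
qed simp

text \<open>
  A splitting \<open>(us, xs, ys)\<close> stands for an ordered bipartition \<open>xs\<close>,
  \<open>ys\<close> of all \<open>n\<close> vertices if \<open>us\<close> is empty, and of the
  vertices other than \<open>u\<close> if \<open>us\<close> is \<open>[u]\<close>; in the second
  case the minimality of \<open>p\<close> is to be applied, which needs the first part to be
  short.
\<close>

definition admissible_split :: "nat \<Rightarrow> nat \<Rightarrow> nat list \<times> nat list \<times> nat list \<Rightarrow> bool" where
  "admissible_split n p = (\<lambda>(us, xs, ys).
     (let zs = us @ xs @ ys in distinct zs \<and> length zs = n \<and> list_all (\<lambda>z. z < n) zs) \<and>
     (us = [] \<or> length us = 1 \<and> length xs < p))"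

text \<open>
  Here \<open>D u 3\<close> means that \<open>u\<close> has in-degree at least 3.
\<close>

definition split_clause :: "(nat \<Rightarrow> nat \<Rightarrow> bool) \<Rightarrow> (nat \<Rightarrow> nat \<Rightarrow> bool) \<Rightarrow> nat list \<times> nat list \<times> nat list \<Rightarrow> bool" where
  "split_clause e D = (\<lambda>(us, xs, ys). list_ex (\<lambda>u. D u 3) us \<or> has_back e xs \<or> has_back e ys)"

lemma split_clause_simp: "split_clause e D (us, xs, ys) \<longleftrightarrow> list_ex (\<lambda>u. D u 3) us \<or> has_back e xs \<or> has_back e ys"
  by (simp add: split_clause_def)

section \<open>Labelled critical digraphs\<close>

text \<open>
  The digraph \<open>e\<close> on the vertices below \<open>n\<close> has been numbered as
  described at the beginning: vertex 0 has in-degree 2, and the vertices \<open>1, ..., p\<close>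
  and the vertices from \<open>p + 1\<close> on are two acyclic sets in topological order.
\<close>

locale critical_labelling =
  fixes n p :: nat and e :: "nat \<Rightarrow> nat \<Rightarrow> bool"
  assumes asym: "i < n \<Longrightarrow> j < n \<Longrightarrow> e i j \<Longrightarrow> \<not> e j i"
    and out_ge: "i < n \<Longrightarrow> 2 \<le> card {j. j < n \<and> e i j}"
    and in_ge: "i < n \<Longrightarrow> 2 \<le> card {j. j < n \<and> e j i}"
    and size_out: "(\<Sum>i<n. card {j. j < n \<and> e i j}) \<le> 20"
    and size_in: "(\<Sum>i<n. card {j. j < n \<and> e j i}) \<le> 20"
    and in_0: "card {j. j < n \<and> e j 0} \<le> 2"
    and sorted: "\<not> has_back e [1..<Suc p]" "\<not> has_back e [Suc p..<n]"
    and bipartition: "distinct (xs @ ys) \<Longrightarrow> set (xs @ ys) = {..<n} \<Longrightarrow> has_back e xs \<or> has_back e ys"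
    and small_part: "distinct (u # xs @ ys) \<Longrightarrow> set (u # xs @ ys) = {..<n} \<Longrightarrow> length xs < p \<Longrightarrow>
      card {j. j < n \<and> e j u} \<le> 2 \<Longrightarrow> has_back e xs \<or> has_back e ys"

text \<open>
  \<open>D v k\<close> says that \<open>v\<close> has degree at least \<open>k\<close>, and
  \<open>T v j\<close> that the vertices below \<open>v\<close> exceed the degree 2 by at least
  \<open>j\<close> in total. The search treats \<open>D\<close> and \<open>T\<close> as unknown
  relations; they make the bound on the number of arcs accessible to propositional reasoning. As
  all degrees are at least 2, a total excess of \<open>21 - 2 n\<close> is too much.
\<close>

definition counts :: "nat \<Rightarrow> (nat \<Rightarrow> nat \<Rightarrow> bool) \<Rightarrow> (nat \<Rightarrow> nat \<Rightarrow> bool) \<Rightarrow> (nat \<Rightarrow> nat \<Rightarrow> bool) \<Rightarrow> bool" where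
  "counts n f D T \<longleftrightarrow>
     (\<forall>v k. D v k \<longleftrightarrow> k \<le> card {j. j < n \<and> f v j}) \<and>
     (\<forall>v j. T v j \<longleftrightarrow> 2 * v + j \<le> (\<Sum>u<v. card {j. j < n \<and> f u j})) \<and>
     (\<forall>v<n. 2 \<le> card {j. j < n \<and> f v j}) \<and>
     (\<Sum>v<n. card {j. j < n \<and> f v j}) \<le> 20"

lemma counts_choices:
  assumes "counts n f D T" "l = k"
  shows "choices (\<lambda>xs. list_all (f v) xs \<longrightarrow> D v l) k [] [0..<n]"
proof (rule choicesI)
  fix zs assume z: "distinct zs" "set zs \<subseteq> set [] \<union> set [0..<n]" "length zs = length ([] :: nat list) + k"
  show "list_all (f v) zs \<longrightarrow> D v l"
  proof
    assume "list_all (f v) zs"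
    then have "set zs \<subseteq> {j. j < n \<and> f v j}" using z by (auto simp: list_all_iff)
    then have "card (set zs) \<le> card {j. j < n \<and> f v j}" by (intro card_mono) auto
    then show "D v l" using z assms by (simp add: distinct_card counts_def)
  qed
qed simp

lemma counts_sum:
  assumes "counts n f D T"
  shows "T 0 0"
    and "list_all (\<lambda>(v, v'). all_tails (\<lambda>j js. list_all (\<lambda>(j', l). T v j \<and> D v l \<longrightarrow> T v' j')
        (zip (j # js) [2..<24 - 2 * n])) [0..<22 - 2 * n]) (zip [0..<n] [1..<Suc n])"
    and "list_all (\<lambda>v. D v 2) [0..<n]"
    and "list_all (\<lambda>v. \<not> T v (21 - 2 * n)) [0..<Suc n]"
proof -
  let ?d = "\<lambda>v. card {j. j < n \<and> f v j}"
  have D: "D v k \<longleftrightarrow> k \<le> ?d v" and T: "T v j \<longleftrightarrow> 2 * v + j \<le> (\<Sum>u<v. ?d u)" for v j k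
    using assms by (simp_all add: counts_def)
  have ge: "2 \<le> ?d v" if "v < n" for v using assms that by (simp add: counts_def)
  show "T 0 0" by (simp add: T)
  show "list_all (\<lambda>v. D v 2) [0..<n]" using ge by (simp add: list_all_iff D)
  have step: "T (Suc v) (j + k)" if "T v j" "D v (2 + k)" for v j k
    using that by (simp add: T D)
  show "list_all (\<lambda>(v, v'). all_tails (\<lambda>j js. list_all (\<lambda>(j', l). T v j \<and> D v l \<longrightarrow> T v' j')
        (zip (j # js) [2..<24 - 2 * n])) [0..<22 - 2 * n]) (zip [0..<n] [1..<Suc n])"
    unfolding list_all_iff
  proof safe
    fix v v' assume "(v, v') \<in> set (zip [0..<n] [1..<Suc n])"
    then have v': "v' = Suc v" by (auto simp: set_zip simp del: upt_Suc)
    show "all_tails (\<lambda>j js. \<forall>(j', l)\<in>set (zip (j # js) [2..<24 - 2 * n]). T v j \<and> D v l \<longrightarrow> T v' j')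
        [0..<22 - 2 * n]"
    proof (rule all_tails_uptI, safe)
      fix j j' l assume *: "j < 22 - 2 * n" "(j', l) \<in> set (zip (j # [Suc j..<22 - 2 * n]) [2..<24 - 2 * n])"
        "T v j" "D v l"
      have "j # [Suc j..<22 - 2 * n] = [j..<22 - 2 * n]" using *(1) by (simp add: upt_conv_Cons)
      then obtain k where "j' = j + k" "l = 2 + k" using *(2) by (auto simp: set_zip)
      then show "T v' j'" using step *(3,4) v' by simp
    qed
  qed
  have "\<not> T v (21 - 2 * n)" if "v \<le> n" for v
  proof -
    have "(\<Sum>u<n. ?d u) = (\<Sum>u<v. ?d u) + (\<Sum>u\<in>{v..<n}. ?d u)"
      using sum.atLeastLessThan_concat[of 0 v n ?d] that by (simp add: atLeast0LessThan)
    moreover have "(\<Sum>u\<in>{v..<n}. ?d u) \<ge> 2 * (n - v)"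
      using sum_mono[of "{v..<n}" "\<lambda>_. 2" ?d] ge by simp
    moreover have "(\<Sum>u<n. ?d u) \<le> 20" using assms by (simp add: counts_def)
    ultimately show ?thesis using that unfolding T by linarith
  qed
  then show "list_all (\<lambda>v. \<not> T v (21 - 2 * n)) [0..<Suc n]" unfolding list_all_iff by auto
qed

context critical_labelling begin

lemma asym_clauses: "list_all (\<lambda>v. list_all (\<lambda>w. \<not> (e v w \<and> e w v)) [0..<n]) [0..<n]"
  using asym by (auto simp: list_all_iff)

lemma omission_clause:
  assumes "2 \<le> card {j. j < n \<and> P j}"
  shows "omissions (list_ex P) [] [0..<n]"
proof (rule omissionsI)
  fix zs x assume z: "insert x (set zs) = set [] \<union> set [0..<n]"
  show "list_ex P zs"
  proof (rule ccontr)
    assume "\<not> list_ex P zs"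
    then have "{j. j < n \<and> P j} \<subseteq> {x}" using z by (auto simp: list_ex_iff)
    then have "card {j. j < n \<and> P j} \<le> card {x}" by (intro card_mono) auto
    then show False using assms by simp
  qed
qed simp

text \<open>
  At least two neighbors: after leaving out any vertex, one is still there.
\<close>

lemma degree_clauses:
  "list_all (\<lambda>v. omissions (list_ex (e v)) [] [0..<n]) [0..<n]"
  "list_all (\<lambda>v. omissions (list_ex (\<lambda>w. e w v)) [] [0..<n]) [0..<n]"
  using omission_clause out_ge in_ge by (auto simp: list_all_iff)

lemma split_clauses:
  assumes "\<And>v k. D v k \<longleftrightarrow> k \<le> card {j. j < n \<and> e j v}" "list_all (admissible_split n p) ps"
  shows "list_all (split_clause e D) ps"
  unfolding list_all_iff
proof
  fix q assume "q \<in> set ps"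
  moreover obtain us xs ys where q: "q = (us, xs, ys)" by (metis surj_pair)
  ultimately have v: "distinct (us @ xs @ ys)" "length (us @ xs @ ys) = n" "set (us @ xs @ ys) \<subseteq> {..<n}"
      "us = [] \<or> length us = 1 \<and> length xs < p"
    using assms(2) by (auto simp: list_all_iff admissible_split_def Let_def)
  have s: "set (us @ xs @ ys) = {..<n}"
    by (rule card_subset_eq) (use v in \<open>auto simp: distinct_card[OF v(1)] simp del: set_append\<close>)
  show "split_clause e D q"
  proof (cases us)
    case Nil
    then show ?thesis using bipartition[of xs ys] v s by (simp add: q split_clause_def)
  next
    case (Cons u us')
    then have us: "us = [u]" using v by simp
    then show ?thesis using small_part[of u xs ys] v s assms(1)[of u 3] by (auto simp: q split_clause_def)
  qed
qed

lemma in_counts: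
  obtains D T where "counts n (\<lambda>i j. e j i) D T" "\<not> D 0 3"
    "\<And>ss. list_all (admissible_split n p) ss \<Longrightarrow> list_all (split_clause e D) ss"
proof
  let ?D = "\<lambda>v k. k \<le> card {j. j < n \<and> e j v}"
  show "counts n (\<lambda>i j. e j i) ?D (\<lambda>v j. 2 * v + j \<le> (\<Sum>u<v. card {j. j < n \<and> e j u}))"
    using in_ge size_in by (simp add: counts_def)
  show "\<not> ?D 0 3" using in_0 by simp
  show "list_all (split_clause e ?D) ss" if "list_all (admissible_split n p) ss" for ss
    using split_clauses[of ?D ss] that by simp
qed

lemma out_counts:
  obtains D T where "counts n e D T"
proof
  show "counts n e (\<lambda>v k. k \<le> card {j. j < n \<and> e v j})
      (\<lambda>v j. 2 * v + j \<le> (\<Sum>u<v. card {j. j < n \<and> e u j}))"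
    using out_ge size_out by (simp add: counts_def)
qed

end

section \<open>The propositional search\<close>

lemma Suc_numerals:
  "(3::nat) = Suc (Suc (Suc 0))" "(4::nat) = Suc (Suc (Suc (Suc 0)))" "(5::nat) = Suc (Suc (Suc (Suc (Suc 0))))"
  "(6::nat) = Suc (Suc (Suc (Suc (Suc (Suc 0)))))" "(7::nat) = Suc (Suc (Suc (Suc (Suc (Suc (Suc 0))))))"
  by simp_all

lemma upt_lists:
  "[0..<5] = ([0,1,2,3,4] :: nat list)" "[1..<Suc 2] = ([1,2] :: nat list)"
  "[Suc 2..<5] = ([3,4] :: nat list)" "[0..<6] = ([0,1,2,3,4,5] :: nat list)"
  "[Suc 2..<6] = ([3,4,5] :: nat list)" "[0..<7] = ([0,1,2,3,4,5,6] :: nat list)"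
  "[Suc 2..<7] = ([3,4,5,6] :: nat list)" "[0..<Suc 7] = ([0,1,2,3,4,5,6,7] :: nat list)"
  "[1..<Suc 7] = ([1,2,3,4,5,6,7] :: nat list)" "[0..<22 - 2 * 7] = ([0,1,2,3,4,5,6,7] :: nat list)"
  "[2..<24 - 2 * 7] = ([2,3,4,5,6,7,8,9] :: nat list)" "[1..<Suc 3] = ([1,2,3] :: nat list)"
  "[Suc 3..<7] = ([4,5,6] :: nat list)" "[0..<8] = ([0,1,2,3,4,5,6,7] :: nat list)"
  "[Suc 2..<8] = ([3,4,5,6,7] :: nat list)" "[0..<Suc 8] = ([0,1,2,3,4,5,6,7,8] :: nat list)"
  "[1..<Suc 8] = ([1,2,3,4,5,6,7,8] :: nat list)" "[0..<22 - 2 * 8] = ([0,1,2,3,4,5] :: nat list)"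
  "[2..<24 - 2 * 8] = ([2,3,4,5,6,7] :: nat list)" "[Suc 3..<8] = ([4,5,6,7] :: nat list)"
  "[0..<9] = ([0,1,2,3,4,5,6,7,8] :: nat list)" "[Suc 2..<9] = ([3,4,5,6,7,8] :: nat list)"
  "[0..<Suc 9] = ([0,1,2,3,4,5,6,7,8,9] :: nat list)"
  "[1..<Suc 9] = ([1,2,3,4,5,6,7,8,9] :: nat list)" "[0..<22 - 2 * 9] = ([0,1,2,3] :: nat list)"
  "[2..<24 - 2 * 9] = ([2,3,4,5] :: nat list)" "[Suc 3..<9] = ([4,5,6,7,8] :: nat list)"
  "[1..<Suc 4] = ([1,2,3,4] :: nat list)" "[Suc 4..<9] = ([5,6,7,8] :: nat list)"
  "[0..<10] = ([0,1,2,3,4,5,6,7,8,9] :: nat list)" "[Suc 2..<10] = ([3,4,5,6,7,8,9] :: nat list)"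
  "[0..<Suc 10] = ([0,1,2,3,4,5,6,7,8,9,10] :: nat list)"
  "[1..<Suc 10] = ([1,2,3,4,5,6,7,8,9,10] :: nat list)" "[0..<22 - 2 * 10] = ([0,1] :: nat list)"
  "[2..<24 - 2 * 10] = ([2,3] :: nat list)" "[Suc 3..<10] = ([4,5,6,7,8,9] :: nat list)"
  "[Suc 4..<10] = ([5,6,7,8,9] :: nat list)" "21 - 2 * 7 = (7 :: nat)" "21 - 2 * 8 = (5 :: nat)"
  "21 - 2 * 9 = (3 :: nat)" "21 - 2 * 10 = (1 :: nat)"
  by (simp_all add: upt_rec)

lemma list_rec_simps:
  "list_all P [] = True" "list_all P (x # xs) = (P x \<and> list_all P xs)"
  "list_ex P [] = False" "list_ex P (x # xs) = (P x \<or> list_ex P xs)"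
  by simp_all

lemmas clause_simps = list_rec_simps omissions.simps choices.simps append.simps
  all_tails.simps zip_Cons_Cons zip.simps(1) zip_Nil prod.case
  has_back.simps split_clause_simp

text \<open>
  The arcs of the extremal digraph, on the vertices \<open>0, ..., 6\<close>, in the labelling for
  \<open>n = 7\<close> and \<open>p = 2\<close>.
\<close>

definition arcs0 :: "(nat \<times> nat) list" where
  "arcs0 = [(0,1), (0,3), (0,4), (1,2), (1,3), (1,4), (2,0), (2,3), (2,5), (3,4), (3,5), (3,6),
    (4,2), (4,5), (4,6), (5,0), (5,1), (5,6), (6,1), (6,2)]"

text \<open>
  Each listed splitting has no backward arc in some digraph that meets the degree conditions, and
  hence excludes that digraph; together the splittings for \<open>(n, p)\<close> exclude all of
  them, or all but those containing \<open>arcs0\<close> if \<open>n = 7\<close> and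
  \<open>p = 2\<close>. For fewer than seven vertices the bound on the number of arcs holds trivially, and
  only the in-degree of the vertex left out by a splitting is tracked.
\<close>

lemma not_critical_labelling_5_2: "\<not> critical_labelling 5 2 e"
proof
  assume "critical_labelling 5 2 e"
  then interpret critical_labelling 5 2 e .
  obtain D T where D: "counts 5 (\<lambda>i j. e j i) D T" "\<not> D 0 3"
    and split: "\<And>ss. list_all (admissible_split 5 2) ss \<Longrightarrow> list_all (split_clause e D) ss"
    by (rule in_counts) blast
  note in_3 = counts_choices[OF D(1) Suc_numerals(1), unfolded upt_lists clause_simps]
  have split_1: "list_all (split_clause e D) [
      ([],[3,1],[4,2,0]), ([],[1,3,2],[4,0]), ([0],[2],[3,4,1]), ([0],[4],[1,2,3])]"
    by (rule split) code_simp
  show False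
    using [[argo_timeout = 3600]]
      D(2) in_3[of 0] in_3[of 1] in_3[of 2] in_3[of 3] in_3[of 4] split_1[unfolded clause_simps]
      asym_clauses[unfolded upt_lists clause_simps] degree_clauses[unfolded upt_lists clause_simps]
      sorted[unfolded upt_lists clause_simps]
    by argo
qed

lemma not_critical_labelling_6_2: "\<not> critical_labelling 6 2 e"
proof
  assume "critical_labelling 6 2 e"
  then interpret critical_labelling 6 2 e .
  obtain D T where D: "counts 6 (\<lambda>i j. e j i) D T" "\<not> D 0 3"
    and split: "\<And>ss. list_all (admissible_split 6 2) ss \<Longrightarrow> list_all (split_clause e D) ss"
    by (rule in_counts) blast
  note in_3 = counts_choices[OF D(1) Suc_numerals(1), unfolded upt_lists clause_simps]
  have split_1: "list_all (split_clause e D) [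
      ([],[0,1,2],[3,4,5]), ([],[0,1,3],[4,5,2]), ([],[0,1,4],[2,3,5]), ([],[0,3,1],[4,5,2]),
      ([],[0,3,4],[1,5,2]), ([],[0,3,4],[5,1,2]), ([],[1,0,2],[3,4,5]), ([],[1,2,3],[0,4,5]),
      ([],[1,3,2],[4,0,5]), ([],[2,0,3],[4,5,1]), ([],[2,3,4],[0,5,1]), ([0],[1],[3,2,4,5]),
      ([0],[1],[3,4,2,5])]"
    by (rule split) code_simp
  show False
    using [[argo_timeout = 3600]]
      D(2) in_3[of 0] in_3[of 1] in_3[of 2] in_3[of 3] in_3[of 4] in_3[of 5]
      split_1[unfolded clause_simps] asym_clauses[unfolded upt_lists clause_simps]
      degree_clauses[unfolded upt_lists clause_simps] sorted[unfolded upt_lists clause_simps]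
    by argo
qed

lemma critical_labelling_7_2:
  assumes "critical_labelling 7 2 e"
  shows "list_all (\<lambda>(i, j). e i j) arcs0"
proof (rule ccontr)
  assume neg: "\<not> list_all (\<lambda>(i, j). e i j) arcs0"
  interpret critical_labelling 7 2 e by fact
  obtain D T where D: "counts 7 (\<lambda>i j. e j i) D T" "\<not> D 0 3"
    and split: "\<And>ss. list_all (admissible_split 7 2) ss \<Longrightarrow> list_all (split_clause e D) ss"
    by (rule in_counts) blast
  note in_3 = counts_choices[OF D(1) Suc_numerals(1), unfolded upt_lists clause_simps]
  note in_4 = counts_choices[OF D(1) Suc_numerals(2), unfolded upt_lists clause_simps]
  note in_5 = counts_choices[OF D(1) Suc_numerals(3), unfolded upt_lists clause_simps]
  note in_6 = counts_choices[OF D(1) Suc_numerals(4), unfolded upt_lists clause_simps]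
  have split_1: "list_all (split_clause e D) [
      ([],[0,1,2],[3,4,5,6]), ([],[0,1,3],[4,2,5,6]), ([],[0,1,3],[4,5,2,6]), ([],[0,1,5],[2,3,4,6]),
      ([],[0,1,5],[3,2,4,6]), ([],[0,3,1],[4,5,2,6]), ([],[0,3,1],[4,5,6,2]), ([],[0,5,1],[3,2,4,6]),
      ([],[1,0,2],[3,4,5,6]), ([],[1,2,0],[3,4,5,6]), ([],[1,2,3],[4,0,5,6]), ([],[1,2,3],[4,5,0,6]),
      ([],[1,2,3],[5,0,4,6]), ([],[1,2,4],[0,3,5,6]), ([],[1,2,5],[0,3,4,6]), ([],[1,3,2],[4,0,5,6]),
      ([],[1,4,2],[3,5,0,6]), ([],[1,4,2],[5,0,3,6]), ([],[1,5,2],[0,3,4,6]), ([],[2,0,1],[3,4,5,6]),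
      ([],[2,0,3],[4,5,6,1]), ([],[2,3,5],[0,6,1,4]), ([],[4,2,5],[0,3,6,1]), ([],[4,2,5],[0,6,1,3]),
      ([],[5,0,1],[3,4,6,2]), ([],[5,1,2],[0,3,4,6]), ([],[5,2,0],[3,4,6,1]), ([],[5,2,3],[4,0,6,1]),
      ([],[5,2,4],[0,3,6,1]), ([],[0,1,3,4],[6,2,5])]"
    by (rule split) code_simp
  have split_2: "list_all (split_clause e D) [
      ([],[0,3,1,5],[6,2,4]), ([],[0,3,4,5],[1,6,2]), ([],[0,3,4,5],[6,1,2]), ([],[0,3,5,1],[4,2,6]),
      ([],[2,0,3,4],[5,6,1]), ([],[3,0,4,5],[6,1,2]), ([],[3,2,4,5],[0,6,1]), ([],[3,4,1,5],[6,2,0]),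
      ([],[4,0,1,5],[6,2,3]), ([],[4,2,3,5],[0,6,1])]"
    by (rule split) code_simp
  show False
    using [[argo_timeout = 3600]]
      D(2) in_3[of 0] in_3[of 1] in_3[of 2] in_3[of 3] in_3[of 4] in_3[of 5] in_3[of 6] in_4[of 0]
      in_4[of 1] in_4[of 2] in_4[of 3] in_4[of 4] in_4[of 5] in_4[of 6] in_5[of 0] in_5[of 1] in_5[of 2]
      in_5[of 3] in_5[of 4] in_5[of 5] in_5[of 6] in_6[of 0] in_6[of 1] in_6[of 2] in_6[of 3] in_6[of 4]
      in_6[of 5] in_6[of 6] counts_sum[OF D(1), unfolded upt_lists clause_simps]
      split_1[unfolded clause_simps] split_2[unfolded clause_simps]
      asym_clauses[unfolded upt_lists clause_simps] degree_clauses[unfolded upt_lists clause_simps]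
      sorted[unfolded upt_lists clause_simps] neg[unfolded arcs0_def list_rec_simps prod.case]
    by argo
qed

lemma not_critical_labelling_7_3: "\<not> critical_labelling 7 3 e"
proof
  assume "critical_labelling 7 3 e"
  then interpret critical_labelling 7 3 e .
  obtain D T where D: "counts 7 (\<lambda>i j. e j i) D T" "\<not> D 0 3"
    and split: "\<And>ss. list_all (admissible_split 7 3) ss \<Longrightarrow> list_all (split_clause e D) ss"
    by (rule in_counts) blast
  note in_3 = counts_choices[OF D(1) Suc_numerals(1), unfolded upt_lists clause_simps]
  note in_4 = counts_choices[OF D(1) Suc_numerals(2), unfolded upt_lists clause_simps]
  note in_5 = counts_choices[OF D(1) Suc_numerals(3), unfolded upt_lists clause_simps]
  note in_6 = counts_choices[OF D(1) Suc_numerals(4), unfolded upt_lists clause_simps]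
  have split_1: "list_all (split_clause e D) [
      ([],[1,2,3],[0,4,5,6]), ([],[1,2,3],[4,0,5,6]), ([],[1,3,5],[0,2,4,6]), ([],[4,1,5],[2,0,6,3]),
      ([],[0,1,2,3],[4,5,6]), ([],[0,1,4,2],[5,3,6]), ([],[0,4,1,5],[2,6,3]), ([],[0,5,1,3],[4,6,2]),
      ([],[1,0,2,3],[4,5,6]), ([],[5,0,1,3],[4,6,2]), ([0],[1,2],[3,4,5,6]), ([0],[1,2],[4,3,5,6]),
      ([0],[1,3],[4,2,5,6]), ([0],[1,3],[4,5,2,6]), ([0],[2,3],[4,5,1,6]), ([0],[2,3],[4,5,6,1]),
      ([0],[4,5],[1,6,2,3]), ([0],[4,5],[6,1,2,3]), ([0],[4,6],[1,2,5,3]), ([0],[4,6],[1,5,2,3]),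
      ([0],[5,6],[1,2,3,4]), ([0],[5,6],[1,2,4,3])]"
    by (rule split) code_simp
  show False
    using [[argo_timeout = 3600]]
      D(2) in_3[of 0] in_3[of 1] in_3[of 2] in_3[of 3] in_3[of 4] in_3[of 5] in_3[of 6] in_4[of 0]
      in_4[of 1] in_4[of 2] in_4[of 3] in_4[of 4] in_4[of 5] in_4[of 6] in_5[of 0] in_5[of 1] in_5[of 2]
      in_5[of 3] in_5[of 4] in_5[of 5] in_5[of 6] in_6[of 0] in_6[of 1] in_6[of 2] in_6[of 3] in_6[of 4]
      in_6[of 5] in_6[of 6] counts_sum[OF D(1), unfolded upt_lists clause_simps]
      split_1[unfolded clause_simps] asym_clauses[unfolded upt_lists clause_simps]
      degree_clauses[unfolded upt_lists clause_simps] sorted[unfolded upt_lists clause_simps]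
    by argo
qed

lemma not_critical_labelling_8_2: "\<not> critical_labelling 8 2 e"
proof
  assume "critical_labelling 8 2 e"
  then interpret critical_labelling 8 2 e .
  obtain D T where D: "counts 8 (\<lambda>i j. e j i) D T" "\<not> D 0 3"
    and split: "\<And>ss. list_all (admissible_split 8 2) ss \<Longrightarrow> list_all (split_clause e D) ss"
    by (rule in_counts) blast
  note in_3 = counts_choices[OF D(1) Suc_numerals(1), unfolded upt_lists clause_simps]
  note in_4 = counts_choices[OF D(1) Suc_numerals(2), unfolded upt_lists clause_simps]
  note in_5 = counts_choices[OF D(1) Suc_numerals(3), unfolded upt_lists clause_simps]
  note in_6 = counts_choices[OF D(1) Suc_numerals(4), unfolded upt_lists clause_simps]
  note in_7 = counts_choices[OF D(1) Suc_numerals(5), unfolded upt_lists clause_simps]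
  have split_1: "list_all (split_clause e D) [
      ([],[1,2],[3,5,6,0,4,7]), ([],[0,1,2],[3,4,5,6,7]), ([],[0,3,1],[5,6,7,2,4]), ([],[0,5,1],[3,4,6,2,7]),
      ([],[0,6,1],[3,4,2,5,7]), ([],[0,6,1],[4,2,3,5,7]), ([],[1,0,2],[3,4,5,6,7]), ([],[1,2,0],[3,4,5,6,7]),
      ([],[1,2,3],[0,4,5,6,7]), ([],[1,2,3],[4,0,5,6,7]), ([],[1,2,3],[4,5,0,6,7]), ([],[1,2,3],[4,5,6,7,0]),
      ([],[1,2,3],[4,5,7,0,6]), ([],[1,2,3],[5,0,4,6,7]), ([],[1,2,4],[0,3,5,6,7]), ([],[1,2,4],[5,0,3,6,7]),
      ([],[1,2,5],[0,3,4,6,7]), ([],[1,2,6],[0,3,4,5,7]), ([],[1,3,2],[4,0,5,6,7]), ([],[1,3,2],[4,5,6,7,0]),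
      ([],[1,4,2],[3,6,0,5,7]), ([],[1,4,2],[5,0,3,6,7]), ([],[1,5,2],[0,3,4,6,7]), ([],[1,5,2],[3,6,0,4,7]),
      ([],[1,5,2],[4,6,0,3,7]), ([],[1,6,2],[0,3,4,5,7]), ([],[2,0,1],[3,4,5,6,7]), ([],[2,0,3],[4,5,6,7,1]),
      ([],[2,0,4],[3,5,6,7,1]), ([],[2,6,0],[3,4,7,1,5])]"
    by (rule split) code_simp
  have split_2: "list_all (split_clause e D) [
      ([],[4,2,0],[3,5,6,7,1]), ([],[5,1,4],[6,7,2,0,3]), ([],[6,1,2],[0,3,4,5,7]), ([],[6,1,2],[3,7,0,4,5]),
      ([],[6,2,0],[3,4,5,7,1]), ([],[0,1,3,4],[5,2,6,7]), ([],[0,1,3,4],[5,6,2,7]), ([],[0,1,3,4],[6,2,5,7]),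
      ([],[0,1,3,4],[7,2,5,6]), ([],[0,1,3,5],[2,4,6,7]), ([],[0,1,3,5],[4,2,6,7]), ([],[0,1,3,5],[4,6,2,7]),
      ([],[0,1,3,5],[4,7,2,6]), ([],[0,1,3,5],[6,2,4,7]), ([],[0,1,3,5],[7,2,4,6]), ([],[0,1,4,5],[2,3,6,7]),
      ([],[0,1,4,5],[6,2,3,7]), ([],[0,1,4,6],[2,3,5,7]), ([],[0,1,5,6],[2,3,4,7]), ([],[0,3,1,4],[5,6,2,7]),
      ([],[0,3,4,1],[5,2,6,7]), ([],[0,3,4,6],[5,7,1,2]), ([],[0,3,6,1],[4,5,2,7]), ([],[0,4,1,5],[3,6,2,7]),
      ([],[0,4,1,6],[2,3,5,7]), ([],[0,4,5,1],[3,6,2,7]), ([],[0,4,6,1],[2,3,5,7]), ([],[0,4,6,1],[5,2,3,7]),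
      ([],[0,5,1,3],[4,6,2,7]), ([],[0,5,1,4],[2,3,6,7])]"
    by (rule split) code_simp
  have split_3: "list_all (split_clause e D) [
      ([],[0,5,1,6],[2,3,4,7]), ([],[0,5,6,1],[3,2,4,7]), ([],[0,6,1,3],[4,2,5,7]), ([],[0,6,1,3],[5,2,4,7]),
      ([],[0,6,1,4],[2,3,5,7]), ([],[1,2,3,4],[5,0,6,7]), ([],[1,2,3,4],[5,6,0,7]), ([],[1,3,2,4],[5,6,0,7]),
      ([],[1,3,5,2],[0,4,6,7]), ([],[1,3,5,2],[4,6,7,0]), ([],[1,3,6,2],[4,5,0,7]), ([],[1,4,2,3],[5,0,6,7]),
      ([],[1,4,2,5],[3,6,0,7]), ([],[1,4,5,2],[0,3,6,7]), ([],[1,5,2,3],[4,6,0,7]), ([],[1,5,2,4],[6,0,3,7]),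
      ([],[2,0,3,4],[5,6,7,1]), ([],[2,0,3,5],[4,6,7,1]), ([],[2,3,5,6],[0,7,1,4]), ([],[2,5,0,6],[3,7,1,4]),
      ([],[3,1,4,5],[7,2,6,0]), ([],[3,2,4,5],[0,6,7,1]), ([],[3,2,4,6],[0,5,7,1]), ([],[3,2,5,6],[0,4,7,1]),
      ([],[3,4,1,5],[6,2,7,0]), ([],[3,4,6,2],[5,0,7,1]), ([],[3,5,0,6],[4,7,1,2]), ([],[3,5,2,6],[0,4,7,1]),
      ([],[3,6,1,4],[5,7,2,0]), ([],[4,0,1,5],[6,7,2,3])]"
    by (rule split) code_simp
  have split_4: "list_all (split_clause e D) [
      ([],[4,2,3,5],[0,6,7,1]), ([],[4,2,5,0],[3,6,7,1]), ([],[4,2,5,6],[0,3,7,1]), ([],[4,2,5,6],[7,0,1,3]),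
      ([],[4,5,1,6],[2,7,0,3]), ([],[4,5,1,6],[7,2,0,3]), ([],[4,5,2,6],[0,3,7,1]), ([],[4,6,1,3],[5,7,2,0]),
      ([],[4,6,1,5],[2,3,7,0]), ([],[4,6,1,5],[7,2,0,3]), ([],[4,6,2,0],[3,5,7,1]), ([],[4,6,2,5],[0,3,7,1]),
      ([],[5,0,1,3],[4,6,7,2]), ([],[5,0,1,6],[3,7,2,4]), ([],[5,0,1,6],[7,2,3,4]), ([],[5,0,4,1],[3,6,7,2]),
      ([],[5,1,3,6],[2,4,7,0]), ([],[5,1,3,6],[7,2,0,4]), ([],[5,2,0,3],[4,6,7,1]), ([],[5,2,0,4],[3,6,7,1]),
      ([],[5,2,3,6],[0,4,7,1]), ([],[5,2,4,6],[0,3,7,1]), ([],[5,2,4,6],[0,7,1,3]), ([],[5,6,1,3],[4,7,2,0]),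
      ([],[6,0,1,3],[4,5,7,2]), ([],[6,0,1,4],[5,7,2,3]), ([],[6,0,1,5],[7,2,3,4]), ([],[6,1,4,5],[7,2,0,3]),
      ([],[6,2,3,5],[0,4,7,1]), ([],[0,3,1,4,6],[7,2,5])]"
    by (rule split) code_simp
  have split_5: "list_all (split_clause e D) [
      ([],[0,3,4,5,6],[1,7,2]), ([],[0,3,4,5,6],[7,1,2]), ([],[0,4,1,3,5],[6,2,7]), ([],[0,4,1,3,6],[7,2,5]),
      ([],[1,3,4,5,6],[2,7,0]), ([],[2,0,3,4,5],[6,7,1]), ([],[2,3,4,5,6],[0,7,1]), ([],[3,1,4,5,6],[7,2,0]),
      ([],[3,4,1,5,6],[7,2,0]), ([],[3,4,2,5,6],[0,7,1]), ([],[3,4,5,2,6],[0,7,1]), ([],[3,4,6,1,5],[7,2,0]),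
      ([],[4,5,1,3,6],[7,2,0]), ([],[5,2,3,4,6],[0,7,1])]"
    by (rule split) code_simp
  show False
    using [[argo_timeout = 3600]]
      D(2) in_3[of 0] in_3[of 1] in_3[of 2] in_3[of 3] in_3[of 4] in_3[of 5] in_3[of 6] in_3[of 7]
      in_4[of 0] in_4[of 1] in_4[of 2] in_4[of 3] in_4[of 4] in_4[of 5] in_4[of 6] in_4[of 7] in_5[of 0]
      in_5[of 1] in_5[of 2] in_5[of 3] in_5[of 4] in_5[of 5] in_5[of 6] in_5[of 7] in_6[of 0] in_6[of 1]
      in_6[of 2] in_6[of 3] in_6[of 4] in_6[of 5] in_6[of 6] in_6[of 7] in_7[of 0] in_7[of 1] in_7[of 2]
      in_7[of 3] in_7[of 4] in_7[of 5] in_7[of 6] in_7[of 7]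
      counts_sum[OF D(1), unfolded upt_lists clause_simps] split_1[unfolded clause_simps]
      split_2[unfolded clause_simps] split_3[unfolded clause_simps] split_4[unfolded clause_simps]
      split_5[unfolded clause_simps] asym_clauses[unfolded upt_lists clause_simps]
      degree_clauses[unfolded upt_lists clause_simps] sorted[unfolded upt_lists clause_simps]
    by argo
qed

lemma not_critical_labelling_8_3: "\<not> critical_labelling 8 3 e"
proof
  assume "critical_labelling 8 3 e"
  then interpret critical_labelling 8 3 e .
  obtain D T where D: "counts 8 (\<lambda>i j. e j i) D T" "\<not> D 0 3"
    and split: "\<And>ss. list_all (admissible_split 8 3) ss \<Longrightarrow> list_all (split_clause e D) ss"
    by (rule in_counts) blast
  note in_3 = counts_choices[OF D(1) Suc_numerals(1), unfolded upt_lists clause_simps]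
  note in_4 = counts_choices[OF D(1) Suc_numerals(2), unfolded upt_lists clause_simps]
  note in_5 = counts_choices[OF D(1) Suc_numerals(3), unfolded upt_lists clause_simps]
  note in_6 = counts_choices[OF D(1) Suc_numerals(4), unfolded upt_lists clause_simps]
  note in_7 = counts_choices[OF D(1) Suc_numerals(5), unfolded upt_lists clause_simps]
  have split_1: "list_all (split_clause e D) [
      ([],[0,1,2],[5,6,3,4,7]), ([],[0,1,2],[7,3,4,5,6]), ([],[0,1,3],[4,6,2,5,7]), ([],[0,1,5],[2,4,6,3,7]),
      ([],[0,2,5],[1,4,6,3,7]), ([],[0,4,1],[5,6,2,7,3]), ([],[1,2,3],[0,4,5,6,7]), ([],[1,2,3],[4,0,5,6,7]),
      ([],[1,2,3],[4,5,0,6,7]), ([],[1,2,3],[4,5,6,7,0]), ([],[1,2,3],[4,6,0,5,7]), ([],[1,2,3],[4,6,7,0,5]),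
      ([],[1,2,3],[4,7,0,5,6]), ([],[1,2,3],[5,0,4,6,7]), ([],[1,2,3],[5,6,0,4,7]), ([],[1,2,3],[6,0,4,5,7]),
      ([],[1,3,5],[0,2,4,6,7]), ([],[1,3,5],[0,6,2,4,7]), ([],[1,3,5],[2,0,4,6,7]), ([],[1,3,6],[0,2,4,5,7]),
      ([],[1,3,6],[2,0,4,5,7]), ([],[1,4,2],[5,6,3,7,0]), ([],[1,5,2],[3,4,6,7,0]), ([],[1,5,2],[6,3,0,4,7]),
      ([],[1,6,2],[0,4,7,3,5]), ([],[2,0,3],[4,1,5,6,7]), ([],[2,3,5],[0,1,4,6,7]), ([],[2,3,6],[0,4,1,5,7]),
      ([],[2,5,3],[4,6,0,7,1]), ([],[2,5,3],[6,0,1,4,7])]"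
    by (rule split) code_simp
  have split_2: "list_all (split_clause e D) [
      ([],[2,6,3],[0,4,1,5,7]), ([],[2,6,3],[0,5,1,4,7]), ([],[3,6,2],[0,4,5,7,1]), ([],[4,1,2],[5,3,6,0,7]),
      ([],[4,1,3],[5,6,0,2,7]), ([],[4,2,6],[3,5,7,0,1]), ([],[5,1,3],[4,6,7,2,0]), ([],[5,2,3],[4,6,7,0,1]),
      ([],[5,2,3],[4,7,0,6,1]), ([],[5,3,6],[0,1,4,7,2]), ([],[6,1,3],[0,5,7,2,4]), ([],[6,1,3],[4,5,7,0,2]),
      ([],[6,1,3],[4,5,7,2,0]), ([],[6,3,0],[4,1,5,7,2]), ([],[0,1,2,3],[4,5,6,7]), ([],[0,1,2,4],[5,3,6,7]),
      ([],[0,1,2,4],[5,6,3,7]), ([],[0,1,2,4],[5,6,7,3]), ([],[0,1,2,4],[6,3,5,7]), ([],[0,1,2,4],[7,3,5,6]),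
      ([],[0,1,2,5],[3,4,6,7]), ([],[0,1,2,5],[4,6,3,7]), ([],[0,1,2,5],[6,3,4,7]), ([],[0,1,2,5],[7,3,4,6]),
      ([],[0,1,2,6],[3,4,5,7]), ([],[0,1,2,6],[7,3,4,5]), ([],[0,1,3,4],[5,6,2,7]), ([],[0,1,3,4],[5,6,7,2]),
      ([],[0,1,3,4],[6,7,2,5]), ([],[0,1,3,5],[2,4,6,7])]"
    by (rule split) code_simp
  have split_3: "list_all (split_clause e D) [
      ([],[0,1,3,5],[4,6,7,2]), ([],[0,1,3,5],[7,2,4,6]), ([],[0,1,3,6],[2,4,5,7]), ([],[0,1,3,6],[4,2,5,7]),
      ([],[0,1,4,2],[5,3,6,7]), ([],[0,1,4,2],[5,6,3,7]), ([],[0,1,4,2],[6,3,5,7]), ([],[0,1,4,3],[5,6,7,2]),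
      ([],[0,1,4,5],[2,6,3,7]), ([],[0,1,4,5],[3,6,2,7]), ([],[0,1,4,5],[6,2,3,7]), ([],[0,1,4,5],[6,2,7,3]),
      ([],[0,1,4,6],[2,3,5,7]), ([],[0,1,4,6],[2,7,3,5]), ([],[0,1,5,2],[3,4,6,7]), ([],[0,1,5,2],[4,6,3,7]),
      ([],[0,1,5,2],[4,6,7,3]), ([],[0,1,5,2],[4,7,3,6]), ([],[0,1,5,2],[6,3,4,7]), ([],[0,1,5,3],[2,4,6,7]),
      ([],[0,1,5,3],[4,6,2,7]), ([],[0,1,5,3],[4,6,7,2]), ([],[0,1,5,3],[4,7,2,6]), ([],[0,1,5,6],[2,3,4,7]),
      ([],[0,1,6,2],[3,4,5,7]), ([],[0,1,6,2],[4,3,5,7]), ([],[0,1,6,2],[4,7,3,5]), ([],[0,1,6,2],[5,3,4,7]),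
      ([],[0,1,6,3],[2,4,5,7]), ([],[0,1,6,3],[4,5,7,2])]"
    by (rule split) code_simp
  have split_4: "list_all (split_clause e D) [
      ([],[0,2,4,1],[5,3,6,7]), ([],[0,2,4,1],[5,6,3,7]), ([],[0,2,4,5],[3,6,7,1]), ([],[0,2,4,5],[6,1,7,3]),
      ([],[0,2,4,5],[6,7,1,3]), ([],[0,2,4,5],[7,1,3,6]), ([],[0,2,4,6],[1,5,3,7]), ([],[0,2,4,6],[7,1,5,3]),
      ([],[0,2,5,1],[3,4,6,7]), ([],[0,2,5,6],[1,3,4,7]), ([],[0,2,6,1],[3,4,5,7]), ([],[0,2,6,1],[4,3,5,7]),
      ([],[0,3,4,1],[5,6,2,7]), ([],[0,3,4,1],[5,6,7,2]), ([],[0,3,4,1],[5,7,2,6]), ([],[0,3,4,6],[1,5,7,2]),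
      ([],[0,3,4,6],[5,1,7,2]), ([],[0,3,4,6],[5,7,1,2]), ([],[0,3,5,1],[4,6,2,7]), ([],[0,3,6,1],[4,5,7,2]),
      ([],[0,4,1,2],[5,6,3,7]), ([],[0,4,1,3],[5,2,6,7]), ([],[0,4,1,3],[5,6,2,7]), ([],[0,4,1,3],[5,6,7,2]),
      ([],[0,4,1,5],[2,6,3,7]), ([],[0,4,1,5],[2,6,7,3]), ([],[0,4,1,5],[3,6,7,2]), ([],[0,4,1,5],[6,2,3,7]),
      ([],[0,4,1,5],[6,2,7,3]), ([],[0,4,1,5],[7,2,6,3])]"
    by (rule split) code_simp
  have split_5: "list_all (split_clause e D) [
      ([],[0,4,1,6],[7,2,5,3]), ([],[0,4,2,5],[6,1,7,3]), ([],[0,4,2,5],[6,3,7,1]), ([],[0,4,2,5],[6,7,1,3]),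
      ([],[0,4,2,5],[7,1,6,3]), ([],[0,4,5,1],[2,6,3,7]), ([],[0,4,5,6],[1,2,7,3]), ([],[0,4,5,6],[1,3,7,2]),
      ([],[0,4,5,6],[1,7,2,3]), ([],[0,4,5,6],[2,7,1,3]), ([],[0,4,5,6],[3,7,1,2]), ([],[0,4,5,6],[7,1,2,3]),
      ([],[0,4,6,1],[2,5,7,3]), ([],[0,4,6,1],[5,2,7,3]), ([],[0,4,6,2],[5,7,1,3]), ([],[0,4,6,3],[1,5,7,2]),
      ([],[0,5,1,2],[4,6,3,7]), ([],[0,5,1,2],[4,7,3,6]), ([],[0,5,1,3],[4,6,2,7]), ([],[0,5,1,3],[4,7,2,6]),
      ([],[0,5,1,6],[2,4,7,3]), ([],[0,5,1,6],[2,7,3,4]), ([],[0,5,2,4],[6,1,3,7]), ([],[0,5,2,4],[6,7,1,3]),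
      ([],[0,5,2,6],[3,4,7,1]), ([],[0,5,3,6],[1,4,7,2]), ([],[0,5,6,1],[2,4,7,3]), ([],[0,5,6,2],[4,7,1,3]),
      ([],[0,5,6,2],[7,1,3,4]), ([],[0,5,6,3],[1,4,7,2])]"
    by (rule split) code_simp
  have split_6: "list_all (split_clause e D) [
      ([],[0,5,6,3],[7,1,2,4]), ([],[0,5,6,3],[7,1,4,2]), ([],[0,6,1,2],[3,4,5,7]), ([],[0,6,1,2],[4,3,5,7]),
      ([],[0,6,1,2],[4,5,7,3]), ([],[0,6,1,2],[4,7,3,5]), ([],[0,6,1,3],[4,2,5,7]), ([],[0,6,1,3],[4,5,7,2]),
      ([],[0,6,1,3],[4,7,2,5]), ([],[0,6,1,4],[5,2,7,3]), ([],[0,6,1,5],[2,3,4,7]), ([],[0,6,2,4],[5,7,1,3]),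
      ([],[1,0,2,3],[4,5,6,7]), ([],[1,2,0,3],[4,5,6,7]), ([],[1,2,3,0],[4,5,6,7]), ([],[1,2,3,4],[5,0,6,7]),
      ([],[1,2,3,4],[5,6,0,7]), ([],[1,2,3,4],[5,7,0,6]), ([],[1,2,3,4],[6,0,5,7]), ([],[1,2,3,4],[7,0,5,6]),
      ([],[1,2,3,5],[0,4,6,7]), ([],[1,2,3,5],[4,6,0,7]), ([],[1,2,3,5],[4,6,7,0]), ([],[1,2,3,5],[4,7,0,6]),
      ([],[1,2,3,5],[7,0,4,6]), ([],[1,2,3,6],[0,4,5,7]), ([],[1,2,4,3],[5,0,6,7]), ([],[1,2,4,3],[5,6,7,0]),
      ([],[1,2,4,5],[3,6,7,0]), ([],[1,2,5,3],[0,4,6,7])]"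
    by (rule split) code_simp
  have split_7: "list_all (split_clause e D) [
      ([],[1,2,5,3],[4,6,0,7]), ([],[1,2,5,3],[4,6,7,0]), ([],[1,2,5,3],[6,0,4,7]), ([],[1,2,5,3],[7,0,4,6]),
      ([],[1,2,6,3],[0,4,5,7]), ([],[1,2,6,3],[4,5,7,0]), ([],[1,2,6,3],[4,7,0,5]), ([],[1,2,6,3],[7,0,4,5]),
      ([],[1,3,0,4],[5,2,6,7]), ([],[1,3,0,4],[5,7,2,6]), ([],[1,3,0,5],[2,4,6,7]), ([],[1,3,0,5],[6,2,4,7]),
      ([],[1,3,4,2],[5,0,6,7]), ([],[1,3,4,2],[6,0,5,7]), ([],[1,3,4,5],[7,0,2,6]), ([],[1,3,4,6],[0,7,2,5]),
      ([],[1,3,4,6],[7,2,0,5]), ([],[1,3,5,0],[2,4,6,7]), ([],[1,3,5,2],[0,4,6,7]), ([],[1,3,5,2],[4,6,0,7]),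
      ([],[1,3,5,2],[6,0,4,7]), ([],[1,3,5,6],[0,2,4,7]), ([],[1,3,5,6],[2,0,4,7]), ([],[1,3,6,0],[2,4,5,7]),
      ([],[1,3,6,0],[4,2,5,7]), ([],[1,3,6,0],[5,2,4,7]), ([],[1,3,6,2],[0,4,5,7]), ([],[1,3,6,2],[4,5,7,0]),
      ([],[1,4,2,3],[5,0,6,7]), ([],[1,4,2,3],[5,6,0,7])]"
    by (rule split) code_simp
  have split_8: "list_all (split_clause e D) [
      ([],[1,4,2,3],[5,7,0,6]), ([],[1,4,2,3],[6,0,5,7]), ([],[1,4,2,5],[3,6,0,7]), ([],[1,4,2,5],[6,3,0,7]),
      ([],[1,4,2,5],[7,3,0,6]), ([],[1,4,3,0],[5,2,6,7]), ([],[1,4,3,0],[5,6,2,7]), ([],[1,4,3,6],[0,5,2,7]),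
      ([],[1,4,5,6],[2,7,3,0]), ([],[1,4,5,6],[7,2,3,0]), ([],[1,4,6,2],[0,5,3,7]), ([],[1,4,6,2],[5,0,7,3]),
      ([],[1,4,6,2],[5,7,3,0]), ([],[1,5,0,2],[4,6,7,3]), ([],[1,5,2,3],[0,4,6,7]), ([],[1,5,2,3],[4,6,0,7]),
      ([],[1,5,2,3],[4,6,7,0]), ([],[1,5,2,3],[6,0,4,7]), ([],[1,5,3,0],[4,6,2,7]), ([],[1,5,3,0],[4,6,7,2]),
      ([],[1,5,3,6],[0,4,7,2]), ([],[1,5,3,6],[0,7,2,4]), ([],[1,5,6,2],[0,7,3,4]), ([],[1,5,6,2],[7,3,0,4]),
      ([],[1,6,2,3],[0,4,5,7]), ([],[1,6,2,3],[4,5,7,0]), ([],[1,6,2,3],[5,7,0,4]), ([],[1,6,2,3],[7,0,4,5]),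
      ([],[1,6,3,0],[2,4,5,7]), ([],[1,6,3,0],[4,2,5,7])]"
    by (rule split) code_simp
  have split_9: "list_all (split_clause e D) [
      ([],[1,6,3,4],[7,2,0,5]), ([],[1,6,3,5],[0,2,4,7]), ([],[2,0,1,3],[4,5,6,7]), ([],[2,0,3,4],[5,6,1,7]),
      ([],[2,0,3,4],[5,6,7,1]), ([],[2,0,3,4],[5,7,1,6]), ([],[2,0,3,4],[6,1,5,7]), ([],[2,0,3,4],[6,7,1,5]),
      ([],[2,0,3,5],[1,4,6,7]), ([],[2,0,3,5],[6,1,4,7]), ([],[2,0,3,6],[4,1,5,7]), ([],[2,0,3,6],[7,1,4,5]),
      ([],[2,0,4,3],[5,6,7,1]), ([],[2,0,4,6],[1,5,3,7]), ([],[2,0,5,3],[4,6,7,1]), ([],[2,0,5,6],[1,3,4,7]),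
      ([],[2,0,6,3],[4,5,7,1]), ([],[2,0,6,3],[4,7,1,5]), ([],[2,3,0,1],[4,5,6,7]), ([],[2,3,0,4],[5,1,6,7]),
      ([],[2,3,0,4],[5,6,7,1]), ([],[2,3,4,1],[5,0,6,7]), ([],[2,3,4,5],[6,0,7,1]), ([],[2,3,4,5],[6,7,0,1]),
      ([],[2,3,4,5],[7,0,1,6]), ([],[2,3,4,6],[0,5,7,1]), ([],[2,3,4,6],[7,0,1,5]), ([],[2,3,5,1],[0,4,6,7]),
      ([],[2,3,6,0],[1,4,5,7]), ([],[2,4,1,3],[5,0,6,7])]"
    by (rule split) code_simp
  have split_10: "list_all (split_clause e D) [
      ([],[2,4,3,5],[6,0,1,7]), ([],[2,4,3,6],[0,5,7,1]), ([],[2,4,5,6],[0,3,7,1]), ([],[2,4,5,6],[1,3,7,0]),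
      ([],[2,4,5,6],[1,7,3,0]), ([],[2,4,5,6],[3,0,7,1]), ([],[2,4,5,6],[3,7,0,1]), ([],[2,4,5,6],[7,1,3,0]),
      ([],[2,5,0,6],[7,1,3,4]), ([],[2,5,1,3],[0,4,6,7]), ([],[2,5,1,3],[4,6,0,7]), ([],[2,5,3,0],[4,6,7,1]),
      ([],[2,5,3,0],[6,1,4,7]), ([],[2,5,3,4],[6,0,7,1]), ([],[2,5,3,6],[0,1,4,7]), ([],[2,5,3,6],[0,4,1,7]),
      ([],[2,5,3,6],[0,7,1,4]), ([],[2,5,6,3],[0,4,7,1]), ([],[2,5,6,3],[4,7,0,1]), ([],[2,6,0,3],[4,1,5,7]),
      ([],[2,6,0,3],[5,7,1,4]), ([],[2,6,0,3],[7,1,4,5]), ([],[2,6,1,3],[0,4,5,7]), ([],[2,6,3,0],[1,4,5,7]),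
      ([],[2,6,3,0],[4,1,5,7]), ([],[2,6,3,0],[4,5,7,1]), ([],[2,6,3,0],[5,7,1,4]), ([],[2,6,3,5],[0,1,4,7]),
      ([],[3,0,1,2],[4,5,6,7]), ([],[3,0,1,6],[2,4,5,7])]"
    by (rule split) code_simp
  have split_11: "list_all (split_clause e D) [
      ([],[3,0,4,1],[5,6,2,7]), ([],[3,0,4,1],[5,6,7,2]), ([],[3,0,4,2],[5,6,7,1]), ([],[3,0,4,5],[6,1,7,2]),
      ([],[3,0,4,5],[7,1,6,2]), ([],[3,0,5,1],[4,6,2,7]), ([],[3,0,5,1],[4,6,7,2]), ([],[3,0,5,2],[4,6,7,1]),
      ([],[3,0,6,1],[2,4,5,7]), ([],[3,0,6,1],[4,2,5,7]), ([],[3,0,6,1],[5,2,4,7]), ([],[3,0,6,2],[4,5,7,1]),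
      ([],[3,4,1,5],[2,0,6,7]), ([],[3,4,1,5],[6,2,0,7]), ([],[3,4,2,0],[5,6,7,1]), ([],[3,4,2,5],[6,7,0,1]),
      ([],[3,4,5,6],[0,1,7,2]), ([],[3,4,5,6],[0,2,7,1]), ([],[3,4,5,6],[0,7,1,2]), ([],[3,5,0,1],[4,6,7,2]),
      ([],[3,5,2,0],[4,6,1,7]), ([],[3,5,2,0],[4,6,7,1]), ([],[3,5,6,2],[0,4,7,1]), ([],[3,5,6,2],[7,0,1,4]),
      ([],[3,6,0,1],[4,5,7,2]), ([],[3,6,0,4],[5,7,1,2]), ([],[3,6,1,2],[0,4,5,7]), ([],[3,6,2,0],[4,5,7,1]),
      ([],[4,0,5,6],[2,7,1,3]), ([],[4,1,3,6],[0,2,5,7])]"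
    by (rule split) code_simp
  have split_12: "list_all (split_clause e D) [
      ([],[4,1,5,2],[6,7,3,0]), ([],[4,1,5,6],[2,0,7,3]), ([],[4,1,5,6],[2,3,7,0]), ([],[4,1,5,6],[2,7,3,0]),
      ([],[4,1,5,6],[3,7,2,0]), ([],[4,2,0,6],[5,1,3,7]), ([],[4,2,5,6],[0,1,7,3]), ([],[4,2,5,6],[0,3,7,1]),
      ([],[4,2,5,6],[0,7,1,3]), ([],[4,2,5,6],[3,7,0,1]), ([],[4,2,5,6],[7,1,3,0]), ([],[4,2,6,3],[5,7,0,1]),
      ([],[4,3,5,6],[0,1,7,2]), ([],[4,3,5,6],[0,2,7,1]), ([],[4,3,5,6],[0,7,1,2]), ([],[4,3,6,0],[5,7,1,2]),
      ([],[4,5,1,6],[2,0,7,3]), ([],[4,5,1,6],[2,7,0,3]), ([],[4,5,1,6],[2,7,3,0]), ([],[4,5,1,6],[3,7,0,2]),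
      ([],[4,5,1,6],[7,2,0,3]), ([],[4,5,2,6],[0,7,1,3]), ([],[4,5,2,6],[3,0,7,1]), ([],[4,5,3,6],[0,7,1,2]),
      ([],[4,5,6,0],[7,1,2,3]), ([],[4,6,1,5],[7,2,0,3]), ([],[4,6,2,0],[5,7,1,3]), ([],[5,0,1,2],[4,6,3,7]),
      ([],[5,0,1,2],[4,6,7,3]), ([],[5,0,1,3],[4,6,7,2])]"
    by (rule split) code_simp
  have split_13: "list_all (split_clause e D) [
      ([],[5,0,1,3],[6,7,2,4]), ([],[5,0,3,6],[4,7,1,2]), ([],[5,1,2,3],[4,6,7,0]), ([],[5,1,3,0],[4,6,2,7]),
      ([],[5,1,3,6],[2,0,4,7]), ([],[5,1,4,6],[2,7,3,0]), ([],[5,1,4,6],[3,7,2,0]), ([],[5,1,4,6],[7,2,0,3]),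
      ([],[5,1,6,2],[7,3,0,4]), ([],[5,1,6,3],[7,2,0,4]), ([],[5,2,0,3],[4,6,1,7]), ([],[5,2,3,0],[4,6,7,1]),
      ([],[5,2,3,6],[0,4,7,1]), ([],[5,2,3,6],[4,7,0,1]), ([],[5,2,3,6],[7,0,1,4]), ([],[5,2,4,6],[0,1,7,3]),
      ([],[5,2,4,6],[0,7,1,3]), ([],[5,2,4,6],[1,3,7,0]), ([],[5,2,4,6],[3,0,7,1]), ([],[5,2,6,0],[3,4,7,1]),
      ([],[5,2,6,3],[0,4,7,1]), ([],[5,2,6,3],[4,7,0,1]), ([],[5,3,0,1],[4,6,7,2]), ([],[5,3,0,2],[4,6,7,1]),
      ([],[5,3,4,6],[0,1,7,2]), ([],[5,3,4,6],[0,7,1,2]), ([],[5,3,6,0],[1,4,7,2]), ([],[5,6,1,2],[4,7,3,0]),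
      ([],[5,6,1,4],[7,2,0,3]), ([],[6,0,1,2],[4,5,7,3])]"
    by (rule split) code_simp
  have split_14: "list_all (split_clause e D) [
      ([],[6,0,1,3],[4,5,7,2]), ([],[6,0,1,3],[5,7,2,4]), ([],[6,1,2,3],[0,4,5,7]), ([],[6,1,2,3],[4,5,7,0]),
      ([],[6,1,2,3],[4,7,0,5]), ([],[6,1,2,3],[5,7,0,4]), ([],[6,1,2,3],[7,0,4,5]), ([],[6,1,3,0],[2,4,5,7]),
      ([],[6,1,3,0],[4,5,7,2]), ([],[6,1,3,4],[5,7,2,0]), ([],[6,1,4,5],[2,7,3,0]), ([],[6,2,0,3],[4,5,7,1]),
      ([],[6,2,5,3],[4,7,0,1]), ([],[6,3,0,1],[4,5,7,2]), ([],[6,3,4,5],[0,7,1,2]), ([],[6,3,5,0],[1,4,7,2]),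
      ([],[0,1,4,2,6],[7,3,5]), ([],[0,1,4,5,6],[2,7,3]), ([],[0,4,5,1,6],[2,3,7]), ([],[0,4,5,1,6],[2,7,3]),
      ([],[0,5,1,4,6],[2,3,7]), ([],[0,5,2,4,6],[1,3,7]), ([],[1,3,4,6,2],[5,0,7]), ([],[2,0,4,5,6],[1,3,7]),
      ([],[2,5,3,4,6],[0,7,1]), ([],[4,2,0,5,6],[1,3,7]), ([],[4,5,2,3,6],[7,0,1]), ([],[5,1,2,6,3],[4,7,0]),
      ([],[6,0,1,2,4],[5,7,3]), ([0],[1,2],[3,4,5,6,7])]"
    by (rule split) code_simp
  have split_15: "list_all (split_clause e D) [
      ([0],[1,2],[4,3,5,6,7]), ([0],[1,2],[4,5,3,6,7]), ([0],[1,2],[4,6,3,5,7]), ([0],[1,2],[4,7,3,5,6]),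
      ([0],[1,2],[5,3,4,6,7]), ([0],[1,2],[6,7,3,4,5]), ([0],[1,3],[2,4,5,6,7]), ([0],[1,3],[4,2,5,6,7]),
      ([0],[1,3],[4,5,2,6,7]), ([0],[1,3],[4,5,6,2,7]), ([0],[1,3],[4,5,6,7,2]), ([0],[1,3],[4,5,7,2,6]),
      ([0],[1,3],[4,6,2,5,7]), ([0],[1,3],[4,6,7,2,5]), ([0],[1,3],[4,7,2,5,6]), ([0],[1,3],[5,2,4,6,7]),
      ([0],[1,3],[5,6,2,4,7]), ([0],[1,3],[6,2,4,5,7]), ([0],[1,3],[6,7,2,4,5]), ([0],[2,3],[4,5,1,6,7]),
      ([0],[2,3],[4,5,6,1,7]), ([0],[2,3],[4,5,6,7,1]), ([0],[2,3],[4,5,7,1,6]), ([0],[2,3],[4,6,1,5,7]),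
      ([0],[2,3],[4,6,7,1,5]), ([0],[2,3],[5,1,4,6,7]), ([0],[2,3],[5,6,1,4,7]), ([0],[2,3],[5,6,7,1,4]),
      ([0],[2,4],[5,3,6,7,1]), ([0],[3,5],[1,4,6,7,2])]"
    by (rule split) code_simp
  have split_16: "list_all (split_clause e D) [
      ([0],[4,1],[5,2,6,7,3]), ([0],[4,1],[5,3,6,7,2]), ([0],[4,5],[1,6,7,2,3]), ([0],[4,5],[6,1,7,2,3]),
      ([0],[4,6],[1,5,7,2,3]), ([0],[4,6],[2,5,7,1,3]), ([0],[4,6],[2,7,1,5,3]), ([0],[4,6],[5,2,7,1,3]),
      ([0],[4,7],[1,2,5,6,3]), ([0],[4,7],[1,5,2,6,3]), ([0],[4,7],[1,6,2,5,3]), ([0],[5,2],[4,6,3,7,1]),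
      ([0],[5,2],[4,6,7,1,3]), ([0],[5,6],[1,4,7,2,3]), ([0],[5,6],[1,7,2,4,3]), ([0],[5,7],[1,2,4,6,3]),
      ([0],[5,7],[1,2,6,3,4]), ([0],[5,7],[1,4,2,6,3]), ([0],[5,7],[1,6,2,4,3]), ([0],[5,7],[1,6,3,4,2]),
      ([0],[6,3],[2,4,5,7,1]), ([0],[6,3],[4,1,5,7,2]), ([0],[6,7],[1,2,3,4,5]), ([0],[6,7],[1,2,4,3,5]),
      ([0],[6,7],[1,3,4,2,5]), ([0],[6,7],[1,3,5,2,4]), ([0],[6,7],[1,4,2,3,5]), ([0],[6,7],[1,4,5,2,3]),
      ([0],[6,7],[1,5,2,3,4]), ([0],[7,3],[4,2,5,1,6])]"
    by (rule split) code_simp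
  have split_17: "list_all (split_clause e D) [
      ([1],[0,2],[5,6,3,4,7]), ([1],[2,4],[5,6,3,7,0]), ([1],[2,6],[3,4,5,7,0]), ([1],[3,4],[5,6,0,7,2]),
      ([1],[3,5],[0,4,6,7,2]), ([2],[0,1],[4,5,6,3,7]), ([2],[3,6],[4,5,7,0,1]), ([2],[6,7],[0,5,1,3,4]),
      ([3],[1,2],[4,5,7,0,6]), ([3],[2,0],[4,1,5,6,7]), ([3],[4,2],[5,0,6,7,1]), ([3],[4,2],[5,6,7,0,1]),
      ([3],[4,6],[5,7,0,1,2]), ([3],[4,7],[0,5,1,6,2]), ([3],[5,2],[4,6,0,1,7]), ([3],[6,1],[4,5,7,0,2]),
      ([3],[7,1],[2,0,4,5,6]), ([3],[7,2],[0,1,4,5,6]), ([3],[7,2],[0,4,5,1,6]), ([4],[1,2],[5,6,3,7,0]),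
      ([4],[1,3],[5,2,6,7,0]), ([4],[1,3],[5,6,0,2,7]), ([4],[2,3],[5,6,0,7,1]), ([4],[7,1],[2,0,5,6,3]),
      ([5],[1,2],[0,3,4,6,7]), ([5],[1,2],[3,0,4,6,7]), ([5],[1,3],[0,2,4,6,7]), ([5],[2,3],[0,1,4,6,7]),
      ([6],[1,2],[0,4,3,5,7]), ([6],[1,2],[3,0,4,5,7])]"
    by (rule split) code_simp
  have split_18: "list_all (split_clause e D) [
      ([6],[1,2],[4,3,0,5,7]), ([6],[1,2],[4,7,3,0,5]), ([6],[1,3],[0,2,4,5,7]), ([6],[1,3],[0,4,2,5,7]),
      ([6],[1,3],[0,5,2,4,7]), ([6],[1,3],[4,5,7,2,0]), ([6],[2,3],[0,4,7,1,5]), ([6],[2,4],[5,7,1,3,0]),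
      ([6],[7,3],[0,1,4,2,5]), ([7],[0,1],[2,5,3,4,6]), ([7],[1,3],[0,2,4,5,6]), ([7],[1,3],[0,4,2,5,6]),
      ([7],[1,3],[0,4,5,2,6]), ([7],[2,3],[0,4,1,5,6]), ([7],[2,3],[0,4,5,1,6]), ([7],[2,3],[0,4,6,1,5]),
      ([7],[3,0],[4,1,5,2,6])]"
    by (rule split) code_simp
  show False
    using [[argo_timeout = 3600]]
      D(2) in_3[of 0] in_3[of 1] in_3[of 2] in_3[of 3] in_3[of 4] in_3[of 5] in_3[of 6] in_3[of 7]
      in_4[of 0] in_4[of 1] in_4[of 2] in_4[of 3] in_4[of 4] in_4[of 5] in_4[of 6] in_4[of 7] in_5[of 0]
      in_5[of 1] in_5[of 2] in_5[of 3] in_5[of 4] in_5[of 5] in_5[of 6] in_5[of 7] in_6[of 0] in_6[of 1]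
      in_6[of 2] in_6[of 3] in_6[of 4] in_6[of 5] in_6[of 6] in_6[of 7] in_7[of 0] in_7[of 1] in_7[of 2]
      in_7[of 3] in_7[of 4] in_7[of 5] in_7[of 6] in_7[of 7]
      counts_sum[OF D(1), unfolded upt_lists clause_simps] split_1[unfolded clause_simps]
      split_2[unfolded clause_simps] split_3[unfolded clause_simps] split_4[unfolded clause_simps]
      split_5[unfolded clause_simps] split_6[unfolded clause_simps] split_7[unfolded clause_simps]
      split_8[unfolded clause_simps] split_9[unfolded clause_simps] split_10[unfolded clause_simps]
      split_11[unfolded clause_simps] split_12[unfolded clause_simps] split_13[unfolded clause_simps]
      split_14[unfolded clause_simps] split_15[unfolded clause_simps] split_16[unfolded clause_simps]
      split_17[unfolded clause_simps] split_18[unfolded clause_simps]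
      asym_clauses[unfolded upt_lists clause_simps] degree_clauses[unfolded upt_lists clause_simps]
      sorted[unfolded upt_lists clause_simps]
    by argo
qed

lemma not_critical_labelling_9_2: "\<not> critical_labelling 9 2 e"
proof
  assume "critical_labelling 9 2 e"
  then interpret critical_labelling 9 2 e .
  obtain D T where D: "counts 9 (\<lambda>i j. e j i) D T" "\<not> D 0 3"
    and split: "\<And>ss. list_all (admissible_split 9 2) ss \<Longrightarrow> list_all (split_clause e D) ss"
    by (rule in_counts) blast
  note in_3 = counts_choices[OF D(1) Suc_numerals(1), unfolded upt_lists clause_simps]
  note in_4 = counts_choices[OF D(1) Suc_numerals(2), unfolded upt_lists clause_simps]
  note in_5 = counts_choices[OF D(1) Suc_numerals(3), unfolded upt_lists clause_simps]
  have split_1: "list_all (split_clause e D) [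
      ([],[0,1,2],[3,4,5,6,7,8]), ([],[0,1,3],[4,5,6,7,2,8]), ([],[0,1,3],[4,5,6,7,8,2]),
      ([],[0,1,3],[4,5,6,8,2,7]), ([],[0,1,7],[2,3,4,5,6,8]), ([],[0,1,7],[3,2,4,5,6,8]),
      ([],[1,0,2],[3,4,5,6,7,8]), ([],[1,2,0],[3,4,5,6,7,8]), ([],[1,2,3],[0,4,5,6,7,8]),
      ([],[1,2,3],[4,0,5,6,7,8]), ([],[1,2,3],[4,5,7,0,6,8]), ([],[1,2,5],[0,3,4,6,7,8]),
      ([],[1,2,6],[0,3,4,5,7,8]), ([],[1,2,7],[0,3,4,5,6,8]), ([],[1,6,2],[0,3,4,5,7,8]),
      ([],[1,7,2],[0,3,4,5,6,8]), ([],[2,0,1],[3,4,5,6,7,8]), ([],[2,0,3],[4,5,6,7,8,1]),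
      ([],[0,1,3,4],[5,6,2,7,8]), ([],[0,1,4,6],[2,3,5,7,8]), ([],[1,2,3,4],[5,0,6,7,8]),
      ([],[1,2,3,4],[5,6,0,7,8]), ([],[1,2,3,4],[5,6,7,8,0]), ([],[1,2,3,5],[4,6,0,7,8]),
      ([],[1,2,3,5],[4,6,7,8,0]), ([],[1,2,4,5],[0,3,6,7,8]), ([],[1,2,4,5],[3,6,0,7,8]),
      ([],[1,2,5,7],[0,3,4,6,8]), ([],[1,3,2,4],[5,6,7,8,0]), ([],[2,0,4,5],[3,6,7,8,1])]"
    by (rule split) code_simp
  have split_2: "list_all (split_clause e D) [
      ([],[0,3,4,5,6],[7,8,1,2]), ([],[1,3,4,5,6],[7,2,8,0]), ([],[0,3,4,5,6,7],[1,8,2]),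
      ([],[0,3,4,5,6,7],[8,1,2]), ([],[3,2,4,5,6,7],[0,8,1])]"
    by (rule split) code_simp
  show False
    using [[argo_timeout = 3600]]
      D(2) in_3[of 0] in_3[of 1] in_3[of 2] in_3[of 3] in_3[of 4] in_3[of 5] in_3[of 6] in_3[of 7]
      in_3[of 8] in_4[of 0] in_4[of 1] in_4[of 2] in_4[of 3] in_4[of 4] in_4[of 5] in_4[of 6] in_4[of 7]
      in_4[of 8] in_5[of 0] in_5[of 1] in_5[of 2] in_5[of 3] in_5[of 4] in_5[of 5] in_5[of 6] in_5[of 7]
      in_5[of 8] counts_sum[OF D(1), unfolded upt_lists clause_simps] split_1[unfolded clause_simps]
      split_2[unfolded clause_simps] asym_clauses[unfolded upt_lists clause_simps]
      degree_clauses[unfolded upt_lists clause_simps] sorted[unfolded upt_lists clause_simps]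
    by argo
qed

lemma not_critical_labelling_9_3: "\<not> critical_labelling 9 3 e"
proof
  assume "critical_labelling 9 3 e"
  then interpret critical_labelling 9 3 e .
  obtain D T where D: "counts 9 (\<lambda>i j. e j i) D T" "\<not> D 0 3"
    and split: "\<And>ss. list_all (admissible_split 9 3) ss \<Longrightarrow> list_all (split_clause e D) ss"
    by (rule in_counts) blast
  note in_3 = counts_choices[OF D(1) Suc_numerals(1), unfolded upt_lists clause_simps]
  note in_4 = counts_choices[OF D(1) Suc_numerals(2), unfolded upt_lists clause_simps]
  note in_5 = counts_choices[OF D(1) Suc_numerals(3), unfolded upt_lists clause_simps]
  have split_1: "list_all (split_clause e D) [
      ([],[0,1,2],[4,5,6,7,3,8]), ([],[0,1,2],[4,6,3,5,7,8]), ([],[0,1,2],[4,6,8,3,5,7]),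
      ([],[0,1,2],[5,3,4,6,7,8]), ([],[1,2,3],[0,4,5,6,7,8]), ([],[1,2,3],[4,0,5,6,7,8]),
      ([],[1,2,3],[4,5,0,6,7,8]), ([],[1,2,3],[4,5,7,0,6,8]), ([],[1,2,3],[4,5,7,8,0,6]),
      ([],[1,2,3],[4,6,7,0,5,8]), ([],[1,2,3],[4,8,0,5,6,7]), ([],[1,2,3],[5,0,4,6,7,8]),
      ([],[1,2,3],[5,6,0,4,7,8]), ([],[1,2,3],[5,6,7,0,4,8]), ([],[1,2,3],[6,8,0,4,5,7]),
      ([],[1,2,3],[8,0,4,5,6,7]), ([],[1,3,0],[4,5,8,2,6,7]), ([],[1,3,0],[5,6,2,4,7,8]),
      ([],[1,5,2],[4,6,3,7,0,8]), ([],[0,1,2,3],[4,5,6,7,8]), ([],[0,1,2,4],[5,3,6,7,8]),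
      ([],[0,1,2,4],[5,6,3,7,8]), ([],[0,1,2,4],[5,6,7,3,8]), ([],[0,1,2,4],[5,6,7,8,3]),
      ([],[0,1,2,4],[5,6,8,3,7]), ([],[0,1,2,4],[5,7,3,6,8]), ([],[0,1,2,4],[5,7,8,3,6]),
      ([],[0,1,2,5],[3,4,6,7,8]), ([],[0,1,2,5],[4,6,3,7,8]), ([],[0,1,2,5],[4,6,7,3,8])]"
    by (rule split) code_simp
  have split_2: "list_all (split_clause e D) [
      ([],[0,1,2,5],[6,3,4,7,8]), ([],[0,1,2,6],[3,4,5,7,8]), ([],[0,1,2,6],[4,3,5,7,8]),
      ([],[0,1,2,6],[4,5,7,3,8]), ([],[0,1,2,6],[4,8,3,5,7]), ([],[0,1,2,7],[3,4,5,6,8]),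
      ([],[0,1,3,4],[5,6,7,2,8]), ([],[0,1,3,4],[5,6,7,8,2]), ([],[0,1,3,4],[5,7,2,6,8]),
      ([],[0,1,3,5],[4,6,2,7,8]), ([],[0,1,3,5],[4,6,7,8,2]), ([],[0,1,3,6],[2,4,5,7,8]),
      ([],[0,1,3,6],[4,5,7,2,8]), ([],[0,1,3,7],[4,2,5,6,8]), ([],[0,1,3,7],[5,2,4,6,8]),
      ([],[0,1,4,2],[5,3,6,7,8]), ([],[0,1,4,2],[5,6,7,3,8]), ([],[0,1,4,2],[5,7,3,6,8]),
      ([],[0,1,4,3],[5,6,7,2,8]), ([],[0,1,4,3],[5,6,8,2,7]), ([],[0,1,4,7],[2,5,3,6,8]),
      ([],[0,1,5,2],[3,4,6,7,8]), ([],[0,1,5,2],[4,6,7,3,8]), ([],[0,1,5,3],[4,6,2,7,8]),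
      ([],[0,1,5,3],[4,6,7,2,8]), ([],[0,1,5,3],[6,2,4,7,8]), ([],[0,1,5,6],[4,7,2,3,8]),
      ([],[0,1,6,2],[3,4,5,7,8]), ([],[0,1,6,2],[4,5,7,3,8]), ([],[0,1,6,3],[2,4,5,7,8])]"
    by (rule split) code_simp
  have split_3: "list_all (split_clause e D) [
      ([],[0,1,6,3],[4,5,8,2,7]), ([],[0,1,6,3],[5,2,4,7,8]), ([],[0,1,6,7],[2,3,4,5,8]),
      ([],[0,1,6,7],[2,4,5,3,8]), ([],[0,1,7,2],[3,4,5,6,8]), ([],[0,1,7,2],[4,3,5,6,8]),
      ([],[0,1,7,2],[5,3,4,6,8]), ([],[0,1,7,3],[2,4,5,6,8]), ([],[0,2,4,1],[5,6,3,7,8]),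
      ([],[0,2,6,1],[3,4,5,7,8]), ([],[0,2,7,1],[3,4,5,6,8]), ([],[0,3,4,1],[5,6,2,7,8]),
      ([],[0,3,7,1],[2,4,5,6,8]), ([],[0,4,1,2],[5,3,6,7,8]), ([],[0,4,1,2],[5,6,7,3,8]),
      ([],[0,4,1,2],[5,6,7,8,3]), ([],[0,4,1,2],[5,6,8,3,7]), ([],[0,4,1,3],[5,6,7,8,2]),
      ([],[0,4,5,6],[7,1,3,8,2]), ([],[0,4,5,7],[1,6,8,2,3]), ([],[0,4,5,7],[2,6,8,1,3]),
      ([],[0,4,6,7],[8,1,2,5,3]), ([],[0,5,1,2],[4,6,3,7,8]), ([],[0,5,1,2],[4,6,7,3,8]),
      ([],[0,5,1,2],[4,6,7,8,3]), ([],[0,5,1,2],[4,6,8,3,7]), ([],[0,5,1,3],[4,6,7,8,2]),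
      ([],[0,5,7,2],[4,1,6,3,8]), ([],[0,6,1,2],[3,4,5,7,8]), ([],[0,6,1,2],[4,5,8,3,7])]"
    by (rule split) code_simp
  have split_4: "list_all (split_clause e D) [
      ([],[0,6,1,3],[4,5,7,8,2]), ([],[0,7,1,2],[3,4,5,6,8]), ([],[0,7,1,3],[2,4,5,6,8]),
      ([],[0,7,1,3],[4,5,6,8,2]), ([],[0,7,1,3],[5,2,4,6,8]), ([],[1,0,2,3],[4,5,6,7,8]),
      ([],[1,2,0,3],[4,5,6,7,8]), ([],[1,2,3,0],[4,5,6,7,8]), ([],[1,2,3,4],[0,5,6,7,8]),
      ([],[1,2,3,4],[5,0,6,7,8]), ([],[1,2,3,4],[5,6,0,7,8]), ([],[1,2,3,4],[5,6,7,0,8]),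
      ([],[1,2,3,4],[5,6,8,0,7]), ([],[1,2,3,4],[5,8,0,6,7]), ([],[1,2,3,4],[6,8,0,5,7]),
      ([],[1,2,3,4],[7,0,5,6,8]), ([],[1,2,3,5],[0,4,6,7,8]), ([],[1,2,3,5],[4,6,8,0,7]),
      ([],[1,2,3,5],[4,7,8,0,6]), ([],[1,2,3,5],[4,8,0,6,7]), ([],[1,2,3,5],[6,7,8,0,4]),
      ([],[1,2,3,5],[7,0,4,6,8]), ([],[1,2,3,6],[0,4,5,7,8]), ([],[1,2,3,6],[4,5,7,8,0]),
      ([],[1,2,3,6],[4,5,8,0,7]), ([],[1,2,3,6],[4,7,0,5,8]), ([],[1,2,3,6],[7,0,4,5,8]),
      ([],[1,2,3,7],[0,4,5,6,8]), ([],[1,2,4,3],[5,0,6,7,8]), ([],[1,2,4,3],[5,6,0,7,8])]"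
    by (rule split) code_simp
  have split_5: "list_all (split_clause e D) [
      ([],[1,2,4,3],[5,6,7,8,0]), ([],[1,2,4,3],[5,6,8,0,7]), ([],[1,2,4,3],[5,7,0,6,8]),
      ([],[1,2,4,3],[6,0,5,7,8]), ([],[1,2,5,3],[0,4,6,7,8]), ([],[1,2,5,3],[4,6,7,8,0]),
      ([],[1,2,5,3],[4,6,8,0,7]), ([],[1,2,5,3],[4,8,0,6,7]), ([],[1,2,5,3],[6,0,4,7,8]),
      ([],[1,2,5,3],[8,0,4,6,7]), ([],[1,2,6,3],[0,4,5,7,8]), ([],[1,2,6,3],[4,8,0,5,7]),
      ([],[1,2,6,3],[5,7,8,0,4]), ([],[1,2,6,3],[7,0,4,5,8]), ([],[1,2,6,3],[8,0,4,5,7]),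
      ([],[1,2,7,3],[0,4,5,6,8]), ([],[1,2,7,3],[4,6,0,5,8]), ([],[1,2,7,3],[8,0,4,5,6]),
      ([],[1,3,0,2],[4,5,6,7,8]), ([],[1,3,0,4],[5,6,2,7,8]), ([],[1,3,0,4],[5,6,7,2,8]),
      ([],[1,3,0,4],[6,2,5,7,8]), ([],[1,3,0,5],[2,4,6,7,8]), ([],[1,3,0,5],[4,6,7,8,2]),
      ([],[1,3,0,6],[2,4,5,7,8]), ([],[1,3,0,7],[2,4,5,6,8]), ([],[1,3,4,2],[5,0,6,7,8]),
      ([],[1,3,4,2],[5,6,7,0,8]), ([],[1,3,4,2],[5,6,7,8,0]), ([],[1,3,4,2],[6,0,5,7,8])]"
    by (rule split) code_simp
  have split_6: "list_all (split_clause e D) [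
      ([],[1,3,4,7],[0,2,5,6,8]), ([],[1,3,5,0],[2,4,6,7,8]), ([],[1,3,5,2],[0,4,6,7,8]),
      ([],[1,3,5,2],[4,6,0,7,8]), ([],[1,3,5,2],[4,6,7,0,8]), ([],[1,3,6,0],[2,4,5,7,8]),
      ([],[1,3,6,2],[0,4,5,7,8]), ([],[1,3,6,2],[4,5,7,0,8]), ([],[1,3,7,2],[0,4,5,6,8]),
      ([],[1,4,2,3],[5,6,0,7,8]), ([],[1,4,2,3],[5,7,8,0,6]), ([],[1,4,2,3],[5,8,0,6,7]),
      ([],[1,4,2,3],[7,0,5,6,8]), ([],[1,4,2,5],[6,3,7,0,8]), ([],[1,4,2,6],[3,5,7,0,8]),
      ([],[1,4,3,0],[5,6,7,8,2]), ([],[1,4,5,6],[2,7,3,8,0]), ([],[1,5,0,2],[3,4,6,7,8]),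
      ([],[1,5,2,3],[4,6,0,7,8]), ([],[1,5,2,3],[4,6,8,0,7]), ([],[1,5,2,3],[6,0,4,7,8]),
      ([],[1,5,2,3],[7,0,4,6,8]), ([],[1,5,3,0],[4,6,2,7,8]), ([],[1,6,2,3],[0,4,5,7,8]),
      ([],[1,6,2,3],[4,5,7,0,8]), ([],[1,6,2,3],[4,5,7,8,0]), ([],[1,6,2,3],[4,7,0,5,8]),
      ([],[1,6,2,3],[4,7,8,0,5]), ([],[1,6,2,3],[5,7,0,4,8]), ([],[1,6,3,0],[4,5,7,2,8])]"
    by (rule split) code_simp
  have split_7: "list_all (split_clause e D) [
      ([],[1,6,3,0],[4,5,7,8,2]), ([],[1,7,0,2],[4,5,6,8,3]), ([],[1,7,2,3],[0,4,5,6,8]),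
      ([],[1,7,2,3],[4,0,5,6,8]), ([],[1,7,2,3],[4,8,0,5,6]), ([],[1,7,2,3],[5,6,8,0,4]),
      ([],[1,7,2,3],[8,0,4,5,6]), ([],[1,7,3,0],[4,2,5,6,8]), ([],[1,7,3,0],[4,5,2,6,8]),
      ([],[2,0,1,3],[4,5,6,7,8]), ([],[2,0,3,4],[5,6,7,8,1]), ([],[2,0,3,5],[4,6,1,7,8]),
      ([],[2,0,3,5],[4,6,7,1,8]), ([],[2,0,3,5],[4,6,7,8,1]), ([],[2,0,3,6],[1,4,5,7,8]),
      ([],[2,0,3,6],[4,5,7,1,8]), ([],[2,0,3,6],[5,7,1,4,8]), ([],[2,0,4,3],[5,6,7,1,8]),
      ([],[2,0,4,3],[5,6,7,8,1]), ([],[2,0,5,3],[4,6,7,8,1]), ([],[2,0,7,3],[4,1,5,6,8]),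
      ([],[2,0,7,3],[4,5,1,6,8]), ([],[2,0,7,3],[4,6,1,5,8]), ([],[2,0,7,3],[5,1,4,6,8]),
      ([],[2,3,0,1],[4,5,6,7,8]), ([],[2,3,0,4],[5,6,7,1,8]), ([],[2,3,0,5],[4,6,7,8,1]),
      ([],[2,3,4,1],[0,5,6,7,8]), ([],[2,3,4,1],[5,0,6,7,8]), ([],[2,3,4,1],[5,6,7,0,8])]"
    by (rule split) code_simp
  have split_8: "list_all (split_clause e D) [
      ([],[2,3,4,1],[5,6,8,0,7]), ([],[2,3,4,1],[5,7,0,6,8]), ([],[2,3,4,6],[0,1,5,7,8]),
      ([],[2,3,5,1],[0,4,6,7,8]), ([],[2,3,5,1],[6,7,0,4,8]), ([],[2,3,6,0],[1,4,5,7,8]),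
      ([],[2,3,6,0],[5,1,4,7,8]), ([],[2,3,6,1],[4,5,7,0,8]), ([],[2,3,6,7],[0,1,4,5,8]),
      ([],[2,3,7,0],[1,4,5,6,8]), ([],[2,3,7,0],[4,5,1,6,8]), ([],[2,3,7,0],[5,1,4,6,8]),
      ([],[2,3,7,1],[0,4,5,6,8]), ([],[2,4,1,3],[5,6,7,8,0]), ([],[2,4,1,3],[6,0,5,7,8]),
      ([],[2,5,1,3],[0,4,6,7,8]), ([],[2,5,1,3],[4,6,0,7,8]), ([],[2,5,1,3],[6,0,4,7,8]),
      ([],[2,5,3,0],[4,6,7,1,8]), ([],[2,5,3,0],[4,6,7,8,1]), ([],[2,6,1,3],[0,4,5,7,8]),
      ([],[2,6,3,0],[4,5,7,8,1]), ([],[2,7,1,3],[0,4,5,6,8]), ([],[2,7,1,3],[4,5,6,8,0]),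
      ([],[2,7,3,0],[1,4,5,6,8]), ([],[2,7,3,0],[4,5,6,8,1]), ([],[3,0,1,2],[4,5,6,7,8]),
      ([],[3,0,1,4],[5,6,7,8,2]), ([],[3,0,1,7],[2,4,5,6,8]), ([],[3,0,4,1],[5,6,7,8,2])]"
    by (rule split) code_simp
  have split_9: "list_all (split_clause e D) [
      ([],[3,0,4,2],[5,6,1,7,8]), ([],[3,0,4,2],[5,6,7,8,1]), ([],[3,0,4,5],[1,6,7,8,2]),
      ([],[3,6,0,1],[2,4,5,7,8]), ([],[3,6,1,2],[0,4,5,7,8]), ([],[3,6,1,2],[4,5,7,8,0]),
      ([],[3,7,1,2],[0,4,5,6,8]), ([],[3,7,1,2],[4,5,6,8,0]), ([],[4,1,5,6],[2,3,7,8,0]),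
      ([],[4,1,6,7],[2,5,8,0,3]), ([],[4,2,3,5],[6,0,7,8,1]), ([],[4,2,5,7],[1,6,3,8,0]),
      ([],[4,2,6,3],[5,7,8,0,1]), ([],[4,3,6,7],[0,5,1,8,2]), ([],[4,5,1,2],[0,6,7,8,3]),
      ([],[4,5,7,0],[1,6,8,2,3]), ([],[4,6,0,7],[2,5,8,1,3]), ([],[4,7,0,5],[6,1,8,2,3]),
      ([],[5,0,6,7],[1,4,8,2,3]), ([],[5,1,2,3],[4,6,7,8,0]), ([],[5,1,2,7],[0,3,4,6,8]),
      ([],[5,1,6,7],[2,3,4,8,0]), ([],[5,2,0,3],[4,6,7,1,8]), ([],[5,2,3,6],[4,7,8,0,1]),
      ([],[5,7,3,0],[4,6,1,8,2]), ([],[6,0,5,7],[2,4,8,1,3]), ([],[6,1,2,3],[0,4,5,7,8]),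
      ([],[6,1,2,3],[4,5,7,8,0]), ([],[6,1,2,3],[4,7,0,5,8]), ([],[6,1,2,3],[5,7,8,0,4])]"
    by (rule split) code_simp
  have split_10: "list_all (split_clause e D) [
      ([],[6,1,3,0],[4,7,8,2,5]), ([],[6,2,0,3],[4,5,7,8,1]), ([],[6,2,3,0],[4,5,7,1,8]),
      ([],[7,0,1,2],[4,5,6,8,3]), ([],[7,0,1,3],[4,5,6,8,2]), ([],[7,1,2,3],[0,4,5,6,8]),
      ([],[7,1,2,3],[4,5,0,6,8]), ([],[7,1,2,3],[4,8,0,5,6]), ([],[7,1,2,3],[6,8,0,4,5]),
      ([],[7,1,3,0],[4,5,6,8,2]), ([],[7,1,3,0],[4,5,8,2,6]), ([],[7,2,3,0],[4,5,6,8,1]),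
      ([],[7,3,0,1],[2,4,5,6,8]), ([],[0,1,4,5,6],[2,7,3,8]), ([],[0,1,4,5,7],[2,3,6,8]),
      ([],[0,1,4,6,7],[2,3,5,8]), ([],[0,2,4,5,7],[6,1,3,8]), ([],[0,2,4,6,7],[1,3,5,8]),
      ([],[0,3,4,6,7],[5,8,1,2]), ([],[0,4,5,3,7],[6,8,1,2]), ([],[0,4,5,6,7],[1,2,8,3]),
      ([],[0,4,5,6,7],[1,3,8,2]), ([],[0,4,5,6,7],[1,8,2,3]), ([],[0,4,5,6,7],[2,3,8,1]),
      ([],[0,4,5,6,7],[2,8,1,3]), ([],[0,4,5,6,7],[3,8,1,2]), ([],[0,4,5,6,7],[8,1,2,3]),
      ([],[0,5,1,6,7],[2,3,4,8]), ([],[0,5,1,7,2],[3,4,6,8]), ([],[1,2,3,4,5],[6,0,7,8])]"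
    by (rule split) code_simp
  have split_11: "list_all (split_clause e D) [
      ([],[1,2,3,4,5],[6,7,8,0]), ([],[1,2,3,4,5],[6,8,0,7]), ([],[1,2,3,5,7],[0,4,6,8]),
      ([],[1,2,4,3,5],[6,7,8,0]), ([],[1,3,4,2,5],[6,7,0,8]), ([],[1,4,2,3,5],[6,0,7,8]),
      ([],[1,4,2,3,5],[6,7,0,8]), ([],[1,4,2,7,3],[5,0,6,8]), ([],[1,4,3,6,2],[0,5,7,8]),
      ([],[1,4,5,3,6],[2,7,8,0]), ([],[1,4,5,6,7],[2,8,3,0]), ([],[1,4,6,0,7],[2,5,8,3]),
      ([],[1,4,6,2,3],[5,7,0,8]), ([],[1,5,2,4,3],[6,0,7,8]), ([],[1,6,2,3,5],[4,7,8,0]),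
      ([],[1,6,3,7,0],[2,4,5,8]), ([],[1,6,7,2,3],[0,4,5,8]), ([],[1,6,7,2,3],[4,8,0,5]),
      ([],[1,7,2,4,3],[5,6,0,8]), ([],[2,0,4,6,7],[1,3,5,8]), ([],[2,3,0,4,5],[6,7,8,1]),
      ([],[2,3,0,4,6],[5,7,1,8]), ([],[2,3,4,6,0],[1,5,7,8]), ([],[2,4,1,3,5],[6,0,7,8]),
      ([],[2,4,1,6,3],[5,7,8,0]), ([],[2,4,3,5,6],[7,8,0,1]), ([],[2,4,3,7,0],[5,1,6,8]),
      ([],[2,4,5,6,7],[0,8,1,3]), ([],[2,4,5,6,7],[1,3,8,0]), ([],[2,4,5,6,7],[1,8,3,0])]"
    by (rule split) code_simp
  have split_12: "list_all (split_clause e D) [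
      ([],[2,4,5,6,7],[3,0,8,1]), ([],[2,5,6,1,3],[4,7,0,8]), ([],[3,4,1,6,2],[5,7,8,0]),
      ([],[3,4,5,6,7],[0,1,8,2]), ([],[3,4,5,6,7],[0,2,8,1]), ([],[3,4,5,6,7],[0,8,1,2]),
      ([],[4,1,3,5,6],[0,2,7,8]), ([],[4,1,5,6,7],[2,8,0,3]), ([],[4,2,5,6,7],[0,3,8,1]),
      ([],[4,2,5,6,7],[3,8,0,1]), ([],[4,2,5,6,7],[8,1,3,0]), ([],[4,3,5,6,7],[0,1,8,2]),
      ([],[4,3,5,6,7],[0,8,1,2]), ([],[4,5,0,6,7],[1,3,8,2]), ([],[4,5,1,6,7],[2,0,8,3]),
      ([],[4,5,1,6,7],[8,2,3,0]), ([],[4,5,3,6,7],[0,1,8,2]), ([],[4,5,6,1,7],[2,3,8,0]),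
      ([],[4,5,6,1,7],[8,2,3,0]), ([],[4,5,6,3,7],[0,1,8,2]), ([],[4,5,6,7,0],[8,1,2,3]),
      ([],[4,5,6,7,1],[8,2,0,3]), ([],[4,5,6,7,3],[0,8,1,2]), ([],[4,6,0,2,7],[5,8,1,3]),
      ([],[4,6,0,5,7],[1,8,2,3]), ([],[4,6,0,5,7],[8,1,2,3]), ([],[4,6,1,5,7],[2,3,8,0]),
      ([],[4,6,2,5,7],[1,8,3,0]), ([],[4,6,3,5,7],[0,8,1,2]), ([],[4,7,0,5,6],[1,8,2,3])]"
    by (rule split) code_simp
  have split_13: "list_all (split_clause e D) [
      ([],[4,7,1,5,6],[8,2,0,3]), ([],[5,1,2,6,3],[8,0,4,7]), ([],[5,1,2,7,3],[0,4,6,8]),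
      ([],[5,1,4,6,7],[2,8,3,0]), ([],[5,2,0,3,6],[4,7,1,8]), ([],[5,2,0,6,7],[1,3,4,8]),
      ([],[5,2,4,6,7],[0,8,1,3]), ([],[5,6,2,0,3],[4,7,8,1]), ([],[5,7,0,4,6],[8,1,2,3]),
      ([],[5,7,1,2,3],[4,6,0,8]), ([],[6,0,4,5,7],[8,1,2,3]), ([],[6,1,2,7,3],[5,8,0,4]),
      ([],[6,1,7,2,3],[4,5,8,0]), ([],[7,1,2,5,3],[4,6,8,0]), ([],[7,1,4,2,3],[5,6,8,0]),
      ([],[7,1,6,2,3],[4,5,8,0]), ([],[0,4,1,5,6,7],[2,3,8]), ([],[0,4,2,5,6,7],[1,3,8]),
      ([0],[1,2],[3,4,5,6,7,8]), ([0],[1,2],[4,3,5,6,7,8]), ([0],[1,2],[4,5,3,6,7,8]),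
      ([0],[1,2],[4,5,7,3,6,8]), ([0],[1,2],[4,5,7,8,3,6]), ([0],[1,2],[4,5,8,3,6,7]),
      ([0],[1,2],[4,6,7,3,5,8]), ([0],[1,2],[4,7,8,3,5,6]), ([0],[1,2],[5,7,3,4,6,8]),
      ([0],[1,2],[7,3,4,5,6,8]), ([0],[1,3],[2,4,5,6,7,8]), ([0],[1,3],[4,2,5,6,7,8])]"
    by (rule split) code_simp
  have split_14: "list_all (split_clause e D) [
      ([0],[1,3],[4,5,2,6,7,8]), ([0],[1,3],[4,5,6,2,7,8]), ([0],[1,3],[4,5,6,7,2,8]),
      ([0],[1,3],[4,5,6,8,2,7]), ([0],[1,3],[4,5,7,2,6,8]), ([0],[1,3],[4,5,7,8,2,6]),
      ([0],[1,3],[4,6,2,5,7,8]), ([0],[1,3],[4,6,7,2,5,8]), ([0],[1,3],[4,6,8,2,5,7]),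
      ([0],[1,3],[4,7,2,5,6,8]), ([0],[1,3],[5,2,4,6,7,8]), ([0],[1,3],[5,6,7,2,4,8]),
      ([0],[1,3],[5,6,7,8,2,4]), ([0],[1,3],[6,2,4,5,7,8]), ([0],[1,3],[7,2,4,5,6,8]),
      ([0],[2,3],[4,5,1,6,7,8]), ([0],[2,3],[4,5,6,1,7,8]), ([0],[2,3],[4,5,6,7,1,8]),
      ([0],[2,3],[4,5,7,1,6,8]), ([0],[2,3],[4,5,7,8,1,6]), ([0],[2,3],[4,5,8,1,6,7]),
      ([0],[2,3],[4,6,1,5,7,8]), ([0],[2,3],[4,6,8,1,5,7]), ([0],[2,3],[4,7,1,5,6,8]),
      ([0],[2,3],[5,6,1,4,7,8]), ([0],[2,3],[5,6,7,1,4,8]), ([0],[2,3],[6,7,1,4,5,8]),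
      ([0],[3,8],[4,1,5,2,6,7]), ([1],[2,3],[4,5,6,7,0,8]), ([1],[2,3],[4,6,0,5,7,8])]"
    by (rule split) code_simp
  have split_15: "list_all (split_clause e D) [
      ([2],[1,3],[4,5,6,0,7,8]), ([2],[1,3],[4,5,6,8,0,7]), ([2],[3,0],[4,5,6,7,8,1]),
      ([3],[1,2],[4,5,6,0,7,8]), ([3],[1,2],[4,6,0,5,7,8]), ([3],[1,2],[6,0,4,5,7,8]),
      ([6],[1,3],[0,2,4,5,7,8])]"
    by (rule split) code_simp
  show False
    using [[argo_timeout = 3600]]
      D(2) in_3[of 0] in_3[of 1] in_3[of 2] in_3[of 3] in_3[of 4] in_3[of 5] in_3[of 6] in_3[of 7]
      in_3[of 8] in_4[of 0] in_4[of 1] in_4[of 2] in_4[of 3] in_4[of 4] in_4[of 5] in_4[of 6] in_4[of 7]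
      in_4[of 8] in_5[of 0] in_5[of 1] in_5[of 2] in_5[of 3] in_5[of 4] in_5[of 5] in_5[of 6] in_5[of 7]
      in_5[of 8] counts_sum[OF D(1), unfolded upt_lists clause_simps] split_1[unfolded clause_simps]
      split_2[unfolded clause_simps] split_3[unfolded clause_simps] split_4[unfolded clause_simps]
      split_5[unfolded clause_simps] split_6[unfolded clause_simps] split_7[unfolded clause_simps]
      split_8[unfolded clause_simps] split_9[unfolded clause_simps] split_10[unfolded clause_simps]
      split_11[unfolded clause_simps] split_12[unfolded clause_simps] split_13[unfolded clause_simps]
      split_14[unfolded clause_simps] split_15[unfolded clause_simps]
      asym_clauses[unfolded upt_lists clause_simps] degree_clauses[unfolded upt_lists clause_simps]
      sorted[unfolded upt_lists clause_simps]
    by argo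
qed

lemma not_critical_labelling_9_4: "\<not> critical_labelling 9 4 e"
proof
  assume "critical_labelling 9 4 e"
  then interpret critical_labelling 9 4 e .
  obtain D T where D: "counts 9 (\<lambda>i j. e j i) D T" "\<not> D 0 3"
    and split: "\<And>ss. list_all (admissible_split 9 4) ss \<Longrightarrow> list_all (split_clause e D) ss"
    by (rule in_counts) blast
  note in_3 = counts_choices[OF D(1) Suc_numerals(1), unfolded upt_lists clause_simps]
  note in_4 = counts_choices[OF D(1) Suc_numerals(2), unfolded upt_lists clause_simps]
  note in_5 = counts_choices[OF D(1) Suc_numerals(3), unfolded upt_lists clause_simps]
  have split_1: "list_all (split_clause e D) [
      ([],[0,1,2,3],[5,7,8,4,6]), ([],[0,2,3,4],[6,7,8,1,5]), ([],[0,5,6,7],[2,4,8,1,3]),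
      ([],[1,2,0,3],[5,4,6,7,8]), ([],[1,2,3,4],[5,0,6,7,8]), ([],[1,2,3,4],[5,6,7,0,8]),
      ([],[1,2,3,4],[5,6,7,8,0]), ([],[1,2,3,4],[5,7,0,6,8]), ([],[1,2,3,4],[6,0,5,7,8]),
      ([],[1,2,3,4],[8,0,5,6,7]), ([],[1,3,0,4],[5,2,6,7,8]), ([],[2,3,4,5],[6,7,8,1,0]),
      ([],[2,3,6,4],[0,5,7,1,8]), ([],[4,5,6,7],[1,2,8,0,3]), ([],[7,1,3,4],[0,2,5,6,8]),
      ([],[7,1,3,4],[0,5,6,8,2]), ([],[0,1,5,2,3],[6,7,4,8]), ([],[0,1,6,2,3],[5,7,8,4]),
      ([],[0,3,5,6,7],[1,2,4,8]), ([],[0,5,6,2,7],[1,3,4,8]), ([],[0,6,1,2,4],[5,7,8,3]),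
      ([],[1,0,2,3,4],[5,6,7,8]), ([],[1,2,0,3,4],[5,6,7,8]), ([],[1,2,3,4,0],[5,6,7,8]),
      ([],[1,2,3,5,4],[6,0,7,8]), ([],[1,2,4,0,3],[5,6,7,8]), ([],[2,0,1,3,4],[5,6,7,8]),
      ([],[2,3,0,4,5],[1,6,7,8]), ([],[2,3,4,5,1],[6,0,7,8]), ([],[2,3,7,0,4],[5,1,6,8])]"
    by (rule split) code_simp
  have split_2: "list_all (split_clause e D) [
      ([],[2,3,7,1,4],[5,6,8,0]), ([],[2,4,0,1,3],[5,6,7,8]), ([],[2,7,1,3,4],[0,5,6,8]),
      ([],[2,7,3,0,4],[5,1,6,8]), ([],[4,0,1,2,3],[5,6,7,8]), ([],[7,1,2,4,0],[5,6,8,3]),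
      ([0],[1,2,3],[4,5,6,7,8]), ([0],[1,2,3],[5,6,4,7,8]), ([0],[1,2,3],[5,6,8,4,7]),
      ([0],[1,2,3],[5,7,4,6,8]), ([0],[1,2,3],[6,4,5,7,8]), ([0],[1,2,3],[6,7,4,5,8]),
      ([0],[1,2,3],[7,4,5,6,8]), ([0],[1,2,4],[3,5,6,7,8]), ([0],[1,2,4],[5,3,6,7,8]),
      ([0],[1,2,4],[5,6,3,7,8]), ([0],[1,2,4],[5,6,7,3,8]), ([0],[1,2,4],[5,7,3,6,8]),
      ([0],[1,2,4],[5,7,8,3,6]), ([0],[1,2,4],[5,8,3,6,7]), ([0],[1,2,4],[6,3,5,7,8]),
      ([0],[1,2,4],[6,8,3,5,7]), ([0],[1,3,4],[5,6,2,7,8]), ([0],[1,3,4],[5,6,7,2,8]),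
      ([0],[1,3,4],[5,6,7,8,2]), ([0],[1,3,4],[5,7,2,6,8]), ([0],[1,3,4],[5,7,8,2,6]),
      ([0],[1,3,4],[6,2,5,7,8]), ([0],[1,3,8],[5,2,4,6,7]), ([0],[1,4,7],[2,5,6,3,8])]"
    by (rule split) code_simp
  have split_3: "list_all (split_clause e D) [
      ([0],[1,4,7],[5,2,3,6,8]), ([0],[1,4,8],[2,5,6,3,7]), ([0],[1,4,8],[5,2,6,3,7]),
      ([0],[1,5,7],[2,3,6,8,4]), ([0],[1,5,8],[2,6,7,3,4]), ([0],[1,6,7],[2,3,5,8,4]),
      ([0],[2,3,4],[5,6,1,7,8]), ([0],[2,3,4],[5,7,1,6,8]), ([0],[2,3,4],[5,7,8,1,6]),
      ([0],[2,3,6],[5,1,7,8,4]), ([0],[2,4,6],[5,7,1,8,3]), ([0],[2,4,7],[5,1,3,6,8]),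
      ([0],[2,5,3],[6,7,1,4,8]), ([0],[2,5,8],[6,7,1,3,4]), ([0],[2,6,4],[1,5,7,3,8]),
      ([0],[3,5,6],[7,8,1,2,4]), ([0],[4,6,8],[1,2,3,5,7]), ([0],[5,1,4],[6,7,2,8,3]),
      ([0],[5,2,3],[6,8,1,4,7]), ([0],[5,2,7],[6,1,3,4,8]), ([0],[5,4,7],[1,6,8,2,3]),
      ([0],[5,6,2],[7,1,3,4,8]), ([0],[5,6,7],[1,2,3,8,4]), ([0],[5,6,7],[1,2,4,8,3]),
      ([0],[5,6,7],[1,2,8,3,4]), ([0],[5,6,7],[1,3,8,2,4]), ([0],[5,6,7],[1,4,8,2,3]),
      ([0],[5,6,7],[1,8,2,3,4]), ([0],[5,6,7],[2,3,8,1,4]), ([0],[5,6,7],[8,1,2,3,4])]"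
    by (rule split) code_simp
  have split_4: "list_all (split_clause e D) [
      ([0],[5,6,8],[1,2,3,7,4]), ([0],[5,6,8],[1,3,7,2,4]), ([0],[5,6,8],[1,4,7,2,3]),
      ([0],[5,6,8],[1,7,2,3,4]), ([0],[5,6,8],[7,1,2,3,4]), ([0],[5,7,4],[1,2,6,8,3]),
      ([0],[5,7,8],[1,2,3,4,6]), ([0],[5,7,8],[1,2,3,6,4]), ([0],[5,7,8],[1,2,6,3,4]),
      ([0],[5,7,8],[1,3,6,2,4]), ([0],[5,7,8],[1,4,6,2,3]), ([0],[5,7,8],[1,6,2,3,4]),
      ([0],[5,7,8],[2,3,6,1,4]), ([0],[5,7,8],[2,6,1,3,4]), ([0],[5,7,8],[3,6,1,2,4]),
      ([0],[5,7,8],[6,1,2,3,4]), ([0],[5,8,3],[1,6,7,2,4]), ([0],[6,4,7],[1,5,2,8,3]),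
      ([0],[6,7,4],[1,5,8,2,3]), ([0],[6,7,8],[1,2,3,4,5]), ([0],[6,7,8],[1,2,4,5,3]),
      ([0],[6,7,8],[1,2,5,3,4]), ([0],[6,7,8],[1,3,4,5,2]), ([0],[6,7,8],[1,3,5,2,4]),
      ([0],[6,7,8],[2,3,5,1,4]), ([0],[6,7,8],[2,5,1,3,4]), ([0],[6,7,8],[3,5,1,2,4]),
      ([0],[6,7,8],[4,5,1,2,3]), ([0],[6,8,3],[1,5,7,2,4]), ([0],[7,8,3],[5,1,2,4,6])]"
    by (rule split) code_simp
  have split_5: "list_all (split_clause e D) [
      ([1],[0,2,4],[5,6,7,8,3]), ([1],[2,3,4],[0,5,6,7,8]), ([1],[2,3,4],[5,6,0,7,8]),
      ([1],[2,3,4],[5,6,8,0,7]), ([1],[2,3,4],[5,7,8,0,6]), ([1],[2,3,4],[6,7,8,0,5]),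
      ([1],[3,0,4],[5,2,6,7,8]), ([1],[3,4,0],[5,6,8,2,7]), ([1],[5,6,7],[2,3,4,8,0]),
      ([1],[5,6,8],[2,3,4,7,0]), ([1],[5,6,8],[2,3,7,4,0]), ([1],[5,7,8],[0,2,3,4,6]),
      ([1],[5,7,8],[0,2,3,6,4]), ([1],[6,7,8],[2,0,3,5,4]), ([1],[6,7,8],[3,0,2,4,5]),
      ([1],[8,2,3],[5,6,4,7,0]), ([2],[0,1,3],[5,6,7,4,8]), ([2],[0,1,4],[5,6,8,3,7]),
      ([2],[0,1,4],[6,7,3,5,8]), ([2],[0,3,4],[5,6,7,1,8]), ([2],[0,5,7],[1,3,6,8,4]),
      ([2],[0,5,8],[6,7,1,3,4]), ([2],[1,3,0],[5,4,6,7,8]), ([2],[1,3,4],[5,6,0,7,8]),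
      ([2],[1,3,4],[5,6,8,0,7]), ([2],[1,3,4],[6,7,0,5,8]), ([2],[1,3,4],[7,0,5,6,8]),
      ([2],[1,3,4],[7,8,0,5,6]), ([2],[1,4,7],[3,0,5,6,8]), ([2],[3,0,4],[5,1,6,7,8])]"
    by (rule split) code_simp
  have split_6: "list_all (split_clause e D) [
      ([2],[3,0,4],[5,6,7,8,1]), ([2],[3,4,0],[5,6,7,1,8]), ([2],[3,4,0],[5,6,8,1,7]),
      ([2],[5,6,7],[0,3,8,1,4]), ([2],[5,6,7],[1,3,4,8,0]), ([2],[5,6,7],[1,4,8,0,3]),
      ([2],[5,6,8],[1,7,3,0,4]), ([2],[5,6,8],[3,7,1,4,0]), ([2],[5,7,8],[0,3,6,1,4]),
      ([2],[5,7,8],[1,3,0,4,6]), ([2],[6,0,8],[5,1,3,4,7]), ([2],[6,7,8],[0,1,4,5,3]),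
      ([2],[6,7,8],[0,1,5,3,4]), ([2],[6,7,8],[0,3,5,1,4]), ([3],[0,1,2],[5,4,6,7,8]),
      ([3],[0,1,2],[5,6,7,4,8]), ([3],[0,2,4],[5,1,6,7,8]), ([3],[0,2,4],[5,6,8,1,7]),
      ([3],[0,6,7],[1,2,5,8,4]), ([3],[1,2,4],[5,8,0,6,7]), ([3],[1,2,4],[6,7,0,5,8]),
      ([3],[1,2,4],[6,8,0,5,7]), ([3],[1,4,0],[2,5,6,7,8]), ([3],[5,6,7],[0,1,8,2,4]),
      ([3],[5,6,7],[1,8,0,2,4]), ([3],[5,6,8],[0,1,2,4,7]), ([3],[5,6,8],[0,1,2,7,4]),
      ([3],[5,7,8],[0,1,2,6,4]), ([3],[5,7,8],[1,2,4,6,0]), ([3],[5,7,8],[1,4,0,6,2])]"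
    by (rule split) code_simp
  have split_7: "list_all (split_clause e D) [
      ([3],[5,7,8],[1,6,2,4,0]), ([3],[6,0,7],[1,5,8,2,4]), ([3],[6,7,8],[0,1,2,4,5]),
      ([3],[6,7,8],[0,1,4,5,2]), ([3],[6,7,8],[0,1,5,2,4]), ([4],[0,1,3],[6,7,2,5,8]),
      ([4],[0,2,3],[5,6,7,8,1]), ([4],[0,2,3],[5,6,8,1,7]), ([4],[0,5,6],[1,7,8,2,3]),
      ([4],[0,6,7],[1,5,8,2,3]), ([4],[0,6,8],[1,2,5,7,3]), ([4],[0,7,8],[5,1,2,6,3]),
      ([4],[1,2,3],[0,5,6,7,8]), ([4],[1,2,3],[7,0,5,6,8]), ([4],[1,7,3],[0,5,2,6,8]),
      ([4],[2,0,3],[5,8,1,6,7]), ([4],[2,3,0],[6,7,1,5,8]), ([4],[5,6,7],[0,1,2,8,3]),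
      ([4],[5,6,7],[0,1,8,2,3]), ([4],[5,6,7],[1,8,0,2,3]), ([4],[5,6,8],[0,1,2,7,3]),
      ([4],[5,6,8],[0,1,7,2,3]), ([4],[5,6,8],[0,2,7,1,3]), ([4],[5,6,8],[1,2,7,0,3]),
      ([4],[5,6,8],[3,7,0,1,2]), ([4],[5,6,8],[7,0,1,2,3]), ([4],[5,7,8],[0,1,2,3,6]),
      ([4],[5,7,8],[0,1,6,2,3]), ([4],[6,0,8],[5,7,1,2,3]), ([5],[0,6,8],[2,7,1,3,4])]"
    by (rule split) code_simp
  have split_8: "list_all (split_clause e D) [
      ([5],[0,7,8],[1,3,4,6,2]), ([5],[1,2,3],[6,4,0,7,8]), ([5],[1,2,4],[6,8,0,3,7]),
      ([5],[1,3,4],[6,0,7,2,8]), ([5],[2,3,4],[6,0,7,1,8]), ([5],[6,7,8],[1,2,3,0,4]),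
      ([5],[6,7,8],[1,3,0,2,4]), ([5],[6,7,8],[1,4,0,2,3]), ([5],[6,7,8],[2,3,4,0,1]),
      ([5],[7,0,6],[2,8,1,3,4]), ([5],[7,8,0],[1,2,4,6,3]), ([6],[0,2,4],[5,7,1,8,3]),
      ([6],[0,5,7],[1,3,4,8,2]), ([6],[0,5,7],[2,8,1,3,4]), ([6],[0,5,8],[1,2,7,3,4]),
      ([6],[1,2,3],[4,0,5,7,8]), ([6],[1,2,4],[5,7,0,3,8]), ([6],[1,3,4],[0,2,5,7,8]),
      ([6],[1,3,4],[5,7,8,0,2]), ([6],[1,3,4],[7,0,2,5,8]), ([6],[1,4,0],[5,8,2,3,7]),
      ([6],[2,3,0],[5,7,1,4,8]), ([6],[2,3,4],[0,5,8,1,7]), ([6],[2,3,4],[5,7,8,0,1]),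
      ([6],[5,7,8],[1,4,0,2,3]), ([6],[5,8,0],[1,2,7,3,4]), ([6],[7,8,0],[1,5,2,3,4]),
      ([7],[0,1,2],[3,4,5,6,8]), ([7],[0,1,3],[5,2,4,6,8]), ([7],[0,5,6],[2,8,1,3,4])]"
    by (rule split) code_simp
  have split_9: "list_all (split_clause e D) [
      ([7],[0,5,8],[1,2,4,6,3]), ([7],[0,6,8],[1,2,3,5,4]), ([7],[1,2,3],[4,0,5,6,8]),
      ([7],[1,2,3],[5,0,4,6,8]), ([7],[1,2,4],[0,3,5,6,8]), ([7],[2,3,4],[5,6,1,8,0]),
      ([7],[2,3,4],[5,6,8,0,1]), ([7],[3,0,4],[5,1,6,8,2]), ([7],[3,4,0],[1,5,2,6,8]),
      ([7],[5,6,8],[0,1,2,3,4]), ([7],[5,6,8],[2,3,0,1,4]), ([7],[6,0,8],[1,2,3,5,4]),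
      ([8],[0,1,3],[5,2,4,6,7]), ([8],[0,5,6],[1,2,3,4,7]), ([8],[0,5,6],[1,2,4,7,3]),
      ([8],[0,5,6],[1,2,7,3,4]), ([8],[0,5,6],[1,3,4,7,2]), ([8],[1,2,3],[0,5,4,6,7]),
      ([8],[1,2,3],[5,4,0,6,7]), ([8],[1,2,4],[0,5,6,3,7]), ([8],[1,2,4],[3,0,5,6,7]),
      ([8],[1,2,4],[5,3,7,0,6]), ([8],[1,3,0],[5,2,4,6,7]), ([8],[1,3,4],[0,5,2,6,7]),
      ([8],[1,3,4],[0,5,6,2,7]), ([8],[1,3,4],[5,0,7,2,6]), ([8],[1,3,4],[5,7,2,0,6]),
      ([8],[2,3,4],[0,5,1,6,7]), ([8],[5,6,7],[1,2,3,0,4]), ([8],[5,6,7],[1,3,4,0,2])]"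
    by (rule split) code_simp
  have split_10: "list_all (split_clause e D) [
      ([8],[7,0,6],[1,2,3,5,4])]"
    by (rule split) code_simp
  show False
    using [[argo_timeout = 3600]]
      D(2) in_3[of 0] in_3[of 1] in_3[of 2] in_3[of 3] in_3[of 4] in_3[of 5] in_3[of 6] in_3[of 7]
      in_3[of 8] in_4[of 0] in_4[of 1] in_4[of 2] in_4[of 3] in_4[of 4] in_4[of 5] in_4[of 6] in_4[of 7]
      in_4[of 8] in_5[of 0] in_5[of 1] in_5[of 2] in_5[of 3] in_5[of 4] in_5[of 5] in_5[of 6] in_5[of 7]
      in_5[of 8] counts_sum[OF D(1), unfolded upt_lists clause_simps] split_1[unfolded clause_simps]
      split_2[unfolded clause_simps] split_3[unfolded clause_simps] split_4[unfolded clause_simps]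
      split_5[unfolded clause_simps] split_6[unfolded clause_simps] split_7[unfolded clause_simps]
      split_8[unfolded clause_simps] split_9[unfolded clause_simps] split_10[unfolded clause_simps]
      asym_clauses[unfolded upt_lists clause_simps] degree_clauses[unfolded upt_lists clause_simps]
      sorted[unfolded upt_lists clause_simps]
    by argo
qed

text \<open>
  With ten vertices the bound makes all degrees equal to 2. The out-degrees are tracked as well,
  because using both conditions shortens the search.
\<close>

lemma not_critical_labelling_10_2: "\<not> critical_labelling 10 2 e"
proof
  assume "critical_labelling 10 2 e"
  then interpret critical_labelling 10 2 e .
  obtain D T where D: "counts 10 (\<lambda>i j. e j i) D T" "\<not> D 0 3"
    and split: "\<And>ss. list_all (admissible_split 10 2) ss \<Longrightarrow> list_all (split_clause e D) ss"
    by (rule in_counts) blast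
  obtain D' T' where D': "counts 10 e D' T'"
    by (rule out_counts)
  note in_3 = counts_choices[OF D(1) Suc_numerals(1), unfolded upt_lists clause_simps]
  note out_3 = counts_choices[OF D' Suc_numerals(1), unfolded upt_lists clause_simps]
  have split_1: "list_all (split_clause e D) [
      ([],[0,1,2],[3,4,5,6,7,8,9]), ([],[1,2,3],[4,5,6,7,8,0,9]), ([],[1,2,5],[3,4,0,6,7,8,9]),
      ([],[1,0,2,3],[4,5,6,7,8,9]), ([],[1,0,7,2],[3,4,5,6,8,9]), ([],[1,2,0,5],[3,4,6,7,8,9]),
      ([],[1,2,4,6],[0,3,5,7,8,9]), ([],[1,2,4,8],[0,3,5,6,7,9]), ([],[6,2,0,1],[3,4,5,7,8,9]),
      ([],[6,8,1,2,0],[3,4,5,7,9]), ([],[7,8,1,2,0],[3,4,5,6,9]), ([],[0,3,5,6,7,8],[2,4,9,1]),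
      ([],[3,4,5,6,7,8],[1,9,0,2]), ([],[3,4,5,6,7,8],[9,2,0,1]), ([],[0,3,4,5,6,7,8],[1,9,2]),
      ([],[0,3,4,5,6,7,8],[9,1,2])]"
    by (rule split) code_simp
  show False
    using [[argo_timeout = 3600]]
      D(2) in_3[of 0] in_3[of 1] in_3[of 2] in_3[of 3] in_3[of 4] in_3[of 5] in_3[of 6] in_3[of 7]
      in_3[of 8] in_3[of 9] counts_sum[OF D(1), unfolded upt_lists clause_simps] out_3[of 0] out_3[of 1]
      out_3[of 2] out_3[of 3] out_3[of 4] out_3[of 5] out_3[of 6] out_3[of 7] out_3[of 8] out_3[of 9]
      counts_sum[OF D', unfolded upt_lists clause_simps] split_1[unfolded clause_simps]
      asym_clauses[unfolded upt_lists clause_simps] degree_clauses[unfolded upt_lists clause_simps]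
      sorted[unfolded upt_lists clause_simps]
    by argo
qed

lemma not_critical_labelling_10_3: "\<not> critical_labelling 10 3 e"
proof
  assume "critical_labelling 10 3 e"
  then interpret critical_labelling 10 3 e .
  obtain D T where D: "counts 10 (\<lambda>i j. e j i) D T" "\<not> D 0 3"
    and split: "\<And>ss. list_all (admissible_split 10 3) ss \<Longrightarrow> list_all (split_clause e D) ss"
    by (rule in_counts) blast
  obtain D' T' where D': "counts 10 e D' T'"
    by (rule out_counts)
  note in_3 = counts_choices[OF D(1) Suc_numerals(1), unfolded upt_lists clause_simps]
  note out_3 = counts_choices[OF D' Suc_numerals(1), unfolded upt_lists clause_simps]
  have split_1: "list_all (split_clause e D) [
      ([],[1,2,3],[4,5,6,0,7,8,9]), ([],[0,1,2,3],[4,5,6,7,8,9]), ([],[0,1,2,5],[4,6,7,8,9,3]),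
      ([],[0,1,2,8],[3,4,5,6,7,9]), ([],[1,2,0,3],[4,5,6,7,8,9]), ([],[1,2,3,0],[4,5,6,7,8,9]),
      ([],[1,2,3,4],[5,6,7,0,8,9]), ([],[1,2,3,4],[5,6,7,8,9,0]), ([],[1,2,3,5],[4,0,6,7,8,9]),
      ([],[1,2,3,5],[4,6,7,8,9,0]), ([],[1,2,3,5],[6,7,8,9,0,4]), ([],[1,2,3,6],[0,4,5,7,8,9]),
      ([],[1,2,3,7],[0,4,5,6,8,9]), ([],[1,2,3,7],[4,5,0,6,8,9]), ([],[1,2,3,8],[0,4,5,6,7,9]),
      ([],[1,2,4,3],[5,6,7,8,0,9]), ([],[1,2,8,3],[4,0,5,6,7,9]), ([],[1,3,0,2],[4,5,6,7,8,9]),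
      ([],[1,3,0,8],[2,4,5,6,7,9]), ([],[1,3,4,2],[5,6,7,8,9,0]), ([],[2,3,0,1],[4,5,6,7,8,9]),
      ([],[2,3,0,4],[5,6,7,8,9,1]), ([],[2,3,0,7],[4,5,8,1,6,9]), ([],[2,3,0,8],[1,4,5,6,7,9]),
      ([],[0,1,2,4,6],[5,7,8,9,3]), ([],[1,0,2,3,4],[5,6,7,8,9]), ([],[1,0,2,3,5],[4,6,7,8,9]),
      ([],[1,2,4,3,5],[6,7,8,0,9]), ([],[1,2,4,3,6],[5,7,8,0,9]), ([],[1,2,5,6,3],[4,7,8,0,9])]"
    by (rule split) code_simp
  have split_2: "list_all (split_clause e D) [
      ([],[1,2,5,7,3],[4,6,8,0,9]), ([],[1,6,8,2,3],[4,5,7,9,0]), ([],[1,7,8,2,3],[0,4,5,6,9]),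
      ([],[2,0,1,3,5],[4,6,7,8,9]), ([],[2,0,1,6,3],[4,5,7,8,9]), ([],[2,4,5,7,8],[0,1,6,9,3]),
      ([],[4,5,3,7,8],[6,9,0,1,2]), ([],[7,1,2,3,4],[5,6,8,9,0]), ([],[7,8,1,2,3],[0,4,5,6,9]),
      ([],[8,1,2,3,4],[0,5,6,7,9]), ([],[0,4,5,6,7,8],[1,2,9,3]), ([],[0,4,5,6,7,8],[1,9,2,3]),
      ([],[0,4,5,6,7,8],[2,9,1,3]), ([],[0,4,5,6,7,8],[3,9,1,2]), ([],[2,4,5,6,7,8],[9,1,3,0]),
      ([],[3,4,5,6,7,8],[0,1,9,2]), ([],[3,4,5,6,7,8],[0,2,9,1]), ([],[4,1,5,6,7,8],[9,2,3,0]),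
      ([0],[1,2],[4,5,6,7,8,3,9]), ([0],[1,3],[5,2,4,6,7,8,9]), ([1],[0,3],[4,2,5,6,7,8,9]),
      ([2],[0,3],[4,5,1,6,7,8,9]), ([2],[1,3],[4,5,6,7,8,9,0]), ([3],[1,2],[4,0,5,6,7,8,9])]"
    by (rule split) code_simp
  show False
    using [[argo_timeout = 3600]]
      D(2) in_3[of 0] in_3[of 1] in_3[of 2] in_3[of 3] in_3[of 4] in_3[of 5] in_3[of 6] in_3[of 7]
      in_3[of 8] in_3[of 9] counts_sum[OF D(1), unfolded upt_lists clause_simps] out_3[of 0] out_3[of 1]
      out_3[of 2] out_3[of 3] out_3[of 4] out_3[of 5] out_3[of 6] out_3[of 7] out_3[of 8] out_3[of 9]
      counts_sum[OF D', unfolded upt_lists clause_simps] split_1[unfolded clause_simps]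
      split_2[unfolded clause_simps] asym_clauses[unfolded upt_lists clause_simps]
      degree_clauses[unfolded upt_lists clause_simps] sorted[unfolded upt_lists clause_simps]
    by argo
qed

lemma not_critical_labelling_10_4: "\<not> critical_labelling 10 4 e"
proof
  assume "critical_labelling 10 4 e"
  then interpret critical_labelling 10 4 e .
  obtain D T where D: "counts 10 (\<lambda>i j. e j i) D T" "\<not> D 0 3"
    and split: "\<And>ss. list_all (admissible_split 10 4) ss \<Longrightarrow> list_all (split_clause e D) ss"
    by (rule in_counts) blast
  obtain D' T' where D': "counts 10 e D' T'"
    by (rule out_counts)
  note in_3 = counts_choices[OF D(1) Suc_numerals(1), unfolded upt_lists clause_simps]
  note out_3 = counts_choices[OF D' Suc_numerals(1), unfolded upt_lists clause_simps]
  have split_1: "list_all (split_clause e D) [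
      ([],[1,2,4],[0,5,6,3,7,8,9]), ([],[0,1,2,3],[5,6,7,8,4,9]), ([],[0,1,2,3],[5,7,9,4,6,8]),
      ([],[0,2,3,5],[6,7,8,9,1,4]), ([],[0,6,7,8],[1,2,4,5,9,3]), ([],[0,6,7,8],[9,1,2,3,4,5]),
      ([],[1,2,3,4],[5,6,7,8,9,0]), ([],[1,2,3,4],[5,7,8,9,0,6]), ([],[1,2,3,4],[9,0,5,6,7,8]),
      ([],[1,2,4,7],[3,0,5,6,8,9]), ([],[1,2,5,3],[0,6,7,4,8,9]), ([],[1,2,7,4],[5,6,8,3,0,9]),
      ([],[1,3,4,0],[6,2,5,7,8,9]), ([],[2,3,4,8],[0,1,5,6,7,9]), ([],[5,1,2,3],[6,0,7,9,4,8]),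
      ([],[5,1,2,3],[6,7,8,9,4,0]), ([],[5,6,7,8],[3,9,4,0,1,2]), ([],[5,6,7,8],[9,1,2,0,3,4]),
      ([],[5,7,0,8],[2,9,1,3,6,4]), ([],[8,1,2,4],[5,6,9,3,0,7]), ([],[0,1,2,3,4],[5,6,7,8,9]),
      ([],[0,1,2,3,5],[6,7,8,4,9]), ([],[0,1,2,3,6],[4,5,7,8,9]), ([],[0,1,2,3,8],[4,5,6,7,9]),
      ([],[0,1,2,4,6],[5,7,3,8,9]), ([],[0,1,3,4,7],[2,5,6,8,9]), ([],[0,1,3,4,8],[2,5,6,7,9]),
      ([],[0,1,5,2,3],[6,7,8,9,4]), ([],[0,1,5,3,4],[6,7,8,9,2]), ([],[0,1,6,2,3],[5,7,4,8,9])]"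
    by (rule split) code_simp
  have split_2: "list_all (split_clause e D) [
      ([],[0,1,6,3,4],[5,7,8,2,9]), ([],[0,1,6,7,8],[2,3,4,5,9]), ([],[0,1,7,2,4],[5,6,9,3,8]),
      ([],[0,2,6,7,8],[1,3,4,5,9]), ([],[0,2,8,1,4],[5,3,6,7,9]), ([],[0,5,1,2,3],[6,7,4,8,9]),
      ([],[0,5,1,2,3],[6,7,8,9,4]), ([],[0,5,6,7,8],[1,2,9,3,4]), ([],[0,5,6,7,8],[1,3,9,2,4]),
      ([],[0,5,6,7,8],[4,9,1,2,3]), ([],[0,6,1,2,4],[5,7,8,9,3]), ([],[0,6,1,7,8],[2,3,4,5,9]),
      ([],[1,0,2,3,4],[5,6,7,8,9]), ([],[1,0,2,4,5],[6,8,3,7,9]), ([],[1,2,3,0,4],[5,6,7,8,9]),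
      ([],[1,2,3,4,0],[5,6,7,8,9]), ([],[1,2,3,4,5],[6,7,8,9,0]), ([],[1,2,3,4,6],[0,5,7,8,9]),
      ([],[1,2,3,4,6],[5,7,0,8,9]), ([],[1,2,3,4,6],[5,7,9,0,8]), ([],[1,2,3,4,6],[7,0,5,8,9]),
      ([],[1,2,3,4,7],[0,5,6,8,9]), ([],[1,2,3,5,4],[6,7,0,8,9]), ([],[1,2,3,7,4],[0,5,6,8,9]),
      ([],[1,2,3,7,4],[5,8,9,0,6]), ([],[1,2,3,8,4],[5,0,6,7,9]), ([],[1,2,4,0,3],[5,6,7,8,9]),
      ([],[1,2,4,0,7],[3,5,6,8,9]), ([],[1,2,4,5,8],[3,6,7,9,0]), ([],[1,2,4,7,8],[3,0,5,6,9])]"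
    by (rule split) code_simp
  have split_3: "list_all (split_clause e D) [
      ([],[1,2,4,8,3],[0,5,6,7,9]), ([],[1,2,4,8,3],[6,7,0,5,9]), ([],[1,2,5,3,4],[6,0,7,8,9]),
      ([],[1,2,5,3,4],[6,7,8,9,0]), ([],[1,2,7,3,4],[5,8,0,6,9]), ([],[1,2,7,3,4],[8,9,0,5,6]),
      ([],[1,2,8,3,4],[5,6,9,0,7]), ([],[1,2,8,4,0],[5,6,7,9,3]), ([],[1,3,0,6,4],[2,5,7,8,9]),
      ([],[1,3,4,0,2],[5,6,7,8,9]), ([],[1,3,8,2,4],[0,5,6,7,9]), ([],[1,4,0,2,3],[5,6,7,8,9]),
      ([],[1,4,8,2,3],[5,0,6,7,9]), ([],[1,6,2,3,4],[5,7,0,8,9]), ([],[1,6,3,4,8],[0,5,7,9,2]),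
      ([],[1,7,2,3,4],[0,5,6,8,9]), ([],[1,7,2,4,0],[3,5,6,8,9]), ([],[1,7,3,4,8],[2,0,5,6,9]),
      ([],[1,8,0,2,3],[5,6,7,9,4]), ([],[1,8,2,0,3],[4,5,6,7,9]), ([],[1,8,3,0,2],[4,5,6,7,9]),
      ([],[2,0,1,3,4],[5,6,7,8,9]), ([],[2,0,3,4,5],[6,7,8,1,9]), ([],[2,0,3,5,4],[6,7,8,1,9]),
      ([],[2,3,0,1,4],[5,6,7,8,9]), ([],[2,3,0,6,1],[5,7,8,4,9]), ([],[2,3,4,0,1],[5,6,7,8,9]),
      ([],[2,3,4,7,1],[0,5,6,8,9]), ([],[2,3,5,1,4],[6,7,0,8,9]), ([],[2,3,7,4,0],[6,8,1,5,9])]"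
    by (rule split) code_simp
  have split_4: "list_all (split_clause e D) [
      ([],[2,4,5,1,3],[6,7,8,0,9]), ([],[2,4,7,1,3],[0,5,6,8,9]), ([],[2,5,1,3,4],[6,7,8,0,9]),
      ([],[2,5,6,7,8],[1,9,3,4,0]), ([],[2,7,3,0,4],[5,6,8,9,1]), ([],[3,0,5,6,7],[8,1,2,4,9]),
      ([],[3,5,6,7,8],[1,9,0,2,4]), ([],[3,5,6,7,8],[9,1,2,4,0]), ([],[4,0,5,6,7],[8,1,2,3,9]),
      ([],[4,5,6,7,8],[0,1,2,9,3]), ([],[4,5,6,7,8],[0,9,1,2,3]), ([],[4,5,7,8,0],[6,9,1,2,3]),
      ([],[5,2,6,8,0],[1,3,7,9,4]), ([],[5,3,6,7,8],[0,1,9,2,4]), ([],[5,6,4,7,8],[0,1,3,9,2]),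
      ([],[5,6,4,7,8],[0,2,3,9,1]), ([],[5,6,7,8,1],[3,9,0,2,4]), ([],[5,7,1,6,8],[9,2,3,4,0]),
      ([],[6,2,3,4,0],[5,7,8,1,9]), ([],[6,2,5,7,8],[1,9,3,4,0]), ([],[7,1,2,3,4],[5,6,8,0,9]),
      ([],[7,1,2,4,0],[5,6,8,9,3]), ([],[8,1,2,4,0],[3,5,6,7,9]), ([],[8,2,3,4,0],[5,6,9,1,7]),
      ([],[0,5,6,7,1,8],[2,3,4,9]), ([],[0,5,6,7,8,3],[1,2,9,4]), ([],[1,2,8,3,5,4],[6,7,0,9]),
      ([],[1,3,0,2,4,7],[5,6,8,9]), ([],[1,3,4,5,8,2],[0,6,7,9]), ([],[1,3,5,2,7,4],[6,8,0,9])]"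
    by (rule split) code_simp
  have split_5: "list_all (split_clause e D) [
      ([],[1,5,2,4,6,3],[7,0,8,9]), ([],[1,6,2,3,4,7],[8,0,5,9]), ([],[1,7,2,8,3,4],[0,5,6,9]),
      ([],[2,3,7,8,1,4],[0,5,6,9]), ([],[2,6,1,8,3,4],[0,5,7,9]), ([],[2,7,1,8,3,4],[0,5,6,9]),
      ([],[3,0,5,6,7,8],[1,2,4,9]), ([],[4,0,1,2,7,3],[5,6,8,9]), ([0],[1,2,3],[5,6,7,4,8,9]),
      ([0],[1,2,3],[5,6,8,9,4,7]), ([0],[1,2,3],[5,6,9,4,7,8]), ([0],[1,2,3],[5,7,4,6,8,9]),
      ([0],[1,2,3],[5,8,4,6,7,9]), ([0],[1,2,3],[7,9,4,5,6,8]), ([0],[1,2,4],[5,3,6,7,8,9]),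
      ([0],[1,2,4],[5,6,8,3,7,9]), ([0],[1,2,4],[5,7,3,6,8,9]), ([0],[1,2,4],[6,3,5,7,8,9]),
      ([0],[1,3,4],[5,2,6,7,8,9]), ([0],[1,3,4],[5,6,7,2,8,9]), ([0],[1,3,4],[5,7,2,6,8,9]),
      ([0],[1,3,4],[6,7,8,9,2,5]), ([0],[1,3,4],[7,9,2,5,6,8]), ([0],[1,4,5],[6,7,3,8,2,9]),
      ([0],[1,4,8],[2,5,6,9,3,7]), ([0],[2,3,4],[5,1,6,7,8,9]), ([0],[2,3,4],[5,6,7,9,1,8]),
      ([0],[2,3,4],[5,7,9,1,6,8]), ([0],[2,3,4],[6,7,1,5,8,9]), ([0],[2,3,5],[6,7,1,8,9,4])]"
    by (rule split) code_simp
  have split_6: "list_all (split_clause e D) [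
      ([0],[2,3,9],[1,4,5,6,7,8]), ([0],[2,4,5],[6,7,8,9,1,3]), ([0],[2,4,7],[5,6,1,8,3,9]),
      ([0],[2,6,4],[5,7,1,3,8,9]), ([0],[5,2,4],[6,1,7,8,9,3]), ([0],[5,6,7],[2,8,3,9,1,4]),
      ([0],[5,6,7],[8,1,3,9,2,4]), ([0],[5,6,7],[8,9,1,2,3,4]), ([0],[5,6,8],[1,2,7,3,9,4]),
      ([0],[5,6,8],[3,7,1,9,2,4]), ([0],[5,7,8],[1,2,3,6,9,4]), ([0],[5,7,8],[1,2,6,4,9,3]),
      ([0],[5,7,8],[1,4,6,9,2,3]), ([0],[5,7,8],[9,1,2,4,6,3]), ([0],[5,7,9],[1,2,3,6,8,4]),
      ([0],[5,7,9],[1,2,6,3,8,4]), ([0],[5,8,9],[1,2,3,6,7,4]), ([0],[5,8,9],[1,2,6,7,3,4]),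
      ([0],[6,7,8],[1,2,5,9,3,4]), ([0],[6,7,9],[1,5,8,2,3,4]), ([0],[6,8,9],[1,2,5,7,3,4]),
      ([0],[6,8,9],[1,3,5,7,2,4]), ([0],[7,8,9],[1,2,3,4,5,6]), ([0],[7,8,9],[1,3,5,4,6,2]),
      ([0],[7,8,9],[2,3,5,1,4,6]), ([0],[7,8,9],[3,4,5,1,6,2]), ([0],[8,1,2],[5,6,4,7,9,3]),
      ([0],[8,4,9],[1,5,6,2,7,3]), ([1],[0,2,3],[6,7,4,5,8,9]), ([1],[0,2,4],[5,6,7,3,8,9])]"
    by (rule split) code_simp
  have split_7: "list_all (split_clause e D) [
      ([1],[0,2,4],[5,6,7,8,3,9]), ([1],[0,2,4],[5,6,7,8,9,3]), ([1],[0,2,4],[5,6,7,9,3,8]),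
      ([1],[2,3,0],[6,9,4,5,7,8]), ([1],[2,3,4],[5,6,7,0,8,9]), ([1],[2,3,4],[5,6,7,9,0,8]),
      ([1],[2,3,4],[5,6,8,0,7,9]), ([1],[2,3,4],[5,8,0,6,7,9]), ([1],[2,3,4],[6,0,5,7,8,9]),
      ([1],[2,3,4],[6,7,8,0,5,9]), ([1],[2,4,6],[0,3,5,7,8,9]), ([1],[2,7,4],[0,5,6,8,3,9]),
      ([1],[2,9,4],[0,5,6,3,7,8]), ([1],[3,4,0],[5,6,7,9,2,8]), ([1],[3,4,0],[6,7,2,5,8,9]),
      ([1],[3,4,6],[0,2,5,7,8,9]), ([1],[5,6,8],[2,3,7,9,4,0]), ([1],[5,8,9],[2,3,0,4,6,7]),
      ([1],[5,8,9],[2,3,6,0,7,4]), ([2],[0,1,3],[4,5,6,7,8,9]), ([2],[0,1,3],[5,4,6,7,8,9]),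
      ([2],[0,1,3],[5,6,4,7,8,9]), ([2],[0,1,3],[5,6,7,9,4,8]), ([2],[0,1,4],[5,6,8,9,3,7]),
      ([2],[0,1,4],[5,7,9,3,6,8]), ([2],[0,1,4],[6,7,3,5,8,9]), ([2],[0,1,4],[7,8,3,5,6,9]),
      ([2],[0,3,4],[5,6,1,7,8,9]), ([2],[0,3,4],[5,6,7,8,9,1]), ([2],[0,5,7],[6,8,1,3,4,9])]"
    by (rule split) code_simp
  have split_8: "list_all (split_clause e D) [
      ([2],[1,3,4],[5,0,6,7,8,9]), ([2],[1,3,4],[5,6,0,7,8,9]), ([2],[1,3,4],[5,6,7,8,0,9]),
      ([2],[1,3,4],[6,8,9,0,5,7]), ([2],[1,3,4],[7,8,0,5,6,9]), ([2],[1,4,6],[0,5,3,7,8,9]),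
      ([2],[1,4,8],[0,3,5,6,7,9]), ([2],[3,4,0],[5,6,1,7,8,9]), ([2],[3,4,0],[5,6,8,1,7,9]),
      ([2],[4,0,3],[5,7,8,1,6,9]), ([3],[0,1,2],[5,4,6,7,8,9]), ([3],[0,1,2],[5,6,4,7,8,9]),
      ([3],[0,1,2],[5,6,8,4,7,9]), ([3],[0,1,2],[6,4,5,7,8,9]), ([3],[0,1,5],[6,7,8,9,2,4]),
      ([3],[0,2,9],[5,1,6,4,7,8]), ([3],[0,6,8],[1,5,9,2,4,7]), ([3],[1,2,4],[5,6,8,9,0,7]),
      ([3],[1,4,0],[5,7,9,2,6,8]), ([3],[1,4,0],[7,2,5,6,8,9]), ([3],[2,4,0],[5,6,7,1,8,9]),
      ([3],[5,2,4],[6,7,8,0,1,9]), ([3],[5,7,8],[0,6,1,9,2,4]), ([3],[5,8,9],[1,6,0,2,7,4]),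
      ([4],[0,1,2],[3,5,6,7,8,9]), ([4],[0,1,3],[5,6,2,7,8,9]), ([4],[0,1,3],[5,6,7,8,2,9]),
      ([4],[0,2,3],[5,6,7,8,1,9]), ([4],[0,2,3],[5,6,7,8,9,1]), ([4],[0,2,3],[5,6,9,1,7,8])]"
    by (rule split) code_simp
  have split_9: "list_all (split_clause e D) [
      ([4],[0,6,9],[1,5,2,7,8,3]), ([4],[1,0,2],[5,6,7,3,8,9]), ([4],[1,0,2],[5,6,9,3,7,8]),
      ([4],[1,0,3],[5,6,8,2,7,9]), ([4],[1,2,3],[5,7,0,6,8,9]), ([4],[1,2,3],[6,7,9,0,5,8]),
      ([4],[1,2,7],[0,5,6,3,8,9]), ([4],[1,3,7],[0,5,6,2,8,9]), ([4],[1,8,0],[2,5,3,6,7,9]),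
      ([4],[2,3,9],[0,1,5,6,7,8]), ([4],[2,7,3],[5,0,6,8,1,9]), ([4],[3,0,6],[1,5,7,8,9,2]),
      ([4],[5,1,2],[6,7,8,9,3,0]), ([4],[5,6,7],[8,0,1,2,9,3]), ([4],[5,6,9],[1,7,8,0,2,3]),
      ([4],[9,1,3],[0,5,2,6,7,8]), ([5],[0,1,2],[6,7,3,4,8,9]), ([5],[0,1,3],[6,2,7,4,8,9]),
      ([5],[0,1,4],[6,7,8,2,9,3]), ([5],[0,6,9],[1,7,2,3,8,4]), ([5],[1,2,3],[6,4,7,8,0,9]),
      ([5],[1,2,3],[6,8,0,9,4,7]), ([5],[1,3,4],[6,7,8,0,2,9]), ([5],[2,3,4],[7,1,6,8,0,9]),
      ([5],[6,7,8],[1,2,9,0,3,4]), ([5],[7,8,9],[1,2,0,3,4,6]), ([5],[8,9,0],[1,6,2,3,7,4]),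
      ([6],[0,1,2],[7,3,5,8,9,4]), ([6],[0,1,3],[5,7,9,2,4,8]), ([6],[0,2,3],[5,7,8,9,1,4])]"
    by (rule split) code_simp
  have split_10: "list_all (split_clause e D) [
      ([6],[0,5,9],[1,2,7,3,8,4]), ([6],[0,7,8],[1,2,3,5,9,4]), ([6],[1,2,3],[5,7,4,8,0,9]),
      ([6],[1,3,4],[0,5,7,8,9,2]), ([6],[1,3,4],[5,7,9,0,2,8]), ([6],[1,3,4],[7,0,5,8,2,9]),
      ([6],[1,4,0],[5,7,2,8,3,9]), ([6],[2,3,4],[5,7,8,9,0,1]), ([6],[5,7,9],[1,2,8,0,3,4]),
      ([6],[5,9,0],[1,7,2,4,8,3]), ([6],[5,9,0],[7,1,2,8,3,4]), ([6],[5,9,0],[7,8,1,2,3,4]),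
      ([7],[1,2,3],[0,5,6,8,4,9]), ([7],[1,2,3],[5,6,8,9,4,0]), ([7],[1,2,4],[0,6,3,5,8,9]),
      ([7],[1,3,0],[5,6,8,2,4,9]), ([7],[1,3,4],[0,2,5,6,8,9]), ([7],[1,3,4],[0,5,6,9,2,8]),
      ([7],[1,3,4],[5,8,0,6,2,9]), ([7],[2,3,4],[0,1,5,6,8,9]), ([7],[2,3,4],[5,8,0,1,6,9]),
      ([7],[2,4,0],[1,5,6,3,8,9]), ([7],[3,4,0],[5,6,1,8,2,9]), ([8],[0,1,2],[3,4,5,6,7,9]),
      ([8],[0,1,2],[4,5,6,7,3,9]), ([8],[0,2,3],[1,5,4,6,7,9]), ([8],[0,5,9],[1,2,6,3,7,4]),
      ([8],[0,6,9],[1,2,5,3,4,7]), ([8],[1,3,4],[5,6,9,0,2,7]), ([8],[2,3,4],[0,5,1,6,7,9])]"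
    by (rule split) code_simp
  have split_11: "list_all (split_clause e D) [
      ([8],[2,3,4],[0,5,7,9,1,6]), ([8],[3,4,0],[1,5,6,9,2,7]), ([8],[5,6,9],[1,2,7,0,3,4]),
      ([8],[5,6,9],[1,7,3,0,2,4]), ([8],[5,7,0],[1,6,2,9,3,4]), ([8],[5,7,9],[1,3,0,2,4,6]),
      ([8],[5,9,0],[1,6,2,7,3,4]), ([8],[6,9,0],[1,2,5,3,4,7]), ([9],[0,1,4],[5,2,6,3,7,8]),
      ([9],[0,5,7],[1,2,6,8,3,4]), ([9],[0,5,8],[1,6,2,3,7,4]), ([9],[1,4,0],[2,3,5,6,7,8]),
      ([9],[2,3,0],[5,1,4,6,7,8]), ([9],[5,6,8],[1,2,0,3,4,7]), ([9],[6,7,8],[1,2,0,3,4,5]),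
      ([9],[6,7,8],[1,2,0,3,5,4]), ([9],[6,7,8],[1,3,0,2,4,5])]"
    by (rule split) code_simp
  show False
    using [[argo_timeout = 3600]]
      D(2) in_3[of 0] in_3[of 1] in_3[of 2] in_3[of 3] in_3[of 4] in_3[of 5] in_3[of 6] in_3[of 7]
      in_3[of 8] in_3[of 9] counts_sum[OF D(1), unfolded upt_lists clause_simps] out_3[of 0] out_3[of 1]
      out_3[of 2] out_3[of 3] out_3[of 4] out_3[of 5] out_3[of 6] out_3[of 7] out_3[of 8] out_3[of 9]
      counts_sum[OF D', unfolded upt_lists clause_simps] split_1[unfolded clause_simps]
      split_2[unfolded clause_simps] split_3[unfolded clause_simps] split_4[unfolded clause_simps]
      split_5[unfolded clause_simps] split_6[unfolded clause_simps] split_7[unfolded clause_simps]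
      split_8[unfolded clause_simps] split_9[unfolded clause_simps] split_10[unfolded clause_simps]
      split_11[unfolded clause_simps] asym_clauses[unfolded upt_lists clause_simps]
      degree_clauses[unfolded upt_lists clause_simps] sorted[unfolded upt_lists clause_simps]
    by argo
qed

lemma critical_labelling_cases:
  assumes "critical_labelling n p e" "2 \<le> p" "2 * p < n" "n \<le> 10"
  shows "n = 7 \<and> list_all (\<lambda>(i, j). e i j) arcs0"
proof -
  have "n = 5 \<and> p = 2 \<or> n = 6 \<and> p = 2 \<or> n = 7 \<and> p = 2 \<or> n = 7 \<and> p = 3 \<or> n = 8 \<and> p = 2 \<or> n = 8 \<and> p = 3 \<or>
      n = 9 \<and> p = 2 \<or> n = 9 \<and> p = 3 \<or> n = 9 \<and> p = 4 \<or> n = 10 \<and> p = 2 \<or> n = 10 \<and> p = 3 \<or> n = 10 \<and> p = 4"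
    using assms(2-4) by presburger
  then show ?thesis
    using assms(1) critical_labelling_7_2 not_critical_labelling_5_2 not_critical_labelling_6_2
      not_critical_labelling_7_3 not_critical_labelling_8_2 not_critical_labelling_8_3
      not_critical_labelling_9_2 not_critical_labelling_9_3 not_critical_labelling_9_4
      not_critical_labelling_10_2 not_critical_labelling_10_3 not_critical_labelling_10_4
    by (elim disjE) auto
qed

section \<open>Vertex-critical oriented graphs with at most 20 arcs\<close>

text \<open>
  The relational form of a 3-dicritical oriented graph with at most 20 arcs; criticality enters
  only through the deletion of single vertices.
\<close>

locale vertex_critical =
  fixes V :: "'v set" and r :: "'v \<Rightarrow> 'v \<Rightarrow> bool"
  assumes finite_V: "finite V"
    and asym: "r x y \<Longrightarrow> \<not> r y x"
    and no_bipartition: "S \<subseteq> V \<Longrightarrow> acyclic_on r S \<Longrightarrow> \<not> acyclic_on r (V - S)"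
    and critical: "v \<in> V \<Longrightarrow> \<exists>S\<subseteq>V - {v}. acyclic_on r S \<and> acyclic_on r (V - {v} - S)"
    and size: "card {(x, y). x \<in> V \<and> y \<in> V \<and> r x y} \<le> 20"
begin

abbreviation "ins v \<equiv> {w \<in> V. r w v}"
abbreviation "outs v \<equiv> {w \<in> V. r v w}"

text \<open>
  An acyclic set \<open>X\<close> whose complement in \<open>V - {v}\<close> is acyclic cannot be
  enlarged by \<open>v\<close>, so \<open>v\<close> is neither a source nor a sink with respect to
  \<open>X\<close>.
\<close>

lemma two_le_degree:
  assumes "v \<in> V"
  shows "2 \<le> card (ins v)" "2 \<le> card (outs v)"
proof -
  obtain S where S: "S \<subseteq> V - {v}" "acyclic_on r S" "acyclic_on r (V - {v} - S)"
    using critical assms by blast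
  have irrefl: "\<not> r v v" using asym by blast
  have *: "\<exists>w\<in>X. r w v" "\<exists>w\<in>X. r v w" if X: "X \<subseteq> V - {v}" "acyclic_on r X" "acyclic_on r (V - {v} - X)" for X
  proof -
    have "V - insert v X = V - {v} - X" by auto
    then have "\<not> acyclic_on r (insert v X)"
      using no_bipartition[of "insert v X"] X assms by auto
    then show "\<exists>w\<in>X. r w v" "\<exists>w\<in>X. r v w"
      using acyclic_on_insert_source[OF X(2)] acyclic_on_insert_sink[OF X(2)] irrefl by blast+
  qed
  have T: "V - {v} - (V - {v} - S) = S" using S(1) by auto
  have two: "2 \<le> card Z" if "a \<in> S" "b \<in> V - {v} - S" "{a, b} \<subseteq> Z" "Z \<subseteq> V" for a b Z
  proof -
    have "card {a, b} \<le> card Z" using that finite_V by (intro card_mono) (auto intro: finite_subset)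
    moreover have "a \<noteq> b" using that by auto
    ultimately show ?thesis by simp
  qed
  obtain a b where "a \<in> S" "r a v" "b \<in> V - {v} - S" "r b v"
    using *(1)[OF S] *(1)[of "V - {v} - S"] S T by auto
  then show "2 \<le> card (ins v)" using S(1) by (intro two[of a b]) auto
  obtain a b where "a \<in> S" "r v a" "b \<in> V - {v} - S" "r v b"
    using *(2)[OF S] *(2)[of "V - {v} - S"] S T by auto
  then show "2 \<le> card (outs v)" using S(1) by (intro two[of a b]) auto
qed

lemma sum_degrees:
  "(\<Sum>v\<in>V. card (outs v)) = card {(x, y). x \<in> V \<and> y \<in> V \<and> r x y}" (is "_ = card ?A")
  "(\<Sum>v\<in>V. card (ins v)) = card {(x, y). x \<in> V \<and> y \<in> V \<and> r x y}"
proof -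
  have "?A = Sigma V outs" by auto
  then show "(\<Sum>v\<in>V. card (outs v)) = card ?A"
    using card_SigmaI[of V outs] finite_V by simp
  have "?A = prod.swap ` Sigma V ins" by force
  then show "(\<Sum>v\<in>V. card (ins v)) = card ?A"
    using card_SigmaI[of V ins] finite_V by (simp add: card_image)
qed

lemma V_nonempty: "V \<noteq> {}"
  using no_bipartition[of "{}"] by (auto simp: acyclic_on_def acyclic_def)

lemma card_V_le: "card V \<le> 10"
  using sum_mono[of V "\<lambda>_. 2" "\<lambda>v. card (ins v)"] two_le_degree sum_degrees size by simp

text \<open>
  If all in-degrees were at least 3, there would be at most six vertices, since \<open>3 n \<le>
  20\<close>; but an oriented graph on \<open>n\<close> vertices has at most \<open>n (n - 1) /
  2\<close> arcs, which forces \<open>n \<ge> 7\<close>.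
\<close>

lemma ex_in_degree_two: "\<exists>v\<in>V. card (ins v) = 2"
proof (rule ccontr)
  assume "\<not> ?thesis"
  then have ge: "3 \<le> card (ins v)" if "v \<in> V" for v
    using two_le_degree(1)[OF that] that by fastforce
  have "3 * card V \<le> (\<Sum>v\<in>V. card (ins v))"
    using sum_mono[of V "\<lambda>_. 3" "\<lambda>v. card (ins v)"] ge by (simp add: mult.commute)
  moreover have "(\<Sum>v\<in>V. card (ins v)) + (\<Sum>v\<in>V. card (outs v)) \<le> card V * (card V - 1)"
  proof -
    have "card (ins v) + card (outs v) \<le> card V - 1" if "v \<in> V" for v
    proof -
      have "card (ins v) + card (outs v) = card (ins v \<union> outs v)"
        by (rule card_Un_disjoint[symmetric]) (use finite_V asym in auto)
      also have "\<dots> \<le> card (V - {v})" using asym finite_V by (intro card_mono) auto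
      finally show ?thesis using that finite_V by simp
    qed
    then show ?thesis
      using sum_mono[of V "\<lambda>v. card (ins v) + card (outs v)" "\<lambda>_. card V - 1"] by (simp add: sum.distrib)
  qed
  ultimately have "6 * card V \<le> card V * (card V - 1)" "3 * card V \<le> 20"
    using sum_degrees size by linarith+
  moreover have "card V > 0" using V_nonempty finite_V by auto
  ultimately have "6 \<le> card V - 1" "card V \<le> 6" by (simp_all add: mult.commute[of 6])
  then show False by simp
qed

text \<open>
  The least part \<open>S\<close> over all vertices of in-degree 2 is taken. It has at least two
  elements because an oriented graph on two vertices is acyclic, so \<open>v\<close> could be
  added to a smaller \<open>S\<close>; and \<open>S\<close> is at most as large as the other part,
  which is also a candidate.
\<close>

lemma labelling:
  obtains vs p where "distinct vs" "set vs = V" "2 \<le> p" "2 * p < length vs"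
    "critical_labelling (length vs) p (\<lambda>i j. r (vs ! i) (vs ! j))"
proof -
  define Q where "Q = (\<lambda>(v, S). v \<in> V \<and> card (ins v) = 2 \<and> S \<subseteq> V - {v} \<and> acyclic_on r S \<and> acyclic_on r (V - {v} - S))"
  obtain v0 where v0: "v0 \<in> V" "card (ins v0) = 2" using ex_in_degree_two by blast
  obtain S0 where "S0 \<subseteq> V - {v0}" "acyclic_on r S0" "acyclic_on r (V - {v0} - S0)"
    using critical[OF v0(1)] by blast
  with v0 have "Q (v0, S0)" by (simp add: Q_def)
  from ex_has_least_nat[where P = Q, OF this, of "\<lambda>b. card (snd b)"]
  obtain a where a: "Q a" "\<And>b. Q b \<Longrightarrow> card (snd a) \<le> card (snd b)" by auto
  obtain v S where vS: "a = (v, S)" by force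
  define T where "T = V - {v} - S"
  have v: "v \<in> V" "card (ins v) = 2" and S: "S \<subseteq> V - {v}" "acyclic_on r S" and T: "acyclic_on r T"
    using a(1) unfolding vS Q_def T_def by auto
  have min: "card S \<le> card S'"
    if "u \<in> V" "card (ins u) = 2" "S' \<subseteq> V - {u}" "acyclic_on r S'" "acyclic_on r (V - {u} - S')" for u S'
    using a(2)[of "(u, S')"] that unfolding vS Q_def by auto
  have irrefl: "\<not> r x x" for x using asym by blast
  have fin: "finite S" "finite T" using S(1) finite_V unfolding T_def by (auto intro: finite_subset)
  obtain xs where xs: "distinct xs" "set xs = S" "\<not> has_back r xs"
    by (rule acyclic_on_ordering[OF fin(1) S(2)])
  obtain ys where ys: "distinct ys" "set ys = T" "\<not> has_back r ys"
    by (rule acyclic_on_ordering[OF fin(2) T])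
  define vs where "vs = v # xs @ ys"
  define n p where "n = length vs" and "p = length xs"
  have vs0: "vs ! 0 = v" by (simp add: vs_def)
  have vs: "distinct vs" "set vs = V" using xs ys v S unfolding vs_def T_def by auto
  have p: "card S = p" and q: "card T = length ys"
    using xs ys distinct_card unfolding p_def by auto
  have "V - {v} - T = S" using S(1) unfolding T_def by auto
  then have "p \<le> length ys"
    using min[of v T] v S T unfolding p[symmetric] q[symmetric] by (auto simp: T_def)
  then have "2 * p < n" unfolding n_def p_def vs_def by simp
  have "2 \<le> p"
  proof (rule ccontr)
    assume "\<not> 2 \<le> p"
    then have "card S \<le> 1" using p by simp
    then have "\<exists>s. S \<subseteq> {s}" using fin(1) by (metis card_le_Suc0_iff_eq One_nat_def empty_subsetI insert_subset subsetI singletonI)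
    then obtain s where s: "S \<subseteq> {s}" by blast
    have "\<not> has_back r [v, s] \<or> \<not> has_back r [s, v]" using asym[of v s] by auto
    then have "acyclic_on r {v, s}"
      using acyclic_on_if_not_has_back[of r "[v, s]"] acyclic_on_if_not_has_back[of r "[s, v]"] irrefl
      by (auto simp: insert_commute)
    then have "acyclic_on r (insert v S)" by (rule acyclic_on_subset) (use s in auto)
    moreover have "V - insert v S = T" unfolding T_def by auto
    ultimately show False using no_bipartition[of "insert v S"] T v S by auto
  qed
  let ?e = "\<lambda>i j. r (vs ! i) (vs ! j)"
  have bij: "bij_betw ((!) vs) {..<n} V" using bij_betw_nth[OF vs(1)] vs(2) n_def by auto
  have card_P: "card {j. j < n \<and> P (vs ! j)} = card {w \<in> V. P w}" for P
  proof (rule bij_betw_same_card)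
    show "bij_betw ((!) vs) {j. j < n \<and> P (vs ! j)} {w \<in> V. P w}"
      using bij by (auto simp: bij_betw_def inj_on_def)
  qed
  have nth_in: "vs ! i \<in> V" if "i < n" for i using that vs n_def nth_mem by blast
  have image: "set (map ((!) vs) zs) = V - set (map ((!) vs) ws) - set (map ((!) vs) us)"
    if "distinct (us @ ws @ zs)" "set (us @ ws @ zs) = {..<n}" for us ws zs
  proof -
    have i: "inj_on ((!) vs) {..<n}" and V: "V = (!) vs ` {..<n}" using bij by (auto simp: bij_betw_def)
    have "set zs = {..<n} - set ws - set us" using that by auto
    then have "(!) vs ` set zs = (!) vs ` ({..<n} - set ws) - (!) vs ` set us"
      using that(2) inj_on_image_set_diff[OF i, of "{..<n} - set ws" "set us"] by auto
    moreover have "(!) vs ` ({..<n} - set ws) = (!) vs ` {..<n} - (!) vs ` set ws"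
      using that(2) by (intro inj_on_image_set_diff[OF i]) auto
    ultimately show ?thesis by (simp add: V)
  qed
  have acyclic: "acyclic_on r (set (map ((!) vs) zs))" if "\<not> has_back ?e zs" for zs
    using that by (intro acyclic_on_if_not_has_back irrefl) (simp add: has_back_map)
  have "critical_labelling n p ?e"
  proof
    fix i j assume "i < n" "j < n" "?e i j"
    then show "\<not> ?e j i" using asym by blast
  next
    fix i assume "i < n"
    then show "2 \<le> card {j. j < n \<and> ?e i j}" "2 \<le> card {j. j < n \<and> ?e j i}"
      using two_le_degree nth_in by (simp_all add: card_P[of "\<lambda>w. r w _"] card_P[of "r _"])
  next
    show "(\<Sum>i<n. card {j. j < n \<and> ?e i j}) \<le> 20" "(\<Sum>i<n. card {j. j < n \<and> ?e j i}) \<le> 20"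
      using sum_degrees size sum.reindex_bij_betw[OF bij, of "\<lambda>v. card (ins v)"]
        sum.reindex_bij_betw[OF bij, of "\<lambda>v. card (outs v)"]
      by (simp_all add: card_P[of "\<lambda>w. r w _"] card_P[of "r _"])
    show "card {j. j < n \<and> ?e j 0} \<le> 2" using v vs0 by (simp add: card_P[of "\<lambda>w. r w _"])
    have "map ((!) vs) [1..<Suc p] = xs" by (rule nth_equalityI) (simp_all add: vs_def p_def nth_append del: upt_Suc)
    then show "\<not> has_back ?e [1..<Suc p]" using xs(3) has_back_map by metis
    have "map ((!) vs) [Suc p..<n] = ys" by (rule nth_equalityI) (simp_all add: vs_def p_def n_def nth_append del: upt_Suc)
    then show "\<not> has_back ?e [Suc p..<n]" using ys(3) has_back_map by metis
  next
    fix ws zs assume d: "distinct (ws @ zs)" "set (ws @ zs) = {..<n}"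
    show "has_back ?e ws \<or> has_back ?e zs"
    proof (rule ccontr)
      assume "\<not> ?thesis"
      then have "acyclic_on r (set (map ((!) vs) ws))" "acyclic_on r (set (map ((!) vs) zs))"
        using acyclic by auto
      moreover have "set (map ((!) vs) ws) \<subseteq> V" using d nth_in by auto
      ultimately show False using no_bipartition image[of "[]" ws zs] d by auto
    qed
  next
    fix u ws zs assume d: "distinct (u # ws @ zs)" "set (u # ws @ zs) = {..<n}"
      and small: "length ws < p" "card {j. j < n \<and> ?e j u} \<le> 2"
    show "has_back ?e ws \<or> has_back ?e zs"
    proof (rule ccontr)
      assume "\<not> ?thesis"
      then have ac: "acyclic_on r (set (map ((!) vs) ws))" "acyclic_on r (set (map ((!) vs) zs))"
        using acyclic by auto
      have u: "u < n" "vs ! u \<in> V" using d nth_in by auto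
      have "card (ins (vs ! u)) = 2"
        using small(2) two_le_degree(1)[OF u(2)] by (simp add: card_P[of "\<lambda>w. r w _"])
      moreover have Z: "set (map ((!) vs) zs) = V - {vs ! u} - set (map ((!) vs) ws)"
        using image[of "[u]" ws zs] d by auto
      moreover have "set (map ((!) vs) ws) \<subseteq> V - {vs ! u}"
      proof -
        have "vs ! i \<noteq> vs ! u" if "i \<in> set ws" for i
          using d that vs(1) u(1) n_def by (subst nth_eq_iff_index_eq) auto
        then show ?thesis using d nth_in by auto
      qed
      ultimately have "card S \<le> card (set (map ((!) vs) ws))"
        using min[OF u(2), of "set (map ((!) vs) ws)"] ac by auto
      also have "\<dots> \<le> length ws" using card_length[of "map ((!) vs) ws"] by simp
      finally show False using small(1) p by simp
    qed
  qed
  then show thesis using that[of vs p] vs \<open>2 \<le> p\<close> \<open>2 * p < n\<close> n_def by simp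
qed

lemma arcs_unique:
  obtains vs where "distinct vs" "set vs = V" "length vs = 7"
    "{(x, y). x \<in> V \<and> y \<in> V \<and> r x y} = (\<lambda>(i, j). (vs ! i, vs ! j)) ` set arcs0"
proof -
  obtain vs p where vs: "distinct vs" "set vs = V" "2 \<le> p" "2 * p < length vs"
    "critical_labelling (length vs) p (\<lambda>i j. r (vs ! i) (vs ! j))" by (rule labelling)
  have "length vs = card V" using vs distinct_card by metis
  then have n: "length vs = 7" and l: "list_all (\<lambda>(i, j). r (vs ! i) (vs ! j)) arcs0"
    using critical_labelling_cases[OF vs(5,3,4)] card_V_le by auto
  \<comment> \<open>The 20 forced arcs already exhaust the bound, so there are no others.\<close>
  let ?A = "{(x, y). x \<in> V \<and> y \<in> V \<and> r x y}" and ?f = "\<lambda>(i, j). (vs ! i, vs ! j)"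
  have lt: "i < 7 \<and> j < 7" if "(i, j) \<in> set arcs0" for i j
    using that by (auto simp: arcs0_def)
  have "?f ` set arcs0 \<subseteq> ?A"
    using l lt vs(2) n nth_mem[of _ vs] by (fastforce simp: list_all_iff)
  moreover have "card (?f ` set arcs0) = 20"
  proof -
    have "inj_on ?f (set arcs0)"
      using lt n vs(1) by (auto simp: inj_on_def nth_eq_iff_index_eq)
    moreover have "card (set arcs0) = 20" by (simp add: arcs0_def)
    ultimately show ?thesis by (simp add: card_image)
  qed
  moreover have "finite ?A" by (rule finite_subset[of _ "V \<times> V"]) (use finite_V in auto)
  ultimately have "?A = ?f ` set arcs0" using card_seteq[of ?A "?f ` set arcs0"] size by simp
  then show thesis using that vs n by blast
qed

end

section \<open>Colorings with two colors in terms of acyclic sets\<close>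

abbreviation adj :: "('a, 'b) pre_digraph \<Rightarrow> 'a \<Rightarrow> 'a \<Rightarrow> bool" where
  "adj G x y \<equiv> (x, y) \<in> arcs_ends G"

context wf_digraph begin

lemma acyclic_digraph_iff: "acyclic_digraph G \<longleftrightarrow> acyclic (arcs_ends G)"
proof -
  have "(\<exists>p. cycle p) \<longleftrightarrow> (\<exists>u. (u, u) \<in> (arcs_ends G)\<^sup>+)"
  proof
    assume "\<exists>p. cycle p"
    then show "\<exists>u. (u, u) \<in> (arcs_ends G)\<^sup>+"
      by (auto simp: cycle_def reachable1_awalk)
  next
    assume "\<exists>u. (u, u) \<in> (arcs_ends G)\<^sup>+"
    then obtain u p where "awalk u p u" "p \<noteq> []" by (auto simp: reachable1_awalk)
    then have "closed_w p" by (auto simp: closed_w_def)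
    then show "\<exists>p. cycle p" by (rule closed_w_imp_cycle)
  qed
  then show ?thesis by (simp add: acyclic_digraph_def acyclic_def)
qed

lemma acyclic_induce_subgraph_iff:
  "acyclic_digraph (G \<restriction> S) \<longleftrightarrow> acyclic_on (adj G) S"
proof -
  interpret H: wf_digraph "G \<restriction> S" by unfold_locales auto
  have "arcs_ends (G \<restriction> S) = {(x, y). x \<in> S \<and> y \<in> S \<and> adj G x y}"
    by (auto simp: arcs_ends_conv)
  then show ?thesis by (simp add: H.acyclic_digraph_iff acyclic_on_def)
qed

lemma dicoloring_iff:
  "dicoloring G k c \<longleftrightarrow>
    (\<forall>v\<in>verts G. c v \<in> {1..k}) \<and> (\<forall>i\<in>{1..k}. acyclic_on (adj G) {v \<in> verts G. c v = i})"
  by (simp add: dicoloring_def acyclic_induce_subgraph_iff)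

lemma dicoloring_mono:
  assumes "dicoloring G k c" "k \<le> l"
  shows "dicoloring G l c"
  unfolding dicoloring_iff
proof (intro conjI ballI)
  fix v assume "v \<in> verts G" then show "c v \<in> {1..l}" using assms by (fastforce simp: dicoloring_iff)
next
  fix i assume i: "i \<in> {1..l}"
  show "acyclic_on (adj G) {v \<in> verts G. c v = i}"
  proof (cases "i \<le> k")
    case True
    then show ?thesis using assms(1) i by (simp add: dicoloring_iff)
  next
    case False
    then have "{v \<in> verts G. c v = i} = {}" using assms(1) by (fastforce simp: dicoloring_iff)
    then show ?thesis by (simp only:) (simp add: acyclic_on_def acyclic_def)
  qed
qed

end

context digraph begin

text \<open>
  Giving every vertex its own color works because there are no loops.
\<close>

lemma ex_dicoloring: "\<exists>k c. dicoloring G k c"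
proof -
  obtain h where h: "bij_betw h (verts G) {0..<card (verts G)}"
    using ex_bij_betw_finite_nat[OF finite_verts] by blast
  have "dicoloring G (card (verts G)) (\<lambda>v. Suc (h v))"
    unfolding dicoloring_iff
  proof (intro conjI ballI)
    fix v assume "v \<in> verts G"
    then have "h v \<in> {0..<card (verts G)}" using h by (auto simp: bij_betw_def)
    then show "Suc (h v) \<in> {1..card (verts G)}" by simp
  next
    fix i
    have "\<not> adj G x y" if "x \<in> {v \<in> verts G. Suc (h v) = i}" "y \<in> {v \<in> verts G. Suc (h v) = i}" for x y
    proof -
      have "x = y" using that h by (auto simp: bij_betw_def inj_on_def)
      then show ?thesis using no_loops by (auto simp: arcs_ends_conv)
    qed
    then have "{(x, y). x \<in> {v \<in> verts G. Suc (h v) = i} \<and> y \<in> {v \<in> verts G. Suc (h v) = i} \<and> adj G x y} = {}"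
      by auto
    then show "acyclic_on (adj G) {v \<in> verts G. Suc (h v) = i}"
      unfolding acyclic_on_def by (simp only:) (simp add: acyclic_def)
  qed
  then show ?thesis by blast
qed

text \<open>
  The existence of some coloring is what makes \<open>dichromatic_number\<close> a true minimum.
\<close>

lemma dichromatic_number_le_iff: "dichromatic_number G \<le> k \<longleftrightarrow> (\<exists>c. dicoloring G k c)"
proof
  assume "dichromatic_number G \<le> k"
  moreover have "\<exists>c. dicoloring G (dichromatic_number G) c"
    unfolding dichromatic_number_def by (rule LeastI_ex) (rule ex_dicoloring)
  ultimately show "\<exists>c. dicoloring G k c" using dicoloring_mono by blast
next
  assume "\<exists>c. dicoloring G k c"
  then show "dichromatic_number G \<le> k"
    unfolding dichromatic_number_def by (rule Least_le)
qed

lemma dichromatic_number_le_2_iff: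
  "dichromatic_number G \<le> 2 \<longleftrightarrow>
    (\<exists>S\<subseteq>verts G. acyclic_on (adj G) S \<and> acyclic_on (adj G) (verts G - S))"
  unfolding dichromatic_number_le_iff
proof
  assume "\<exists>c. dicoloring G 2 c"
  then obtain c where c: "dicoloring G 2 c" ..
  then have "verts G - {v \<in> verts G. c v = 1} = {v \<in> verts G. c v = 2}"
    by (fastforce simp: dicoloring_iff)
  then show "\<exists>S\<subseteq>verts G. acyclic_on (adj G) S \<and> acyclic_on (adj G) (verts G - S)"
    using c by (intro exI[of _ "{v \<in> verts G. c v = 1}"]) (auto simp: dicoloring_iff)
next
  assume "\<exists>S\<subseteq>verts G. acyclic_on (adj G) S \<and> acyclic_on (adj G) (verts G - S)"
  then obtain S where S: "S \<subseteq> verts G" "acyclic_on (adj G) S" "acyclic_on (adj G) (verts G - S)"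
    by blast
  define c :: "'a \<Rightarrow> nat" where "c v = (if v \<in> S then 1 else 2)" for v
  have "{v \<in> verts G. c v = 1} = S" "{v \<in> verts G. c v = 2} = verts G - S"
    using S(1) by (auto simp: c_def)
  moreover have "{1..2} = {1, 2 :: nat}" by auto
  ultimately have "dicoloring G 2 c"
    using S by (auto simp: dicoloring_iff c_def)
  then show "\<exists>c. dicoloring G 2 c" by blast
qed

end

lemma subgraph_digraph:
  assumes "digraph G" "subgraph H G"
  shows "digraph H"
proof -
  interpret G: digraph G by fact
  have H: "verts H \<subseteq> verts G" "arcs H \<subseteq> arcs G" "tail H = tail G" "head H = head G" "wf_digraph H"
    using assms(2) by (auto simp: subgraph_def compatible_def)
  interpret H: wf_digraph H by fact
  show ?thesis
  proof
    show "finite (verts H)" "finite (arcs H)"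
      using H(1,2) G.finite_verts G.finite_arcs by (auto intro: finite_subset)
    show "tail H e \<noteq> head H e" if "e \<in> arcs H" for e using G.no_loops H that by auto
    show "e1 = e2" if "e1 \<in> arcs H" "e2 \<in> arcs H" "arc_to_ends H e1 = arc_to_ends H e2" for e1 e2
      using G.no_multi_arcs[of e1 e2] H that by (auto simp: arc_to_ends_def)
  qed
qed

lemma arcs_ends_subset: "wf_digraph G \<Longrightarrow> adj G x y \<Longrightarrow> x \<in> verts G \<and> y \<in> verts G"
  by (auto simp: arcs_ends_conv wf_digraph.tail_in_verts wf_digraph.head_in_verts)

lemma (in digraph) card_arcs_ends: "card (arcs_ends G) = card (arcs G)"
proof -
  have "inj_on (arc_to_ends G) (arcs G)" using no_multi_arcs by (auto simp: inj_on_def)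
  then show ?thesis by (simp add: arcs_ends_def card_image)
qed

lemma (in oriented_graph) vertex_critical_if_dicritical:
  assumes "dicritical 3 G" "card (arcs G) \<le> 20"
  shows "vertex_critical (verts G) (adj G)"
proof
  show "finite (verts G)" by simp
  show "\<not> adj G y x" if "adj G x y" for x y using no_2cycles that .
  have "\<not> dichromatic_number G \<le> 2" using assms(1) by (simp add: dicritical_def)
  then show "\<not> acyclic_on (adj G) (verts G - S)" if "S \<subseteq> verts G" "acyclic_on (adj G) S" for S
    using that by (auto simp: dichromatic_number_le_2_iff)
  show "\<exists>S\<subseteq>verts G - {v}. acyclic_on (adj G) S \<and> acyclic_on (adj G) (verts G - {v} - S)"
    if "v \<in> verts G" for v
  proof -
    let ?H = "G \<restriction> (verts G - {v})"
    have H: "subgraph ?H G"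
      unfolding subgraph_def compatible_def by (auto simp: wf_digraph intro!: wf_digraph.intro)
    then interpret H: digraph ?H using subgraph_digraph digraph_axioms by blast
    have "?H \<noteq> G" using that by (metis Diff_iff induce_subgraph_verts singletonI)
    then have "dichromatic_number ?H \<le> 2" using assms(1) H by (force simp: dicritical_def)
    then obtain S where S: "S \<subseteq> verts G - {v}" "acyclic_on (adj ?H) S" "acyclic_on (adj ?H) (verts G - {v} - S)"
      by (auto simp: H.dichromatic_number_le_2_iff)
    have "adj ?H x y" if "adj G x y" "x \<in> verts G - {v}" "y \<in> verts G - {v}" for x y
      using that by (auto simp: arcs_ends_conv)
    then have "acyclic_on (adj G) S" "acyclic_on (adj G) (verts G - {v} - S)"
      using S by (auto intro: acyclic_on_mono)
    then show ?thesis using S(1) by blast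
  qed
  have "{(x, y). x \<in> verts G \<and> y \<in> verts G \<and> adj G x y} = arcs_ends G"
    using arcs_ends_subset[OF wf_digraph] by auto
  then show "card {(x, y). x \<in> verts G \<and> y \<in> verts G \<and> adj G x y} \<le> 20"
    using assms(2) card_arcs_ends by simp
qed

section \<open>The extremal digraph\<close>

definition G0 :: "(nat, nat \<times> nat) pre_digraph" where
  "G0 = \<lparr>verts = {..<7}, arcs = set arcs0, tail = fst, head = snd\<rparr>"

lemma G0_simps [simp]: "verts G0 = {..<7}" "arcs G0 = set arcs0" "tail G0 = fst" "head G0 = snd"
  by (simp_all add: G0_def)

lemma arcs_ends_G0 [simp]: "arcs_ends G0 = set arcs0"
  by (simp add: arcs_ends_conv)

lemma oriented_graph_G0: "oriented_graph G0"
proof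
  have "list_all (\<lambda>(i, j). i < 7 \<and> j < 7 \<and> i \<noteq> j \<and> (j, i) \<notin> set arcs0) arcs0"
    by (simp add: arcs0_def)
  then have *: "i < 7 \<and> j < 7 \<and> i \<noteq> j \<and> (j, i) \<notin> set arcs0" if "(i, j) \<in> set arcs0" for i j
    using that by (auto simp: list_all_iff)
  show "tail G0 e \<in> verts G0" "head G0 e \<in> verts G0" "tail G0 e \<noteq> head G0 e" if "e \<in> arcs G0" for e
    using that *[of "fst e" "snd e"] by auto
  show "(v, u) \<notin> arcs_ends G0" if "(u, v) \<in> arcs_ends G0" for u v using * that by simp
  show "finite (verts G0)" "finite (arcs G0)" by simp_all
  show "e1 = e2" if "e1 \<in> arcs G0" "e2 \<in> arcs G0" "arc_to_ends G0 e1 = arc_to_ends G0 e2" for e1 e2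
    using that by (auto simp: arc_to_ends_def prod_eq_iff)
qed

lemma not_acyclic_on_triangle:
  assumes "acyclic_on r S" "r a b" "r b c" "r c a"
  shows "\<not> (a \<in> S \<and> b \<in> S \<and> c \<in> S)"
proof
  assume "a \<in> S \<and> b \<in> S \<and> c \<in> S"
  then have "(a, b) \<in> {(x, y). x \<in> S \<and> y \<in> S \<and> r x y}" "(b, c) \<in> {(x, y). x \<in> S \<and> y \<in> S \<and> r x y}"
      "(c, a) \<in> {(x, y). x \<in> S \<and> y \<in> S \<and> r x y}"
    using assms(2-4) by auto
  then have "(a, a) \<in> {(x, y). x \<in> S \<and> y \<in> S \<and> r x y}\<^sup>+"
    by (meson r_into_trancl trancl_trans)
  then show False using assms(1) by (auto simp: acyclic_on_def acyclic_def)
qed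

text \<open>
  The ten directed triangles used here form a hypergraph that has no proper coloring with two
  colors.
\<close>

lemma dichromatic_number_G0: "3 \<le> dichromatic_number G0"
proof -
  interpret oriented_graph G0 by (rule oriented_graph_G0)
  have False if S: "S \<subseteq> verts G0" "acyclic_on (adj G0) S" "acyclic_on (adj G0) (verts G0 - S)" for S
  proof -
    have tri: "\<not> (a \<in> S \<and> b \<in> S \<and> c \<in> S)" "\<not> (a \<notin> S \<and> b \<notin> S \<and> c \<notin> S)"
      if "(a, b) \<in> set arcs0" "(b, c) \<in> set arcs0" "(c, a) \<in> set arcs0" "a < 7" "b < 7" "c < 7" for a b c
      using not_acyclic_on_triangle[OF S(2), of a b c] not_acyclic_on_triangle[OF S(3), of a b c] that by auto
    show False
      using tri[of 0 1 2] tri[of 0 3 5] tri[of 0 4 2] tri[of 0 4 5] tri[of 1 2 5] tri[of 1 3 6]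
        tri[of 1 4 5] tri[of 1 4 6] tri[of 2 3 4] tri[of 2 5 6]
      by (simp add: arcs0_def) argo
  qed
  then have "\<not> dichromatic_number G0 \<le> 2" by (auto simp: dichromatic_number_le_2_iff)
  then show ?thesis by simp
qed

text \<open>
  For each arc, an ordered bipartition of the vertices in which that arc is the only backward arc.
\<close>

definition removal_orders :: "((nat \<times> nat) \<times> nat list \<times> nat list) list" where
  "removal_orders =
    [((0,1), [1,2,0], [3,4,5,6]), ((0,3), [1,4,2], [3,5,0,6]), ((0,4), [1,2,3], [4,5,0,6]),
     ((1,2), [2,0,1], [3,4,5,6]), ((1,3), [4,2,5], [0,3,6,1]), ((1,4), [2,0,3], [4,5,6,1]),
     ((2,0), [0,1,2], [3,4,5,6]), ((2,3), [3,4,2], [5,0,6,1]), ((2,5), [0,1,3], [4,5,6,2]),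
     ((3,4), [4,2,3], [5,0,6,1]), ((3,5), [1,4,2], [5,0,3,6]), ((3,6), [4,2,5], [0,6,1,3]),
     ((4,2), [2,3,4], [5,0,6,1]), ((4,5), [1,2,3], [5,0,4,6]), ((4,6), [2,3,5], [0,6,1,4]),
     ((5,0), [1,2], [0,3,4,5,6]), ((5,1), [1,2,5], [0,3,4,6]), ((5,6), [0,1,3], [4,6,2,5]),
     ((6,1), [2,5], [0,1,3,4,6]), ((6,2), [0,1,3], [4,2,5,6])]"

lemma G0_minus_arc:
  assumes "e \<in> set arcs0"
  obtains S where "S \<subseteq> {..<7}" "acyclic_on (\<lambda>x y. (x, y) \<in> set arcs0 - {e}) S"
    "acyclic_on (\<lambda>x y. (x, y) \<in> set arcs0 - {e}) ({..<7} - S)"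
proof -
  let ?r = "\<lambda>e x y. (x, y) \<in> set arcs0 \<and> (x, y) \<noteq> e"
  have "map fst removal_orders = arcs0" by (simp add: removal_orders_def arcs0_def)
  then obtain xs ys where *: "(e, xs, ys) \<in> set removal_orders"
    using assms by (metis (no_types, lifting) imageE list.set_map prod.collapse)
  define ok where "ok = (\<lambda>(e, xs, ys). set (xs @ ys) = {0, 1, 2, 3, 4, 5, 6} \<and> distinct (xs @ ys) \<and>
      \<not> has_back (?r e) xs \<and> \<not> has_back (?r e) ys)"
  have "list_all ok removal_orders"
    unfolding ok_def by code_simp
  then have "ok (e, xs, ys)" using * by (simp add: list_all_iff)
  then have **: "set (xs @ ys) = {0, 1, 2, 3, 4, 5, 6}" "distinct (xs @ ys)"
      "\<not> has_back (?r e) xs" "\<not> has_back (?r e) ys"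
    by (simp_all add: ok_def)
  have "{0, 1, 2, 3, 4, 5, 6} = {..<7 :: nat}" by auto
  then have "set xs \<union> set ys = {..<7}" using **(1) by simp
  then have "set ys = {..<7} - set xs" "set xs \<subseteq> {..<7}" using **(2) by auto
  moreover have "\<not> ?r e x x" for x by (auto simp: arcs0_def)
  then have "acyclic_on (?r e) (set xs)" "acyclic_on (?r e) (set ys)"
    using **(3,4) by (auto intro: acyclic_on_if_not_has_back)
  ultimately show thesis using that[of "set xs"] by simp
qed

text \<open>
  As \<open>G0\<close> has no isolated vertex, a proper subgraph misses an arc.
\<close>

lemma dicritical_G0: "dicritical 3 G0"
  unfolding dicritical_def
proof (intro conjI allI impI)
  interpret oriented_graph G0 by (rule oriented_graph_G0)
  show "fin_digraph G0" by unfold_locales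
  show "3 \<le> dichromatic_number G0" by (rule dichromatic_number_G0)
  fix H :: "(nat, nat \<times> nat) pre_digraph" assume *: "subgraph H G0 \<and> H \<noteq> G0"
  then have H: "verts H \<subseteq> {..<7}" "arcs H \<subseteq> set arcs0" "tail H = fst" "head H = snd" "wf_digraph H"
    by (auto simp: subgraph_def compatible_def)
  interpret H: digraph H using subgraph_digraph digraph_axioms * by blast
  have "arcs H \<noteq> set arcs0"
  proof
    assume eq: "arcs H = set arcs0"
    have "x \<in> verts H" if "x < 7" for x
    proof -
      have "x \<in> fst ` set arcs0" using that by (simp add: arcs0_def) linarith
      then show ?thesis using H.tail_in_verts H(3) eq by auto
    qed
    then have "verts H = {..<7}" using H(1) by auto
    then show False using * H eq by (simp add: pre_digraph.equality)
  qed
  then obtain e where e: "e \<in> set arcs0" "e \<notin> arcs H" using H(2) by auto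
  have adj: "(x, y) \<in> set arcs0 - {e}" if "adj H x y" for x y
    using that H(2-4) e by (auto simp: arcs_ends_conv)
  obtain S where S: "S \<subseteq> {..<7}" "acyclic_on (\<lambda>x y. (x, y) \<in> set arcs0 - {e}) S"
      "acyclic_on (\<lambda>x y. (x, y) \<in> set arcs0 - {e}) ({..<7} - S)"
    using G0_minus_arc[OF e(1)] .
  have "acyclic_on (adj H) (S \<inter> verts H)"
    by (rule acyclic_on_mono[OF acyclic_on_subset[OF S(2)]]) (use adj in auto)
  moreover have "acyclic_on (adj H) (verts H - S \<inter> verts H)"
    by (rule acyclic_on_mono[OF acyclic_on_subset[OF S(3)]]) (use adj H(1) in auto)
  ultimately have "dichromatic_number H \<le> 2"
    unfolding H.dichromatic_number_le_2_iff by (intro exI[of _ "S \<inter> verts H"]) auto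
  then show "dichromatic_number H < 3" by simp
qed

lemma (in oriented_graph) digraph_iso_G0:
  assumes "dicritical 3 G" "card (arcs G) \<le> 20"
  shows "digraph_iso G G0"
proof -
  interpret vertex_critical "verts G" "adj G"
    using vertex_critical_if_dicritical[OF assms] .
  obtain vs where vs: "distinct vs" "set vs = verts G" "length vs = 7"
    and ends: "{(x, y). x \<in> verts G \<and> y \<in> verts G \<and> adj G x y} = (\<lambda>(i, j). (vs ! i, vs ! j)) ` set arcs0"
    by (rule arcs_unique)
  have "{(x, y). x \<in> verts G \<and> y \<in> verts G \<and> adj G x y} = arcs_ends G"
    using arcs_ends_subset[OF wf_digraph] by auto
  with ends have ends: "arcs_ends G = (\<lambda>(i, j). (vs ! i, vs ! j)) ` set arcs0" by simp
  have lt: "i < 7 \<and> j < 7" if "(i, j) \<in> set arcs0" for i j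
    using that by (auto simp: arcs0_def)
  define g where "g = the_inv_into {..<7} ((!) vs)"
  have inj: "inj_on ((!) vs) {..<7}" and img: "(!) vs ` {..<7} = verts G"
    using bij_betw_nth[OF vs(1), of "{..<7}" "verts G"] vs by (auto simp: bij_betw_def)
  have g: "g (vs ! i) = i" if "i < 7" for i
    unfolding g_def using the_inv_into_f_f[OF inj] that by simp
  define f where "f = \<lparr>iso_verts = g, iso_arcs = (\<lambda>a. (g (tail G a), g (head G a))),
    iso_head = snd, iso_tail = fst\<rparr>"
  have "inj_on g (verts G)" using g unfolding img[symmetric] by (auto simp: inj_on_def)
  moreover from this have "inj_on (\<lambda>a. (g (tail G a), g (head G a))) (arcs G)"
    using no_multi_arcs by (auto simp: inj_on_def arc_to_ends_def)
  ultimately have "digraph_isomorphism f"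
    by (simp add: digraph_isomorphism_def f_def wf_digraph)
  moreover have "G0 = app_iso f G"
  proof -
    have "g ` verts G = {..<7}" using g unfolding img[symmetric] by (auto simp: image_iff)
    moreover have "(\<lambda>a. (g (tail G a), g (head G a))) ` arcs G = set arcs0"
    proof -
      have "(\<lambda>a. (g (tail G a), g (head G a))) ` arcs G = map_prod g g ` arcs_ends G"
        by (simp add: arcs_ends_conv image_image)
      also have "\<dots> = (\<lambda>(i, j). (g (vs ! i), g (vs ! j))) ` set arcs0"
        unfolding ends by (simp add: image_image case_prod_unfold)
      also have "\<dots> = (\<lambda>p. p) ` set arcs0"
        by (rule image_cong) (use g lt in auto)
      finally show ?thesis by simp
    qed
    ultimately show ?thesis by (simp add: G0_def app_iso_def f_def)
  qed
  ultimately show ?thesis unfolding digraph_iso_def by blast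
qed

theorem corollary4p2:
  shows "\<exists>G\<^sub>0 :: (nat, nat \<times> nat) pre_digraph.
    oriented_graph G\<^sub>0 \<and> dicritical 3 G\<^sub>0 \<and> card (arcs G\<^sub>0) = 20 \<and>
    (\<forall>G :: ('a, 'b) pre_digraph. oriented_graph G \<and> dicritical 3 G \<longrightarrow>
       digraph_iso G G\<^sub>0 \<or> card (arcs G) > 20)"
proof (intro exI conjI allI impI)
  show "card (arcs G0) = 20" by (simp add: arcs0_def)
  show "digraph_iso G G0 \<or> card (arcs G) > 20" if "oriented_graph G \<and> dicritical 3 G"
    for G :: "('a, 'b) pre_digraph"
    using oriented_graph.digraph_iso_G0[of G] that by fastforce
qed (rule oriented_graph_G0 dicritical_G0)+

end
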